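(* For every countable limit ordinal $\lambda$ there is a countable linear ordering whose Scott sentence complexity is $\Sigma^{\mathrm{in}}_{\lambda+2}$.
   Context: Infinitary formulas: $\Sigma^{\mathrm{in}}_0=\Pi^{\mathrm{in}}_0$ are the finitary quantifier-free formulas; for $\alpha\ge1$, a $\Sigma^{\mathrm{in}}_\alpha$ formula is a countable disjunction of formulas $\exists\bar x\,\varphi$ with $\varphi\in\Pi^{\mathrm{in}}_\beta$, $\beta<\alpha$, and $\Pi^{\mathrm{in}}_\alpha$ is dual; $d\text{-}\Sigma^{\mathrm{in}}_\alpha$ formulas are conjunctions of a $\Sigma^{\mathrm{in}}_\alpha$ and a $\Pi^{\mathrm{in}}_\alpha$ formula. A Scott sentence of a countable structure is an $L_{\omega_1\omega}$ sentence whose countable models are exactly its isomorphic copies. The Scott sentence complexity of a structure is the least class among $\Pi^{\mathrm{in}}_\alpha,\Sigma^{\mathrm{in}}_\alpha,d\text{-}\Sigma^{\mathrm{in}}_\alpha$ ($\alpha\ge1$) in which it has a Scott sentence, classes ordered by inclusion up to equivalence ($\Pi_\alpha,\Sigma_\alpha\subseteq d\text{-}\Sigma_\alpha\subseteq \Sigma_{\alpha+1}\cap\Pi_{\alpha+1}$). *)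

theory Defs
  imports Main "HOL-Library.Countable_Set"
begin

section \<open>Countable ordinals\<close>

text \<open>The countable ordinals are the elements of \<open>\<omega>\<^sub>1\<close>, the initial ordinal
  \<^term>\<open>cardSuc natLeq\<close>. The lemmas \<open>countable_below\<close>, \<open>no_largest\<close> and
  \<open>countable_wellorder_represented\<close> below show that this type contains a representative of every
  countable well-order type and nothing else.\<close>

lemma Well_order_omega1: "Well_order (cardSuc natLeq)"
  by (rule cardSuc_Well_order[OF natLeq_Card_order])

typedef omega1 = "Field (cardSuc natLeq)"
  using Field_cardSuc_not_empty[OF natLeq_Card_order] by blast

instantiation omega1 :: wellorder
begin

definition less_eq_omega1 :: "omega1 \<Rightarrow> omega1 \<Rightarrow> bool" where
  "a \<le> b \<longleftrightarrow> (Rep_omega1 a, Rep_omega1 b) \<in> cardSuc natLeq"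

definition less_omega1 :: "omega1 \<Rightarrow> omega1 \<Rightarrow> bool" where
  "a < b \<longleftrightarrow> a \<le> b \<and> a \<noteq> (b :: omega1)"

instance
proof
  let ?r = "cardSuc natLeq"
  have w: "refl_on (Field ?r) ?r" "trans ?r" "antisym ?r" "total_on (Field ?r) ?r" "wf (?r - Id)"
    using Well_order_omega1 by (auto simp: order_on_defs)
  fix x y z :: omega1
  show "x \<le> x"
    using w(1) Rep_omega1[of x] by (auto simp: less_eq_omega1_def refl_on_def)
  show "x \<le> y \<Longrightarrow> y \<le> z \<Longrightarrow> x \<le> z"
    unfolding less_eq_omega1_def using w(2) by (meson transD)
  show "x \<le> y \<Longrightarrow> y \<le> x \<Longrightarrow> x = y"
    unfolding less_eq_omega1_def by (metis antisymD w(3) Rep_omega1_inject)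
  show "(x < y) = (x \<le> y \<and> \<not> y \<le> x)"
    unfolding less_eq_omega1_def less_omega1_def
    by (metis antisymD refl_onD w(1,3) Rep_omega1 Rep_omega1_inject)
  show "x \<le> y \<or> y \<le> x"
    using w(1,4) Rep_omega1[of x] Rep_omega1[of y]
    by (cases "x = y") (auto simp: less_eq_omega1_def total_on_def refl_on_def Rep_omega1_inject)
  fix P :: "omega1 \<Rightarrow> bool" and a :: omega1
  assume step: "\<And>x. (\<And>y. y < x \<Longrightarrow> P y) \<Longrightarrow> P x"
  have "wf (inv_image (?r - Id) Rep_omega1)"
    using w(5) by (rule wf_inv_image)
  then show "P a"
  proof (induction a rule: wf_induct_rule)
    case (less x)
    show ?case
      by (rule step, rule less)
        (auto simp: inv_image_def less_omega1_def less_eq_omega1_def Rep_omega1_inject)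
  qed
qed

end

instantiation omega1 :: zero
begin

definition zero_omega1 :: omega1 where
  "0 = (LEAST a :: omega1. True)"

instance ..

end

definition succ_ord :: "omega1 \<Rightarrow> omega1" where
  "succ_ord a = (LEAST b. a < b)"

definition limit_ord :: "omega1 \<Rightarrow> bool" where
  "limit_ord a \<longleftrightarrow> a \<noteq> 0 \<and> (\<nexists>b. a = succ_ord b)"

lemma countable_below: "countable {..<a :: omega1}"
proof -
  include cardinal_syntax
  let ?r = "cardSuc natLeq"
  have "|underS ?r (Rep_omega1 a)| <o ?r"
    using card_of_underS[OF cardSuc_Card_order[OF natLeq_Card_order] Rep_omega1] .
  then have "|underS ?r (Rep_omega1 a)| \<le>o natLeq"
    using cardSuc_ordLeq_ordLess[OF natLeq_Card_order card_of_Card_order] by blast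
  then have "|underS ?r (Rep_omega1 a)| \<le>o |UNIV :: nat set|"
    using ordLeq_ordIso_trans card_of_nat ordIso_symmetric by blast
  then have "countable (underS ?r (Rep_omega1 a))"
    unfolding countable_def card_of_ordLeq[symmetric] by blast
  moreover have "Rep_omega1 ` {..<a} \<subseteq> underS ?r (Rep_omega1 a)"
    by (auto simp: underS_def less_omega1_def less_eq_omega1_def Rep_omega1_inject)
  ultimately have "countable (Rep_omega1 ` {..<a})"
    by (rule countable_subset[rotated])
  then show ?thesis
    by (rule countable_image_inj_on) (auto simp: inj_on_def Rep_omega1_inject)
qed

lemma no_largest: "\<exists>b. (a :: omega1) < b"
proof -
  have inf: "infinite (Field (cardSuc natLeq))"
    using cardSuc_finite[OF natLeq_Card_order] Field_natLeq infinite_UNIV_nat by simp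
  obtain b where "b \<in> Field (cardSuc natLeq)" "Rep_omega1 a \<noteq> b" "(Rep_omega1 a, b) \<in> cardSuc natLeq"
    using infinite_Card_order_limit[OF cardSuc_Card_order[OF natLeq_Card_order] inf Rep_omega1] by blast
  then have "a < Abs_omega1 b"
    by (auto simp: less_omega1_def less_eq_omega1_def Abs_omega1_inverse)
  then show ?thesis ..
qed

lemma less_succ_ord_iff: "a < succ_ord b \<longleftrightarrow> a \<le> b"
proof
  show "a < succ_ord b \<Longrightarrow> a \<le> b"
    unfolding succ_ord_def using not_less_Least by fastforce
  have "b < succ_ord b"
    unfolding succ_ord_def using no_largest by (metis LeastI_ex)
  then show "a \<le> b \<Longrightarrow> a < succ_ord b" by simp
qed

lemma countable_wellorder_represented:
  assumes "Well_order r" and "countable (Field r)"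
  shows "\<exists>(a :: omega1) f. bij_betw f (Field r) {..<a} \<and>
           (\<forall>x\<in>Field r. \<forall>y\<in>Field r. (x, y) \<in> r \<longleftrightarrow> f x \<le> f y)"
proof -
  include cardinal_syntax
  let ?r = "cardSuc natLeq"
  have "|Field r| \<le>o natLeq"
    using assms(2) card_of_ordLeq[of "Field r" "UNIV :: nat set"] card_of_nat ordLeq_ordIso_trans
    unfolding countable_def by blast
  then have lt: "|Field r| <o ?r"
    using cardSuc_ordLeq_ordLess[OF natLeq_Card_order card_of_Card_order] by blast
  have "r <o ?r"
  proof (rule ccontr)
    assume "\<not> r <o ?r"
    then have "?r \<le>o r"
      using assms(1) Well_order_omega1 not_ordLess_iff_ordLeq by blast
    then have "|Field ?r| \<le>o |Field r|"
      by (rule card_of_mono2)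
    moreover have "?r =o |Field ?r|"
      using Card_order_iff_ordIso_card_of cardSuc_Card_order natLeq_Card_order by blast
    ultimately have "?r \<le>o |Field r|"
      using ordIso_ordLeq_trans by blast
    then show False
      using lt not_ordLess_ordLeq by blast
  qed
  then obtain c where c: "c \<in> Field ?r" and "r =o Restr ?r (underS ?r c)"
    using ordLess_iff_ordIso_Restr[OF Well_order_omega1 assms(1)] by blast
  then obtain g where g: "iso r (Restr ?r (underS ?r c)) g"
    unfolding ordIso_def by blast
  let ?a = "Abs_omega1 c"
  have fR: "Field (Restr ?r (underS ?r c)) = underS ?r c"
    using Well_order_omega1 by (intro Refl_Field_Restr2) (auto simp: order_on_defs underS_def Field_def)
  have bij: "bij_betw g (Field r) (underS ?r c)"
    using g fR unfolding iso_def by simp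
  have cmp: "(x, y) \<in> r \<longleftrightarrow> (g x, g y) \<in> ?r" if "x \<in> Field r" "y \<in> Field r" for x y
  proof -
    have "(x, y) \<in> r \<longleftrightarrow> (g x, g y) \<in> Restr ?r (underS ?r c)"
      using g that unfolding iso_iff2 by blast
    moreover have "g x \<in> underS ?r c" "g y \<in> underS ?r c"
      using bij that by (auto simp: bij_betw_def)
    ultimately show ?thesis by blast
  qed
  have sub: "underS ?r c \<subseteq> Field ?r"
    by (auto simp: underS_def Field_def)
  have bij2: "bij_betw Abs_omega1 (underS ?r c) {..<?a}"
  proof (rule bij_betw_byWitness[where f' = Rep_omega1])
    show "\<forall>x\<in>underS ?r c. Rep_omega1 (Abs_omega1 x) = x"
      using sub Abs_omega1_inverse by blast
    show "\<forall>x\<in>{..<?a}. Abs_omega1 (Rep_omega1 x) = x"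
      by (simp add: Rep_omega1_inverse)
    show "Abs_omega1 ` underS ?r c \<subseteq> {..<?a}"
    proof
      fix z assume "z \<in> Abs_omega1 ` underS ?r c"
      then obtain x where x: "x \<in> underS ?r c" "z = Abs_omega1 x" by blast
      then have "x \<in> Field ?r" using sub by blast
      then show "z \<in> {..<?a}"
        using x c by (auto simp: underS_def less_omega1_def less_eq_omega1_def
            Abs_omega1_inverse Abs_omega1_inject)
    qed
    show "Rep_omega1 ` {..<?a} \<subseteq> underS ?r c"
      using c by (auto simp: underS_def less_omega1_def less_eq_omega1_def
          Abs_omega1_inverse Rep_omega1_inverse)
  qed
  have "bij_betw (Abs_omega1 \<circ> g) (Field r) {..<?a}"
    using bij bij2 by (rule bij_betw_trans)
  moreover have "(x, y) \<in> r \<longleftrightarrow> (Abs_omega1 \<circ> g) x \<le> (Abs_omega1 \<circ> g) y"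
    if "x \<in> Field r" "y \<in> Field r" for x y
  proof -
    have "g x \<in> Field ?r" "g y \<in> Field ?r"
      using bij sub that by (auto simp: bij_betw_def)
    then show ?thesis
      using cmp[OF that] by (simp add: less_eq_omega1_def Abs_omega1_inverse)
  qed
  ultimately show ?thesis by blast
qed


section \<open>Infinitary formulas in the language of one binary relation\<close>

text \<open>Variables are natural numbers. Countable connectives are indexed by \<^typ>\<open>nat\<close>; finite ones
  arise by repetition and the empty ones from \<open>Bot\<close>. The binary connectives are needed to speak
  of finitary quantifier-free formulas.\<close>

datatype form =
    Bot
  | Eq nat nat
  | Le nat nat
  | Neg form
  | And form form
  | Or form form
  | Conj "nat \<Rightarrow> form"
  | Disj "nat \<Rightarrow> form"
  | Ex nat form
  | All nat form

primrec fv :: "form \<Rightarrow> nat set" where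
  "fv Bot = {}"
| "fv (Eq x y) = {x, y}"
| "fv (Le x y) = {x, y}"
| "fv (Neg \<phi>) = fv \<phi>"
| "fv (And \<phi> \<psi>) = fv \<phi> \<union> fv \<psi>"
| "fv (Or \<phi> \<psi>) = fv \<phi> \<union> fv \<psi>"
| "fv (Conj \<Phi>) = (\<Union>i. fv (\<Phi> i))"
| "fv (Disj \<Phi>) = (\<Union>i. fv (\<Phi> i))"
| "fv (Ex x \<phi>) = fv \<phi> - {x}"
| "fv (All x \<phi>) = fv \<phi> - {x}"

definition sentence :: "form \<Rightarrow> bool" where
  "sentence \<phi> \<longleftrightarrow> fv \<phi> = {}"

text \<open>A structure is given by its domain \<open>A\<close> and a relation \<open>R\<close>, of which only the restriction to
  \<open>A\<close> matters.\<close>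

primrec sat :: "'a set \<Rightarrow> 'a rel \<Rightarrow> form \<Rightarrow> (nat \<Rightarrow> 'a) \<Rightarrow> bool" where
  "sat A R Bot e \<longleftrightarrow> False"
| "sat A R (Eq x y) e \<longleftrightarrow> e x = e y"
| "sat A R (Le x y) e \<longleftrightarrow> (e x, e y) \<in> R"
| "sat A R (Neg \<phi>) e \<longleftrightarrow> \<not> sat A R \<phi> e"
| "sat A R (And \<phi> \<psi>) e \<longleftrightarrow> sat A R \<phi> e \<and> sat A R \<psi> e"
| "sat A R (Or \<phi> \<psi>) e \<longleftrightarrow> sat A R \<phi> e \<or> sat A R \<psi> e"
| "sat A R (Conj \<Phi>) e \<longleftrightarrow> (\<forall>i. sat A R (\<Phi> i) e)"
| "sat A R (Disj \<Phi>) e \<longleftrightarrow> (\<exists>i. sat A R (\<Phi> i) e)"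
| "sat A R (Ex x \<phi>) e \<longleftrightarrow> (\<exists>a\<in>A. sat A R \<phi> (e(x := a)))"
| "sat A R (All x \<phi>) e \<longleftrightarrow> (\<forall>a\<in>A. sat A R \<phi> (e(x := a)))"

definition models :: "'a set \<Rightarrow> 'a rel \<Rightarrow> form \<Rightarrow> bool" where
  "models A R \<phi> \<longleftrightarrow> (\<forall>e. range e \<subseteq> A \<longrightarrow> sat A R \<phi> e)"

primrec finitary_qf :: "form \<Rightarrow> bool" where
  "finitary_qf Bot \<longleftrightarrow> True"
| "finitary_qf (Eq x y) \<longleftrightarrow> True"
| "finitary_qf (Le x y) \<longleftrightarrow> True"
| "finitary_qf (Neg \<phi>) \<longleftrightarrow> finitary_qf \<phi>"
| "finitary_qf (And \<phi> \<psi>) \<longleftrightarrow> finitary_qf \<phi> \<and> finitary_qf \<psi>"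
| "finitary_qf (Or \<phi> \<psi>) \<longleftrightarrow> finitary_qf \<phi> \<and> finitary_qf \<psi>"
| "finitary_qf (Conj \<Phi>) \<longleftrightarrow> False"
| "finitary_qf (Disj \<Phi>) \<longleftrightarrow> False"
| "finitary_qf (Ex x \<phi>) \<longleftrightarrow> False"
| "finitary_qf (All x \<phi>) \<longleftrightarrow> False"

definition Exs :: "nat list \<Rightarrow> form \<Rightarrow> form" where
  "Exs xs \<phi> = foldr Ex xs \<phi>"

definition Alls :: "nat list \<Rightarrow> form \<Rightarrow> form" where
  "Alls xs \<phi> = foldr All xs \<phi>"

inductive Sigma_in :: "omega1 \<Rightarrow> form \<Rightarrow> bool" and Pi_in :: "omega1 \<Rightarrow> form \<Rightarrow> bool" where
  Sigma_zero: "finitary_qf \<phi> \<Longrightarrow> Sigma_in 0 \<phi>"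
| Pi_zero: "finitary_qf \<phi> \<Longrightarrow> Pi_in 0 \<phi>"
| Sigma_pos: "(\<And>i. \<beta> i < \<alpha> \<and> Pi_in (\<beta> i) (\<Phi> i)) \<Longrightarrow> Sigma_in \<alpha> (Disj (\<lambda>i. Exs (xs i) (\<Phi> i)))"
| Pi_pos: "(\<And>i. \<beta> i < \<alpha> \<and> Sigma_in (\<beta> i) (\<Phi> i)) \<Longrightarrow> Pi_in \<alpha> (Conj (\<lambda>i. Alls (xs i) (\<Phi> i)))"

definition dSigma_in :: "omega1 \<Rightarrow> form \<Rightarrow> bool" where
  "dSigma_in \<alpha> \<chi> \<longleftrightarrow> (\<exists>\<phi> \<psi>. \<chi> = And \<phi> \<psi> \<and> Sigma_in \<alpha> \<phi> \<and> Pi_in \<alpha> \<psi>)"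


section \<open>Scott sentences and Scott sentence complexity\<close>

definition isomorphic :: "'a set \<Rightarrow> 'a rel \<Rightarrow> 'b set \<Rightarrow> 'b rel \<Rightarrow> bool" where
  "isomorphic A R B S \<longleftrightarrow>
     (\<exists>f. bij_betw f A B \<and> (\<forall>x\<in>A. \<forall>y\<in>A. (x, y) \<in> R \<longleftrightarrow> (f x, f y) \<in> S))"

text \<open>Up to isomorphism, the countable structures are the ones whose domain is a nonempty set of
  natural numbers.\<close>

definition scott_sentence :: "'a set \<Rightarrow> 'a rel \<Rightarrow> form \<Rightarrow> bool" where
  "scott_sentence A R \<phi> \<longleftrightarrow> sentence \<phi> \<and>
     (\<forall>(B :: nat set) S. B \<noteq> {} \<longrightarrow> (models B S \<phi> \<longleftrightarrow> isomorphic A R B S))"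

datatype complexity = SigmaC omega1 | PiC omega1 | dSigmaC omega1

primrec complexity_index :: "complexity \<Rightarrow> omega1" where
  "complexity_index (SigmaC \<alpha>) = \<alpha>"
| "complexity_index (PiC \<alpha>) = \<alpha>"
| "complexity_index (dSigmaC \<alpha>) = \<alpha>"

primrec in_class :: "complexity \<Rightarrow> form \<Rightarrow> bool" where
  "in_class (SigmaC \<alpha>) = Sigma_in \<alpha>"
| "in_class (PiC \<alpha>) = Pi_in \<alpha>"
| "in_class (dSigmaC \<alpha>) = dSigma_in \<alpha>"

text \<open>By the downward Loewenheim-Skolem theorem for \<open>L\<^sub>\<omega>\<^sub>1\<^sub>\<omega>\<close>, sentences that agree on all countable
  structures agree on all structures.\<close>

definition equivalent :: "form \<Rightarrow> form \<Rightarrow> bool" where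
  "equivalent \<phi> \<psi> \<longleftrightarrow> (\<forall>(B :: nat set) S. B \<noteq> {} \<longrightarrow> (models B S \<phi> \<longleftrightarrow> models B S \<psi>))"

text \<open>Inclusion up to equivalence is taken on sentences, the only formulas relevant here; this
  avoids formulas with infinitely many free variables.\<close>

definition class_le :: "complexity \<Rightarrow> complexity \<Rightarrow> bool" where
  "class_le \<Gamma> \<Delta> \<longleftrightarrow>
     (\<forall>\<phi>. sentence \<phi> \<and> in_class \<Gamma> \<phi> \<longrightarrow> (\<exists>\<psi>. sentence \<psi> \<and> in_class \<Delta> \<psi> \<and> equivalent \<phi> \<psi>))"

definition has_scott_sentence_in :: "'a set \<Rightarrow> 'a rel \<Rightarrow> complexity \<Rightarrow> bool" where
  "has_scott_sentence_in A R \<Gamma> \<longleftrightarrow> (\<exists>\<phi>. in_class \<Gamma> \<phi> \<and> scott_sentence A R \<phi>)"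

definition scott_sentence_complexity :: "'a set \<Rightarrow> 'a rel \<Rightarrow> complexity \<Rightarrow> bool" where
  "scott_sentence_complexity A R \<Gamma> \<longleftrightarrow>
     0 < complexity_index \<Gamma> \<and> has_scott_sentence_in A R \<Gamma> \<and>
     (\<forall>\<Delta>. 0 < complexity_index \<Delta> \<and> has_scott_sentence_in A R \<Delta> \<longrightarrow> class_le \<Gamma> \<Delta>)"

end

theory Submission
  imports Defs "HOL-Library.Multiset_Order" "HOL-Analysis.Continuum_Not_Denumerable"
begin

text \<open>Call a copy of \<open>\<omega>\<^bsup>\<gamma>\<^esup> + 1\<close> a block of label \<open>\<gamma>\<close>, and let \<open>Q\<^sub>\<beta>\<close> be the dense order without
  endpoints in which each element is replaced by a block of label \<open>\<gamma> \<le> \<beta>\<close>, every label occurring densely;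
  let \<open>Q\<^sub>\<lambda>\<close> be the same with all labels \<open>\<gamma> < \<lambda>\<close>. Put \<open>T = \<dots> + Q\<^sub>\<beta> + \<dots> + Q\<^sub>1 + Q\<^sub>0\<close>, summed over \<open>\<beta> < \<lambda>\<close> in
  decreasing order. The order of complexity \<open>\<Sigma>\<^bsub>\<lambda> + 2\<^esub>\<close> is \<open>A = Q\<^sub>\<lambda> + (\<omega>\<^bsup>0\<^esup> + 1) + T\<close>.

  Given the least element \<open>p\<close> of the middle block as a parameter, \<open>A\<close> is described up to isomorphism by a
  \<open>\<Pi>\<^bsub>\<lambda> + 1\<^esub>\<close> formula: blocks of label \<open>\<gamma> < \<lambda>\<close> are definable at levels below \<open>\<lambda>\<close>, and each \<open>Q\<^sub>\<beta>\<close> in \<open>T\<close>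
  consists of the blocks after \<open>p\<close> whose final segment has the labels up to \<open>\<beta>\<close>. Quantifying \<open>p\<close> gives a
  \<open>\<Sigma>\<^bsub>\<lambda> + 2\<^esub>\<close> Scott sentence.

  There is no simpler one because \<open>B = Q\<^sub>\<lambda> + T\<close>, in which no parameter \<open>p\<close> as above exists, satisfies
  every \<open>\<Pi>\<^bsub>\<lambda> + 2\<^esub>\<close> sentence true in \<open>A\<close>. Cutting \<open>Q\<^sub>\<lambda>\<close> at a block of label \<open>0\<close> embeds \<open>A\<close> into \<open>B\<close> as
  \<open>Q\<^sub>\<lambda> + (\<omega>\<^bsup>0\<^esup> + 1)\<close> followed by \<open>T\<close>, omitting the rest of \<open>Q\<^sub>\<lambda>\<close>. Up to level \<open>\<delta> < \<lambda>\<close> labels at least \<open>\<delta>\<close> are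
  indistinguishable, so the omitted piece is absorbed by any \<open>Q\<^sub>\<beta>\<close> with \<open>\<delta> \<le> \<beta> < \<lambda>\<close>, and the embedding
  preserves \<open>\<Pi>\<^sub>\<lambda>\<close> formulas. Translating the cut to the right, every finite subset of \<open>B\<close> lies in the
  image of such an embedding.\<close>


section \<open>Countable ordinals\<close>

text \<open>The limit level is what allows rough bookkeeping: a definition whose level is known up
  to finitely many successors stays below \<lambda>, and only the clauses that range over all labels
  reach \<lambda> + 1. Blocks carry an extra last point because that point has no immediate
  successor, which marks the end of a block by a formula of fixed finite level. T has no first
  summand: for every \<delta> < \<lambda> there are summands as far left as desired that can swallow
  the omitted piece, so that finitely many given points of T may stay fixed. The transfer from A to
  B treats one universal and one existential block: a tuple of B is pulled back along an embedding,
  the witnesses found in A are pushed forward, and what remains is \<Pi>_\<lambda>. Minimality needs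
  just the absence of a \<Pi>_(\<lambda>+2) Scott sentence, since a class not above
  \<Sigma>_(\<lambda>+2) lies inside \<Pi>_(\<lambda>+2) up to equivalence. Ordinals enter through
  their Cantor normal forms, finite multisets of exponents in which \<omega>^\<gamma> is a
  singleton.\<close>

lemma omega1_zero_le [simp]: "0 \<le> (a :: omega1)"
  unfolding zero_omega1_def by (simp add: Least_le)

lemma less_succ_ord [simp]: "a < succ_ord a"
  by (simp add: less_succ_ord_iff)

lemma succ_ord_le_iff: "succ_ord a \<le> b \<longleftrightarrow> a < b"
  using less_succ_ord_iff[of b a] by (simp add: linorder_not_less[symmetric])

lemma limit_ord_succ: "limit_ord l \<Longrightarrow> a < l \<Longrightarrow> succ_ord a < l"
  unfolding limit_ord_def by (metis order_le_less succ_ord_le_iff)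

lemma limit_ord_pos: "limit_ord l \<Longrightarrow> 0 < l"
  unfolding limit_ord_def by (metis omega1_zero_le order_le_less)

lemma limit_ord_funpow_succ: "limit_ord l \<Longrightarrow> a < l \<Longrightarrow> (succ_ord ^^ n) a < l"
  by (induction n) (auto intro: limit_ord_succ)

lemma le_funpow_succ: "a \<le> (succ_ord ^^ n) a"
  by (induction n) (auto intro: order.trans less_imp_le[OF less_succ_ord])

lemma funpow_succ_mono: "a \<le> b \<Longrightarrow> (succ_ord ^^ n) a \<le> (succ_ord ^^ n) b"
  by (induction n) (auto simp: succ_ord_le_iff less_succ_ord_iff)

lemma funpow_succ_mono_exp: "m \<le> n \<Longrightarrow> (succ_ord ^^ m) a \<le> (succ_ord ^^ n) a"
  by (metis funpow_add le_funpow_succ le_add_diff_inverse2 o_apply)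

lemma funpow_Suc_pos: "0 < (succ_ord ^^ Suc n) a"
  by (metis funpow.simps(2) less_succ_ord_iff o_apply omega1_zero_le)


section \<open>Finite multisets as ordinals in Cantor normal form\<close>

text \<open>This is the comparison of Cantor normal forms: the largest exponent with different
  coefficients decides. It justifies reading multisets as ordinals.\<close>

lemma less_multiset_iff_greatest_difference:
  fixes M N :: "'a::linorder multiset"
  shows "M < N \<longleftrightarrow> (\<exists>a. count M a < count N a \<and> (\<forall>x>a. count M x = count N x))"
proof
  assume "\<exists>a. count M a < count N a \<and> (\<forall>x>a. count M x = count N x)"
  then obtain a where a: "count M a < count N a" "\<And>x. x > a \<Longrightarrow> count M x = count N x"
    by blast
  have "\<exists>x>y. count M x < count N x" if "count N y < count M y" for y
    using a that by (cases y a rule: linorder_cases) auto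
  then show "M < N"
    using a(1) unfolding less_multiset\<^sub>H\<^sub>O by auto
next
  assume L: "M < N"
  let ?D = "{x. count M x \<noteq> count N x}"
  have "?D \<subseteq> set_mset M \<union> set_mset N"
    by (auto simp: not_in_iff)
  then have fin: "finite ?D"
    by (rule finite_subset) simp
  have "M \<noteq> N"
    using L by simp
  then have ne: "?D \<noteq> {}"
    by (auto simp: multiset_eq_iff)
  define a where "a = Max ?D"
  have a: "count M a \<noteq> count N a"
    using Max_in[OF fin ne] by (simp add: a_def)
  have above: "count M x = count N x" if "x > a" for x
    using Max_ge[OF fin, of x] that by (force simp: a_def)
  \<comment> \<open>A larger count in \<open>M\<close> would have to be compensated above
    \<open>a\<close>, where the counts agree.\<close>
  have "\<not> count N a < count M a"
    using L above unfolding less_multiset\<^sub>H\<^sub>O by (metis less_irrefl)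
  then show "\<exists>a. count M a < count N a \<and> (\<forall>x>a. count M x = count N x)"
    using a above by (metis linorder_neqE_nat)
qed

text \<open>A multiset \<open>{#b\<^sub>1, \<dots>, b\<^sub>k#}\<close> with \<open>b\<^sub>1 \<ge> \<dots> \<ge> b\<^sub>k\<close> stands for the ordinal
  \<open>\<omega>\<^bsup>b\<^sub>1\<^esup> + \<dots> + \<omega>\<^bsup>b\<^sub>k\<^esup>\<close>, and \<open>\<oplus>\<close> is ordinal addition.\<close>

definition osum :: "'a::linorder multiset \<Rightarrow> 'a multiset \<Rightarrow> 'a multiset" (infixl "\<oplus>" 65) where
  "l \<oplus> d = filter_mset (\<lambda>a. \<forall>b\<in>#d. b \<le> a) l + d"

lemma count_osum: "count (l \<oplus> d) x = (if \<forall>b\<in>#d. b \<le> x then count l x else 0) + count d x"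
  by (simp add: osum_def)

lemma osum_empty [simp]: "l \<oplus> {#} = l" "{#} \<oplus> d = d"
  by (auto simp: osum_def)

text \<open>In both bracketings an exponent of \<open>l\<close> survives exactly when it is at least
  every exponent of \<open>d\<close> and of \<open>e\<close>: those of \<open>d\<close> that
  \<open>e\<close> absorbs lie below some exponent of \<open>e\<close>.\<close>

lemma osum_assoc: "(l \<oplus> d) \<oplus> e = l \<oplus> (d \<oplus> e)"
proof (rule multiset_eqI)
  fix x
  have "(\<forall>b\<in>#d \<oplus> e. b \<le> x) \<longleftrightarrow> (\<forall>b\<in>#e. b \<le> x) \<and> (\<forall>b\<in>#d. b \<le> x)"
    (is "?L \<longleftrightarrow> ?R")
  proof
    assume L: ?L
    then have e: "\<forall>b\<in>#e. b \<le> x"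
      by (simp add: osum_def)
    moreover have "b \<le> x" if b: "b \<in># d" for b
    proof (cases "\<forall>c\<in>#e. c \<le> b")
      case True
      then show ?thesis using b L by (simp add: osum_def)
    next
      case False
      then show ?thesis using e by (meson linear order.trans)
    qed
    ultimately show ?R by blast
  next
    assume ?R
    then show ?L by (auto simp: osum_def)
  qed
  then show "count ((l \<oplus> d) \<oplus> e) x = count (l \<oplus> (d \<oplus> e)) x"
    by (simp add: count_osum)
qed

text \<open>From the deciding exponent \<open>a\<close> upwards, \<open>d\<close> and
  \<open>e\<close> let the same exponents of \<open>l\<close> survive, so \<open>a\<close> still
  decides after the addition.\<close>

lemma osum_strict_mono:
  assumes "d < e"
  shows "l \<oplus> d < l \<oplus> e"
proof -
  obtain a where a: "count d a < count e a" "\<And>x. x > a \<Longrightarrow> count d x = count e x"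
    using assms less_multiset_iff_greatest_difference by blast
  have mem: "x \<in># d \<longleftrightarrow> x \<in># e" if "x > a" for x
    using a(2)[OF that] by (metis count_eq_zero_iff)
  have ae: "a \<in># e"
    using a(1) by (metis count_eq_zero_iff gr_implies_not0)
  have up: "(\<forall>b\<in>#d. b \<le> x) \<longleftrightarrow> (\<forall>b\<in>#e. b \<le> x)" if "x \<ge> a" for x
    using mem that by (meson leD leI order.strict_trans1)
  show ?thesis
    unfolding less_multiset_iff_greatest_difference
    by (rule exI[of _ a]) (use a up in \<open>auto simp: count_osum\<close>)
qed

lemma osum_less_iff [simp]: "l \<oplus> d < l \<oplus> e \<longleftrightarrow> d < e"
  by (metis osum_strict_mono less_irrefl less_asym linorder_neqE)

lemma osum_le_iff [simp]: "l \<oplus> d \<le> l \<oplus> e \<longleftrightarrow> d \<le> e"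
  by (simp add: linorder_not_less[symmetric])

lemma osum_left_cancel [simp]: "l \<oplus> d = l \<oplus> e \<longleftrightarrow> d = e"
  by (metis osum_strict_mono less_irrefl linorder_neqE)

lemma le_osum [simp]: "l \<le> l \<oplus> (d :: 'a::linorder multiset)"
  using osum_le_iff[of l "{#}" d] by (simp add: le_multiset_empty_left)

lemma less_osum_iff [simp]: "l < l \<oplus> (d :: 'a::linorder multiset) \<longleftrightarrow> d \<noteq> {#}"
  by (metis le_osum order_less_le osum_empty(1) osum_left_cancel)

text \<open>Left subtraction of ordinals, read off from the greatest exponent at which the normal
  forms differ.\<close>

lemma le_imp_osum:
  assumes "l \<le> (z :: 'a::linorder multiset)"
  obtains w where "z = l \<oplus> w"
proof (cases "l = z")
  case True
  then show ?thesis using that[of "{#}"] by simp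
next
  case False
  then obtain a where a: "count l a < count z a" "\<And>x. x > a \<Longrightarrow> count l x = count z x"
    using assms less_multiset_iff_greatest_difference[of l z] by force
  \<comment> \<open>The remainder is the part of \<open>z\<close> below \<open>a\<close> together
    with the surplus copies of \<open>a\<close>; having largest exponent \<open>a\<close>, it
    absorbs exactly the part of \<open>l\<close> below \<open>a\<close>.\<close>
  let ?w = "filter_mset (\<lambda>x. x < a) z + replicate_mset (count z a - count l a) a"
  have up: "(\<forall>b\<in>#?w. b \<le> x) \<longleftrightarrow> a \<le> x" for x
    using a(1) by (auto simp: in_replicate_mset dest: less_imp_le)
  have "z = l \<oplus> ?w"
  proof (rule multiset_eqI)
    fix x
    show "count z x = count (l \<oplus> ?w) x"
      unfolding count_osum up using a by (cases x a rule: linorder_cases) auto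
  qed
  then show ?thesis by (rule that)
qed

lemma singleton_osum:
  assumes "\<And>b. b \<in># w \<Longrightarrow> b \<le> c"
  shows "{#c#} \<oplus> w = add_mset c w"
  using assms by (auto simp: osum_def)

lemma ex_ge_osum:
  assumes "\<not> (\<exists>x\<in>#e. \<delta> \<le> x)"
  shows "(\<exists>x\<in>#d \<oplus> e. \<delta> \<le> x) \<longleftrightarrow> (\<exists>x\<in>#d. \<delta> \<le> (x :: 'a::linorder))"
proof -
  have "b \<le> x" if "b \<in># e" "\<delta> \<le> x" for b x
    using assms that by (meson leI order.strict_implies_order order.strict_trans1)
  then show ?thesis
    using assms unfolding osum_def by (simp add: Bex_def) blast
qed

text \<open>Ordinals related by \<open>osim \<delta>\<close> agree modulo \<open>\<omega>\<^bsup>\<delta>\<^esup>\<close> and are either both below \<open>\<omega>\<^bsup>\<delta>\<^esup>\<close> or both not.\<close>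

definition osim :: "'a::linorder \<Rightarrow> 'a multiset \<Rightarrow> 'a multiset \<Rightarrow> bool" where
  "osim \<delta> d d' \<longleftrightarrow> (\<forall>x<\<delta>. count d x = count d' x) \<and> ((\<exists>x\<in>#d. \<delta> \<le> x) \<longleftrightarrow> (\<exists>x\<in>#d'. \<delta> \<le> x))"

lemma osim_refl [simp]: "osim \<delta> d d"
  by (simp add: osim_def)

lemma osim_sym: "osim \<delta> d d' \<Longrightarrow> osim \<delta> d' d"
  by (auto simp: osim_def)

lemma osim_mem: "osim \<delta> d d' \<Longrightarrow> x < \<delta> \<Longrightarrow> x \<in># d \<longleftrightarrow> x \<in># d'"
  by (metis osim_def count_eq_zero_iff)

lemma osim_mono:
  assumes "osim \<delta> d d'" "\<delta>' \<le> \<delta>"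
  shows "osim \<delta>' d d'"
proof -
  have "(\<exists>x\<in>#d. \<delta>' \<le> x) \<Longrightarrow> (\<exists>x\<in>#d'. \<delta>' \<le> x)" if "osim \<delta> d d'" for d d'
  proof -
    assume "\<exists>x\<in>#d. \<delta>' \<le> x"
    then obtain x where x: "x \<in># d" "\<delta>' \<le> x" by blast
    show "\<exists>x\<in>#d'. \<delta>' \<le> x"
    proof (cases "x < \<delta>")
      case True
      then show ?thesis using x osim_mem[OF that] by blast
    next
      case False
      then show ?thesis using x that assms(2) unfolding osim_def by (meson leI order.trans)
    qed
  qed
  then have "(\<exists>x\<in>#d. \<delta>' \<le> x) \<longleftrightarrow> (\<exists>x\<in>#d'. \<delta>' \<le> x)"
    using assms(1) osim_sym by blast
  moreover have "\<forall>x<\<delta>'. count d x = count d' x"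
    using assms by (auto simp: osim_def)
  ultimately show ?thesis
    by (simp add: osim_def)
qed

lemma osim_empty_iff: "osim \<delta> d d' \<Longrightarrow> d = {#} \<longleftrightarrow> d' = {#}"
  unfolding osim_def by (metis count_eq_zero_iff count_empty leI multiset_nonemptyE not_in_iff)

lemma osim_singleton: "c = c' \<or> \<delta> \<le> c \<and> \<delta> \<le> c' \<Longrightarrow> osim \<delta> {#c#} {#c'#}"
  by (auto simp: osim_def)

text \<open>If \<open>e\<close> reaches \<omega>^\<delta>, it absorbs every exponent of
  \<open>d\<close> below \<delta>, and so does \<open>e'\<close> with \<open>d'\<close>. Otherwise
  \<open>e = e'\<close>, and all exponents of \<open>d\<close> from \<delta> on survive.\<close>

lemma osim_osum:
  assumes d: "osim \<delta> d d'" and e: "osim \<delta> e e'"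
  shows "osim \<delta> (d \<oplus> e) (d' \<oplus> e')"
proof (cases "\<exists>x\<in>#e. \<delta> \<le> x")
  case True
  then have T': "\<exists>x\<in>#e'. \<delta> \<le> x"
    using e by (auto simp: osim_def)
  have "count (d \<oplus> e) x = count e x" "count (d' \<oplus> e') x = count e' x" if "x < \<delta>" for x
    using that True T' by (auto simp: count_osum)
  moreover have "\<exists>x\<in>#d \<oplus> e. \<delta> \<le> x" "\<exists>x\<in>#d' \<oplus> e'. \<delta> \<le> x"
    using True T' by (auto simp: osum_def)
  ultimately show ?thesis using e by (simp add: osim_def)
next
  case False
  then have F': "\<not> (\<exists>x\<in>#e'. \<delta> \<le> x)"
    using e by (auto simp: osim_def)
  have ee: "e = e'"
  proof (rule multiset_eqI)
    fix x
    show "count e x = count e' x"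
    proof (cases "x < \<delta>")
      case True
      then show ?thesis using e by (simp add: osim_def)
    next
      case F: False
      then have "x \<notin># e" "x \<notin># e'" using False F' by auto
      then show ?thesis by (simp add: not_in_iff)
    qed
  qed
  have big: "(\<exists>x\<in>#d \<oplus> e. \<delta> \<le> x) \<longleftrightarrow> (\<exists>x\<in>#d. \<delta> \<le> x)" for d
    using ex_ge_osum[OF False] .
  show ?thesis
    using d by (simp add: osim_def big ee[symmetric] count_osum)
qed

text \<open>The single step of the game on ordinals: a cut of \<open>d\<close> is answered by a cut
  of \<open>d'\<close>. The loss is asymmetric, only the left piece drops to \<delta>' while the
  right piece keeps \<delta>; this is what later allows many cuts for one drop.\<close>

lemma osim_split:
  assumes dd: "osim \<delta> d d'" and d: "d = e \<oplus> r" and r: "r \<noteq> {#}" and lt: "\<delta>' < \<delta>"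
  obtains e' r' where "d' = e' \<oplus> r'" "osim \<delta>' e e'" "osim \<delta> r r'"
proof (cases "\<exists>x\<in>#r. \<delta> \<le> x")
  case True
  \<comment> \<open>A representative of \<open>e\<close> modulo \<omega>^\<delta>', with one
    exponent \<delta>' standing for all larger ones. It lies below \<omega>^\<delta> and is
    therefore absorbed by \<open>d'\<close>, which serves as its own right piece.\<close>
  let ?e' = "filter_mset (\<lambda>x. x < \<delta>') e + (if \<exists>x\<in>#e. \<delta>' \<le> x then {#\<delta>'#} else {#})"
  have "\<exists>x\<in>#d. \<delta> \<le> x"
    using True by (auto simp: d osum_def)
  then have big: "\<exists>x\<in>#d'. \<delta> \<le> x"
    using dd by (auto simp: osim_def)
  have "x < \<delta>" if "x \<in># ?e'" for x
    using that lt by (auto split: if_splits)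
  then have "\<not> (\<forall>b\<in>#d'. b \<le> a)" if "a \<in># ?e'" for a
    using big that by (meson leD order.trans)
  then have "filter_mset (\<lambda>a. \<forall>b\<in>#d'. b \<le> a) ?e' = filter_mset (\<lambda>a. False) ?e'"
    by (intro filter_mset_cong refl) blast
  then have "filter_mset (\<lambda>a. \<forall>b\<in>#d'. b \<le> a) ?e' = {#}"
    by (simp only: filter_mset_False)
  then have 1: "d' = ?e' \<oplus> d'"
    by (simp add: osum_def)
  have "osim \<delta>' e ?e'"
    by (auto simp: osim_def)
  moreover have "count d x = count r x" if "x < \<delta>" for x
    using that True by (auto simp: d count_osum)
  then have "osim \<delta> r d'"
    using dd True big by (auto simp: osim_def)
  ultimately show ?thesis using that 1 by blast
next
  case False
  \<comment> \<open>Here \<open>r\<close> lies below \<omega>^\<delta> and can be reused unchanged,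
    so \<open>e'\<close> takes its large exponents from \<open>d'\<close> and its small ones from
    \<open>e\<close>.\<close>
  let ?e' = "filter_mset (\<lambda>x. \<delta> \<le> x) d' + filter_mset (\<lambda>x. x < \<delta>) e"
  have 1: "d' = ?e' \<oplus> r"
  proof (rule multiset_eqI)
    fix x
    show "count d' x = count (?e' \<oplus> r) x"
    proof (cases "x < \<delta>")
      case True
      then have "count d' x = count (e \<oplus> r) x"
        using dd d by (simp add: osim_def)
      moreover have "\<not> \<delta> \<le> x" using True by simp
      ultimately show ?thesis using True by (simp add: count_osum)
    next
      case F: False
      then have "\<forall>b\<in>#r. b \<le> x" "x \<notin># r"
        using False by (auto simp: not_less not_le intro: less_imp_le order.strict_trans2)
      then have "\<forall>b\<in>#r. b \<le> x" "count r x = 0"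
        by (auto simp: not_in_iff)
      moreover have "\<delta> \<le> x" using F by simp
      ultimately show ?thesis using F by (simp add: count_osum)
    qed
  qed
  have "(\<exists>x\<in>#e. \<delta> \<le> x) \<longleftrightarrow> (\<exists>x\<in>#d. \<delta> \<le> x)"
    using ex_ge_osum[OF False] d by blast
  then have "osim \<delta> e ?e'"
    using dd unfolding osim_def by auto
  then have "osim \<delta>' e ?e'"
    by (rule osim_mono) (use lt in simp)
  then show ?thesis using that[OF 1] by simp
qed


section \<open>Isomorphisms of linear orders\<close>

lemma isomorphicI:
  "bij_betw f A B \<Longrightarrow> (\<And>x y. x \<in> A \<Longrightarrow> y \<in> A \<Longrightarrow> (x, y) \<in> R \<longleftrightarrow> (f x, f y) \<in> S) \<Longrightarrow>
    isomorphic A R B S"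
  unfolding isomorphic_def by blast

lemma isomorphic_refl [simp]: "isomorphic A R A R"
  by (rule isomorphicI[of id]) auto

lemma isomorphic_sym:
  assumes "isomorphic A R B S"
  shows "isomorphic B S A R"
proof -
  obtain f where f: "bij_betw f A B" "\<And>x y. x \<in> A \<Longrightarrow> y \<in> A \<Longrightarrow> (x, y) \<in> R \<longleftrightarrow> (f x, f y) \<in> S"
    using assms unfolding isomorphic_def by blast
  let ?g = "inv_into A f"
  have g: "?g x \<in> A" "f (?g x) = x" if "x \<in> B" for x
    using f(1) that by (auto simp: bij_betw_def inv_into_into f_inv_into_f)
  show ?thesis
    by (rule isomorphicI[of ?g]) (use f g in \<open>auto intro: bij_betw_inv_into\<close>)
qed

lemma isomorphic_trans:
  assumes "isomorphic A R B S" "isomorphic B S C T"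
  shows "isomorphic A R C T"
proof -
  obtain f where f: "bij_betw f A B" "\<And>x y. x \<in> A \<Longrightarrow> y \<in> A \<Longrightarrow> (x, y) \<in> R \<longleftrightarrow> (f x, f y) \<in> S"
    using assms(1) unfolding isomorphic_def by blast
  obtain g where g: "bij_betw g B C" "\<And>x y. x \<in> B \<Longrightarrow> y \<in> B \<Longrightarrow> (x, y) \<in> S \<longleftrightarrow> (g x, g y) \<in> T"
    using assms(2) unfolding isomorphic_def by blast
  have "f x \<in> B" if "x \<in> A" for x
    using f(1) that by (auto simp: bij_betw_def)
  then show ?thesis
    by (intro isomorphicI[of "g \<circ> f"] bij_betw_trans[OF f(1) g(1)]) (auto simp: f(2) g(2))
qed

text \<open>Isomorphisms of fibres combine once the relation between different fibres is dictated by
  the map on keys. The same lemma serves for splitting intervals, for blocks over their first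
  elements, and for summands over their keys.\<close>

lemma isomorphic_glue:
  assumes "\<kappa> ` A \<subseteq> K" "\<kappa>' ` B \<subseteq> f ` K" "inj_on f K"
    and fib: "\<And>k. k \<in> K \<Longrightarrow> isomorphic {x \<in> A. \<kappa> x = k} R {y \<in> B. \<kappa>' y = f k} S"
    and H: "\<And>x y x' y'. x \<in> A \<Longrightarrow> y \<in> A \<Longrightarrow> x' \<in> B \<Longrightarrow> y' \<in> B \<Longrightarrow> \<kappa>' x' = f (\<kappa> x) \<Longrightarrow>
       \<kappa>' y' = f (\<kappa> y) \<Longrightarrow> \<kappa> x \<noteq> \<kappa> y \<Longrightarrow> (x, y) \<in> R \<longleftrightarrow> (x', y') \<in> S"
  shows "isomorphic A R B S"
proof -
  have "\<forall>k\<in>K. \<exists>g. bij_betw g {x \<in> A. \<kappa> x = k} {y \<in> B. \<kappa>' y = f k} \<and>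
      (\<forall>x\<in>{x \<in> A. \<kappa> x = k}. \<forall>y\<in>{x \<in> A. \<kappa> x = k}. (x, y) \<in> R \<longleftrightarrow> (g x, g y) \<in> S)"
    using fib unfolding isomorphic_def by blast
  from bchoice[OF this] obtain g where g: "\<And>k. k \<in> K \<Longrightarrow> bij_betw (g k) {x \<in> A. \<kappa> x = k} {y \<in> B. \<kappa>' y = f k}"
    and gR: "\<And>k x y. k \<in> K \<Longrightarrow> x \<in> A \<Longrightarrow> y \<in> A \<Longrightarrow> \<kappa> x = k \<Longrightarrow> \<kappa> y = k \<Longrightarrow>
      (x, y) \<in> R \<longleftrightarrow> (g k x, g k y) \<in> S"
    by auto
  let ?h = "\<lambda>x. g (\<kappa> x) x"
  have K: "\<kappa> x \<in> K" if "x \<in> A" for x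
    using assms(1) that by blast
  have hB: "?h x \<in> B" "\<kappa>' (?h x) = f (\<kappa> x)" if "x \<in> A" for x
    using g[OF K[OF that]] that by (auto simp: bij_betw_def)
  show ?thesis
  proof (rule isomorphicI[of ?h])
    show "bij_betw ?h A B"
      unfolding bij_betw_def
    proof
      show "inj_on ?h A"
      proof (rule inj_onI)
        fix x y assume x: "x \<in> A" and y: "y \<in> A" and eq: "?h x = ?h y"
        then have k: "\<kappa> x = \<kappa> y"
          using hB[OF x] hB[OF y] K assms(3) by (metis inj_onD)
        then show "x = y"
          using g[OF K[OF x]] x y eq by (auto simp: bij_betw_def inj_on_def)
      qed
      show "?h ` A = B"
      proof
        show "?h ` A \<subseteq> B" using hB by blast
        show "B \<subseteq> ?h ` A"
        proof
          fix y assume y: "y \<in> B"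
          then obtain k where k: "k \<in> K" "\<kappa>' y = f k"
            using assms(2) by blast
          then have "y \<in> g k ` {x \<in> A. \<kappa> x = k}"
            using g[OF k(1)] y by (auto simp: bij_betw_def)
          then show "y \<in> ?h ` A" by auto
        qed
      qed
    qed
    fix x y assume x: "x \<in> A" and y: "y \<in> A"
    show "(x, y) \<in> R \<longleftrightarrow> (?h x, ?h y) \<in> S"
    proof (cases "\<kappa> x = \<kappa> y")
      case True
      have "(x, y) \<in> R \<longleftrightarrow> (g (\<kappa> x) x, g (\<kappa> x) y) \<in> S"
        by (rule gR[OF K[OF x] x y refl True[symmetric]])
      then show ?thesis by (simp only: True)
    next
      case False
      show ?thesis
        by (rule H[OF x y hB(1)[OF x] hB(1)[OF y] hB(2)[OF x] hB(2)[OF y] False])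
    qed
  qed
qed

text \<open>All that is handed back is that any two pairs of \<open>f\<close> lie in a common
  \<open>p\<close>; this suffices to transfer unary and binary properties from the conditions to
  \<open>f\<close>.\<close>

lemma back_and_forth:
  fixes P :: "('a \<times> 'b) set \<Rightarrow> bool"
  assumes cA: "countable A" and cB: "countable B" and P0: "P {}"
    and sub: "\<And>p. P p \<Longrightarrow> p \<subseteq> A \<times> B"
    and inj: "\<And>p a b a' b'. P p \<Longrightarrow> (a, b) \<in> p \<Longrightarrow> (a', b') \<in> p \<Longrightarrow> a = a' \<longleftrightarrow> b = b'"
    and forth: "\<And>p a. P p \<Longrightarrow> a \<in> A \<Longrightarrow> \<exists>b. P (insert (a, b) p)"
    and bk: "\<And>p b. P p \<Longrightarrow> b \<in> B \<Longrightarrow> \<exists>a. P (insert (a, b) p)"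
  obtains f where "bij_betw f A B"
    and "\<And>a a'. a \<in> A \<Longrightarrow> a' \<in> A \<Longrightarrow> \<exists>p. P p \<and> (a, f a) \<in> p \<and> (a', f a') \<in> p"
proof (cases "A = {}")
  case True
  then have "B = {}"
    using bk[OF P0] sub by blast
  then show ?thesis using that[of "\<lambda>_. undefined"] True by (simp add: bij_betw_def)
next
  case False
  then have Bne: "B \<noteq> {}"
    using forth[OF P0] sub by blast
  let ?a = "from_nat_into A" and ?b = "from_nat_into B"
  have aA: "?a n \<in> A" and bB: "?b n \<in> B" for n
    using False Bne by (auto intro: from_nat_into)
  have "\<exists>p'. P p' \<and> p \<subseteq> p' \<and> (\<exists>b. (?a n, b) \<in> p') \<and> (\<exists>a. (a, ?b n) \<in> p')" if pp: "P p" for p n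
  proof -
    obtain b where b: "P (insert (?a n, b) p)"
      using forth[OF pp aA] by blast
    obtain a where "P (insert (a, ?b n) (insert (?a n, b) p))"
      using bk[OF b bB] by blast
    then show ?thesis by blast
  qed
  \<comment> \<open>Stage \<open>n\<close> puts the \<open>n\<close>-th elements of both
    enumerations into the growing chain of conditions.\<close>
  then have "\<exists>q. \<forall>n. P (q n) \<and> (q n \<subseteq> q (Suc n) \<and> (\<exists>b. (?a n, b) \<in> q (Suc n)) \<and> (\<exists>a. (a, ?b n) \<in> q (Suc n)))"
    using P0 by (intro dependent_nat_choice) blast+
  then obtain q where q: "\<And>n. P (q n)" "\<And>n. q n \<subseteq> q (Suc n)"
    "\<And>n. \<exists>b. (?a n, b) \<in> q (Suc n)" "\<And>n. \<exists>a. (a, ?b n) \<in> q (Suc n)"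
    by blast
  have mono: "q m \<subseteq> q n" if "m \<le> n" for m n
    using lift_Suc_mono_le[of q, OF q(2) that] .
  have tot: "\<exists>b n. (a, b) \<in> q n" if "a \<in> A" for a
    using q(3)[of "to_nat_on A a"] cA that by (metis from_nat_into_to_nat_on)
  have sur: "\<exists>a n. (a, b) \<in> q n" if "b \<in> B" for b
    using q(4)[of "to_nat_on B b"] cB that by (metis from_nat_into_to_nat_on)
  define f where "f a = (SOME b. \<exists>n. (a, b) \<in> q n)" for a
  have fq: "\<exists>n. (a, f a) \<in> q n" if "a \<in> A" for a
    unfolding f_def using someI_ex[OF tot[OF that]] .
  have join: "\<exists>p. P p \<and> x \<in> p \<and> y \<in> p" if "x \<in> q m" "y \<in> q n" for x y m n
    using mono[of m "max m n"] mono[of n "max m n"] that q(1)[of "max m n"] by auto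
  have pair: "\<exists>p. P p \<and> (a, f a) \<in> p \<and> (a', f a') \<in> p" if "a \<in> A" "a' \<in> A" for a a'
    using fq[OF that(1)] fq[OF that(2)] join by meson
  have "bij_betw f A B"
    unfolding bij_betw_def
  proof
    show "inj_on f A"
      by (rule inj_onI) (metis pair inj)
    have "f a \<in> B" if "a \<in> A" for a
      using fq[OF that] q(1) sub by blast
    moreover have "\<exists>a\<in>A. b = f a" if b: "b \<in> B" for b
    proof -
      obtain a n where an: "(a, b) \<in> q n" using sur[OF b] by blast
      then have a: "a \<in> A" using q(1) sub by blast
      obtain m where "(a, f a) \<in> q m" using fq[OF a] by blast
      then obtain p where "P p" "(a, b) \<in> p" "(a, f a) \<in> p" using join[OF an] by meson
      then have "b = f a" using inj by blast
      then show ?thesis using a by blast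
    qed
    ultimately show "f ` A = B" by blast
  qed
  then show ?thesis using that pair by blast
qed

text \<open>As with satisfaction of formulas, only the restriction of \<open>S\<close> to
  \<open>B\<close> matters; \<open>linear_order_on\<close> would constrain \<open>S\<close> outside
  \<open>B\<close> as well.\<close>

definition lin :: "'a set \<Rightarrow> 'a rel \<Rightarrow> bool" where
  "lin B S \<longleftrightarrow> (\<forall>x\<in>B. \<forall>y\<in>B. \<forall>z\<in>B. (x, x) \<in> S \<and> ((x, y) \<in> S \<and> (y, x) \<in> S \<longrightarrow> x = y) \<and>
     ((x, y) \<in> S \<and> (y, z) \<in> S \<longrightarrow> (x, z) \<in> S) \<and> ((x, y) \<in> S \<or> (y, x) \<in> S))"

abbreviation slt :: "'a rel \<Rightarrow> 'a \<Rightarrow> 'a \<Rightarrow> bool" where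
  "slt S x y \<equiv> (x, y) \<in> S \<and> x \<noteq> y"

lemma linD:
  assumes "lin B S" "x \<in> B" "y \<in> B"
  shows "(x, x) \<in> S" "(x, y) \<in> S \<Longrightarrow> (y, x) \<in> S \<Longrightarrow> x = y" "(x, y) \<in> S \<or> (y, x) \<in> S"
    "z \<in> B \<Longrightarrow> (x, y) \<in> S \<Longrightarrow> (y, z) \<in> S \<Longrightarrow> (x, z) \<in> S"
    "(x, y) \<in> S \<longleftrightarrow> \<not> slt S y x"
  using assms unfolding lin_def by blast+

lemma lin_subset: "lin B S \<Longrightarrow> A \<subseteq> B \<Longrightarrow> lin A S"
  unfolding lin_def by blast

text \<open>A shuffle of the labels \<open>L\<close>: each label occurs in every open interval,
  unbounded ones included.\<close>

definition labelled_dense :: "'a set \<Rightarrow> 'a rel \<Rightarrow> ('a \<Rightarrow> 'l) \<Rightarrow> 'l set \<Rightarrow> bool" where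
  "labelled_dense A R c L \<longleftrightarrow> c ` A \<subseteq> L \<and> (\<forall>l\<in>L. (\<exists>z\<in>A. c z = l) \<and>
     (\<forall>x\<in>A. (\<exists>z\<in>A. c z = l \<and> slt R z x) \<and> (\<exists>z\<in>A. c z = l \<and> slt R x z)) \<and>
     (\<forall>x\<in>A. \<forall>y\<in>A. slt R x y \<longrightarrow> (\<exists>z\<in>A. c z = l \<and> slt R x z \<and> slt R z y)))"

lemma lin_finite_greatest:
  assumes "lin A R" "finite X" "X \<subseteq> A" "X \<noteq> {}"
  obtains m where "m \<in> X" "\<And>x. x \<in> X \<Longrightarrow> (x, m) \<in> R"
proof -
  have "\<exists>m\<in>X. \<forall>x\<in>X. (x, m) \<in> R"
    using assms(2,4,3)
  proof (induction X rule: finite_ne_induct)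
    case (singleton x)
    then show ?case using linD(1)[OF assms(1)] by auto
  next
    case (insert x F)
    then obtain m where m: "m \<in> F" "\<forall>x\<in>F. (x, m) \<in> R" by auto
    have mx: "m \<in> A" "x \<in> A" using insert m by auto
    show ?case
    proof (cases "(x, m) \<in> R")
      case True
      then show ?thesis using m by auto
    next
      case False
      then have "(m, x) \<in> R" using linD(3)[OF assms(1) mx] by blast
      then have "\<forall>y\<in>F. (y, x) \<in> R"
        using m insert.prems linD(4)[OF assms(1) _ mx(1) mx(2)] by blast
      then show ?thesis using linD(1)[OF assms(1) mx(2) mx(2)] by auto
    qed
  qed
  then show ?thesis using that by blast
qed

lemma lin_converse: "lin A R \<Longrightarrow> lin A (R\<inverse>)"
  unfolding lin_def by blast

lemma lin_finite_least:
  assumes "lin A R" "finite X" "X \<subseteq> A" "X \<noteq> {}"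
  obtains m where "m \<in> X" "\<And>x. x \<in> X \<Longrightarrow> (m, x) \<in> R"
  using lin_finite_greatest[OF lin_converse[OF assms(1)] assms(2-4)] by auto

text \<open>A finite cut is determined by the greatest element of \<open>X\<close> and the least of
  \<open>Y\<close>; empty sides correspond to the unbounded intervals.\<close>

lemma labelled_dense_between:
  assumes A: "lin A R" "labelled_dense A R c L" "l \<in> L"
    and X: "finite X" "X \<subseteq> A" and Y: "finite Y" "Y \<subseteq> A" "\<And>x y. x \<in> X \<Longrightarrow> y \<in> Y \<Longrightarrow> slt R x y"
  shows "\<exists>z\<in>A. c z = l \<and> (\<forall>x\<in>X. slt R x z) \<and> (\<forall>y\<in>Y. slt R z y)"
proof -
  have tr: "slt R x z" if "(x, y) \<in> R" "slt R y z" "x \<in> A" "y \<in> A" "z \<in> A" for x y z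
    using that linD[OF A(1)] by metis
  have tr': "slt R x z" if "slt R x y" "(y, z) \<in> R" "x \<in> A" "y \<in> A" "z \<in> A" for x y z
    using that linD[OF A(1)] by metis
  have D: "\<exists>z\<in>A. c z = l" "\<And>x. x \<in> A \<Longrightarrow> \<exists>z\<in>A. c z = l \<and> slt R z x"
    "\<And>x. x \<in> A \<Longrightarrow> \<exists>z\<in>A. c z = l \<and> slt R x z"
    "\<And>x y. x \<in> A \<Longrightarrow> y \<in> A \<Longrightarrow> slt R x y \<Longrightarrow> \<exists>z\<in>A. c z = l \<and> slt R x z \<and> slt R z y"
    using A(2,3) unfolding labelled_dense_def by blast+
  have "\<exists>z\<in>A. c z = l \<and> (X \<noteq> {} \<longrightarrow> (\<exists>m\<in>X. (\<forall>x\<in>X. (x, m) \<in> R) \<and> slt R m z)) \<and>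
      (Y \<noteq> {} \<longrightarrow> (\<exists>m\<in>Y. (\<forall>x\<in>Y. (m, x) \<in> R) \<and> slt R z m))"
  proof (cases "X = {}")
    case True
    show ?thesis
    proof (cases "Y = {}")
      case T: True
      then show ?thesis using True D(1) by blast
    next
      case False
      obtain m where "m \<in> Y" "\<And>x. x \<in> Y \<Longrightarrow> (m, x) \<in> R"
        using lin_finite_least[OF A(1) Y(1,2) False] by blast
      then show ?thesis using True D(2)[of m] Y(2) by blast
    qed
  next
    case False
    obtain m where m: "m \<in> X" "\<And>x. x \<in> X \<Longrightarrow> (x, m) \<in> R"
      using lin_finite_greatest[OF A(1) X False] by blast
    show ?thesis
    proof (cases "Y = {}")
      case T: True
      then show ?thesis using m D(3)[of m] X(2) by blast
    next
      case F: False
      obtain n where n: "n \<in> Y" "\<And>x. x \<in> Y \<Longrightarrow> (n, x) \<in> R"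
        using lin_finite_least[OF A(1) Y(1,2) F] by blast
      have "\<exists>z\<in>A. c z = l \<and> slt R m z \<and> slt R z n"
        by (rule D(4)) (use m n X Y in auto)
      then show ?thesis using m n by blast
    qed
  qed
  then obtain z where z: "z \<in> A" "c z = l" "X \<noteq> {} \<longrightarrow> (\<exists>m\<in>X. (\<forall>x\<in>X. (x, m) \<in> R) \<and> slt R m z)"
      "Y \<noteq> {} \<longrightarrow> (\<exists>m\<in>Y. (\<forall>x\<in>Y. (m, x) \<in> R) \<and> slt R z m)" by blast
  have "slt R x z" if "x \<in> X" for x
    using z(1,3) that X(2) tr by blast
  moreover have "slt R z y" if "y \<in> Y" for y
    using z(1,4) that Y(2) tr' by blast
  ultimately show ?thesis using z by blast
qed

definition labelled_partial_iso ::
  "'a set \<Rightarrow> 'a rel \<Rightarrow> ('a \<Rightarrow> 'l) \<Rightarrow> 'b set \<Rightarrow> 'b rel \<Rightarrow> ('b \<Rightarrow> 'l) \<Rightarrow> ('a \<times> 'b) set \<Rightarrow> bool" where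
  "labelled_partial_iso A R c B S d p \<longleftrightarrow> finite p \<and> p \<subseteq> A \<times> B \<and> (\<forall>a b. (a, b) \<in> p \<longrightarrow> c a = d b) \<and>
    (\<forall>a b a' b'. (a, b) \<in> p \<longrightarrow> (a', b') \<in> p \<longrightarrow> (a = a' \<longleftrightarrow> b = b') \<and> ((a, a') \<in> R \<longleftrightarrow> (b, b') \<in> S))"

lemma labelled_partial_iso_converse:
  "labelled_partial_iso A R c B S d p \<Longrightarrow> labelled_partial_iso B S d A R c (p\<inverse>)"
  unfolding labelled_partial_iso_def by (simp add: finite_converse) blast

text \<open>The elements of \<open>p\<close> before and after \<open>a\<close> have images forming a
  finite cut of \<open>B\<close>, and the label of \<open>a\<close> occurs in it.\<close>

lemma labelled_partial_iso_extend:
  assumes P: "labelled_partial_iso A R c B S d p" and a: "a \<in> A"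
    and A: "lin A R" "labelled_dense A R c L" and B: "lin B S" "labelled_dense B S d L"
  shows "\<exists>b. labelled_partial_iso A R c B S d (insert (a, b) p)"
proof (cases "\<exists>b. (a, b) \<in> p")
  case True
  then show ?thesis using P by (metis insert_absorb)
next
  case False
  have p: "finite p" "p \<subseteq> A \<times> B" using P by (auto simp: labelled_partial_iso_def)
  have po: "\<And>x y x' y'. (x, y) \<in> p \<Longrightarrow> (x', y') \<in> p \<Longrightarrow> (x = x' \<longleftrightarrow> y = y') \<and> ((x, x') \<in> R \<longleftrightarrow> (y, y') \<in> S)"
    using P by (auto simp: labelled_partial_iso_def)
  let ?X = "snd ` {q \<in> p. slt R (fst q) a}" and ?Y = "snd ` {q \<in> p. slt R a (fst q)}"
  have "slt S x y" if XY: "x \<in> ?X" "y \<in> ?Y" for x y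
  proof -
    obtain u v where uv: "(u, x) \<in> p" "slt R u a" "(v, y) \<in> p" "slt R a v"
      using XY by auto
    then have "u \<in> A" "v \<in> A" using p by auto
    then have "slt R u v" using uv a linD[OF A(1)] by metis
    then show ?thesis using po uv by blast
  qed
  moreover have "c a \<in> L" using A(2) a by (auto simp: labelled_dense_def)
  ultimately have "\<exists>z\<in>B. d z = c a \<and> (\<forall>x\<in>?X. slt S x z) \<and> (\<forall>y\<in>?Y. slt S z y)"
    using p by (intro labelled_dense_between[OF B]) auto
  then obtain z where z: "z \<in> B" "d z = c a" "\<forall>x\<in>?X. slt S x z" "\<forall>y\<in>?Y. slt S z y" by blast
  have new: "x \<noteq> a \<and> y \<noteq> z \<and> ((x, a) \<in> R \<longleftrightarrow> (y, z) \<in> S) \<and> ((a, x) \<in> R \<longleftrightarrow> (z, y) \<in> S)" if xy: "(x, y) \<in> p" for x y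
  proof -
    have x: "x \<in> A" "y \<in> B" using xy p by auto
    have ne: "x \<noteq> a" using xy False by blast
    consider "slt R x a" | "slt R a x" using linD(3)[OF A(1) a x(1)] ne by blast
    then show ?thesis
    proof cases
      case 1
      then have "y \<in> ?X" using xy by force
      then have "slt S y z" using z by blast
      then show ?thesis using 1 linD(2)[OF A(1) a x(1)] linD(2)[OF B(1) z(1) x(2)] by blast
    next
      case 2
      then have "y \<in> ?Y" using xy by force
      then have "slt S z y" using z by blast
      then show ?thesis using 2 linD(2)[OF A(1) a x(1)] linD(2)[OF B(1) z(1) x(2)] by blast
    qed
  qed
  have "labelled_partial_iso A R c B S d (insert (a, z) p)"
    unfolding labelled_partial_iso_def
  proof (intro conjI allI impI)
    show "finite (insert (a, z) p)" "insert (a, z) p \<subseteq> A \<times> B" using p a z by auto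
    show "c x = d y" if "(x, y) \<in> insert (a, z) p" for x y
      using that z P by (auto simp: labelled_partial_iso_def)
    fix x y x' y' assume "(x, y) \<in> insert (a, z) p" "(x', y') \<in> insert (a, z) p"
    then consider "x = a" "y = z" "x' = a" "y' = z" | "x = a" "y = z" "(x', y') \<in> p"
      | "(x, y) \<in> p" "x' = a" "y' = z" | "(x, y) \<in> p" "(x', y') \<in> p" by blast
    then have "(x = x' \<longleftrightarrow> y = y') \<and> ((x, x') \<in> R \<longleftrightarrow> (y, y') \<in> S)"
    proof cases
      case 1
      then show ?thesis using linD(1)[OF A(1) a a] linD(1)[OF B(1) z(1) z(1)] by simp
    next
      case 2
      then show ?thesis using new[OF 2(3)] by blast
    next
      case 3
      then show ?thesis using new[OF 3(1)] by blast
    next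
      case 4
      then show ?thesis using po by blast
    qed
    then show "x = x' \<longleftrightarrow> y = y'" "(x, x') \<in> R \<longleftrightarrow> (y, y') \<in> S" by blast+
  qed
  then show ?thesis by blast
qed

text \<open>Cantor's theorem with labels. It is applied twice: to first elements of blocks when
  canonical orders are compared, and to block indices with truncated labels in the game.\<close>

lemma labelled_cantor:
  assumes A: "lin A R" "countable A" "labelled_dense A R c L"
    and B: "lin B S" "countable B" "labelled_dense B S d L"
  obtains f where "bij_betw f A B" "\<And>x y. x \<in> A \<Longrightarrow> y \<in> A \<Longrightarrow> (x, y) \<in> R \<longleftrightarrow> (f x, f y) \<in> S"
    "\<And>x. x \<in> A \<Longrightarrow> d (f x) = c x"
proof -
  have P0: "labelled_partial_iso A R c B S d {}" by (simp add: labelled_partial_iso_def)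
  have bk: "\<exists>a. labelled_partial_iso A R c B S d (insert (a, b) p)" if pb: "labelled_partial_iso A R c B S d p" "b \<in> B" for b p
  proof -
    obtain a where "labelled_partial_iso B S d A R c (insert (b, a) (p\<inverse>))"
      using labelled_partial_iso_extend[OF labelled_partial_iso_converse[OF pb(1)] pb(2) B(1,3) A(1,3)] by blast
    then have "labelled_partial_iso A R c B S d ((insert (b, a) (p\<inverse>))\<inverse>)" by (rule labelled_partial_iso_converse)
    moreover have "(insert (b, a) (p\<inverse>))\<inverse> = insert (a, b) p" by auto
    ultimately show ?thesis by auto
  qed
  obtain f where f: "bij_betw f A B"
    "\<And>a a'. a \<in> A \<Longrightarrow> a' \<in> A \<Longrightarrow> \<exists>p. labelled_partial_iso A R c B S d p \<and> (a, f a) \<in> p \<and> (a', f a') \<in> p"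
    by (rule back_and_forth[OF A(2) B(2), of "labelled_partial_iso A R c B S d"])
      (use P0 labelled_partial_iso_extend[OF _ _ A(1,3) B(1,3)] bk in \<open>auto simp: labelled_partial_iso_def\<close>)
  show ?thesis
  proof (rule that[OF f(1)])
    show "(x, y) \<in> R \<longleftrightarrow> (f x, f y) \<in> S" if xy: "x \<in> A" "y \<in> A" for x y
      using f(2)[OF xy] unfolding labelled_partial_iso_def by blast
    show "d (f x) = c x" if x: "x \<in> A" for x
      using f(2)[OF x x] unfolding labelled_partial_iso_def by force
  qed
qed


section \<open>Order types of intervals\<close>

abbreviation ole :: "'a::linorder rel" where
  "ole \<equiv> {(u, v). u \<le> v}"

text \<open>An order isomorphism \<open>f\<close> between segments of a well-order satisfies
  \<open>x \<le> f x\<close>, which at \<open>x = w'\<close> contradicts that values stay below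
  \<open>w'\<close>.\<close>

lemma isomorphic_initial_segments_eq:
  fixes w w' :: "'a::wellorder"
  assumes "isomorphic {..<w} ole {..<w'} ole"
  shows "w = w'"
proof -
  have "\<not> w' < w" if iso: "isomorphic {..<w} ole {..<w'} ole" for w w' :: 'a
  proof
    assume lt: "w' < w"
    obtain f where f: "bij_betw f {..<w} {..<w'}"
      "\<And>x y. x < w \<Longrightarrow> y < w \<Longrightarrow> x \<le> y \<longleftrightarrow> f x \<le> f y"
      using iso unfolding isomorphic_def by auto
    have "x \<le> f x" if "x < w" for x
      using that
    proof (induction x rule: less_induct)
      case (less x)
      show ?case
      proof (rule ccontr)
        assume "\<not> x \<le> f x"
        then have fx: "f x < x" by simp
        then have "f x < w" "f x \<le> f (f x)" using less by auto
        then have "x \<le> f x" using f(2)[of x "f x"] less.prems by simp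
        then show False using fx by simp
      qed
    qed
    from this[OF lt] have "w' \<le> f w'" .
    moreover have "f w' < w'" using f(1) lt by (auto simp: bij_betw_def)
    ultimately show False by simp
  qed
  then show ?thesis using assms isomorphic_sym[OF assms] by (meson linorder_neqE)
qed

definition itv :: "'a set \<Rightarrow> 'a rel \<Rightarrow> 'a \<Rightarrow> 'a \<Rightarrow> 'a set" where
  "itv B S x y = {z \<in> B. (x, z) \<in> S \<and> slt S z y}"

text \<open>An element \<open>w\<close> of a well-order stands for the ordinal of its predecessors;
  for a multiset this is the value of the Cantor normal form.\<close>

definition otyp :: "'a set \<Rightarrow> 'a rel \<Rightarrow> 'a \<Rightarrow> 'a \<Rightarrow> 'b::wellorder \<Rightarrow> bool" where
  "otyp B S x y w \<longleftrightarrow> isomorphic (itv B S x y) S {..<w} ole"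

lemma otyp_unique: "otyp B S x y w \<Longrightarrow> otyp B S x y w' \<Longrightarrow> w = w'"
  unfolding otyp_def by (meson isomorphic_initial_segments_eq isomorphic_sym isomorphic_trans)

lemma otyp_isoE:
  assumes "otyp B S x y w"
  obtains f where "bij_betw f (itv B S x y) {..<w}"
    "\<And>u v. u \<in> itv B S x y \<Longrightarrow> v \<in> itv B S x y \<Longrightarrow> (u, v) \<in> S \<longleftrightarrow> f u \<le> f v"
    "\<And>v. v \<in> itv B S x y \<Longrightarrow> f v < w" "\<And>u. u < w \<Longrightarrow> \<exists>v\<in>itv B S x y. f v = u"
    "\<And>u v. u \<in> itv B S x y \<Longrightarrow> v \<in> itv B S x y \<Longrightarrow> u = v \<longleftrightarrow> f u = f v"
proof -
  obtain f where f: "bij_betw f (itv B S x y) {..<w}"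
    "\<And>u v. u \<in> itv B S x y \<Longrightarrow> v \<in> itv B S x y \<Longrightarrow> (u, v) \<in> S \<longleftrightarrow> f u \<le> f v"
    using assms unfolding otyp_def isomorphic_def by auto
  have "f ` itv B S x y = {..<w}" "inj_on f (itv B S x y)"
    using f(1) by (auto simp: bij_betw_def)
  then have "\<And>v. v \<in> itv B S x y \<Longrightarrow> f v < w" "\<And>u. u < w \<Longrightarrow> \<exists>v\<in>itv B S x y. f v = u"
    "\<And>u v. u \<in> itv B S x y \<Longrightarrow> v \<in> itv B S x y \<Longrightarrow> u = v \<longleftrightarrow> f u = f v"
    by (blast, metis imageE lessThan_iff, metis inj_onD)
  then show ?thesis
    using that[OF f] by blast
qed

lemma itv_sub:
  assumes "lin B S" "x \<in> B" "y \<in> B" "v \<in> itv B S x y"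
  shows "itv B S x v = {z \<in> itv B S x y. slt S z v}" "itv B S v y = {z \<in> itv B S x y. (v, z) \<in> S}"
    "v \<in> B" "(x, v) \<in> S" "slt S v y"
proof -
  have v: "v \<in> B" "(x, v) \<in> S" "slt S v y" using assms(4) by (auto simp: itv_def)
  then show "v \<in> B" "(x, v) \<in> S" "slt S v y" by auto
  have "slt S z y" if "z \<in> B" "slt S z v" for z
    using v that assms linD[OF assms(1)] by metis
  then show "itv B S x v = {z \<in> itv B S x y. slt S z v}"
    by (auto simp: itv_def)
  have "(x, z) \<in> S" if "z \<in> B" "(v, z) \<in> S" for z
    using v that assms linD(4)[OF assms(1)] by blast
  then show "itv B S v y = {z \<in> itv B S x y. (v, z) \<in> S}"
    by (auto simp: itv_def)
qed

lemma otyp_initial_at: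
  assumes B: "lin B S" "x \<in> B" "y \<in> B" "v \<in> itv B S x y"
    and f: "bij_betw f (itv B S x y) {..<w}"
      "\<And>u v. u \<in> itv B S x y \<Longrightarrow> v \<in> itv B S x y \<Longrightarrow> (u, v) \<in> S \<longleftrightarrow> f u \<le> f v"
  shows "otyp B S x v (f v)"
  unfolding otyp_def
proof (rule isomorphicI[of f])
  note s = itv_sub[OF B]
  have fv: "f v < w" using f(1) B(4) by (auto simp: bij_betw_def)
  show "(a, b) \<in> S \<longleftrightarrow> (f a, f b) \<in> ole" if "a \<in> itv B S x v" "b \<in> itv B S x v" for a b
    using f(2)[of a b] that s(1) by auto
  have inj: "inj_on f (itv B S x y)" and im: "f ` itv B S x y = {..<w}"
    using f(1) by (auto simp: bij_betw_def)
  have lt: "slt S a v \<longleftrightarrow> f a < f v" if "a \<in> itv B S x y" for a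
    using f(2)[OF that B(4)] inj that B(4) by (auto simp: inj_on_def order_less_le)
  have "f ` itv B S x v = {..<f v}"
  proof
    show "f ` itv B S x v \<subseteq> {..<f v}" using s(1) lt by auto
    show "{..<f v} \<subseteq> f ` itv B S x v"
    proof
      fix u assume u: "u \<in> {..<f v}"
      then have "u \<in> f ` itv B S x y" using fv im by auto
      then obtain a where a: "a \<in> itv B S x y" "u = f a" by blast
      then have "slt S a v" using lt u by auto
      then show "u \<in> f ` itv B S x v" using a s(1) by auto
    qed
  qed
  then show "bij_betw f (itv B S x v) {..<f v}"
    using inj s(1) by (auto simp: bij_betw_def inj_on_def)
qed

lemma otyp_initial:
  assumes "lin B S" "x \<in> B" "y \<in> B" "otyp B S x y w"
  shows "v \<in> itv B S x y \<Longrightarrow> \<exists>w'<w. otyp B S x v w'" "w' < w \<Longrightarrow> \<exists>v\<in>itv B S x y. otyp B S x v w'"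
proof -
  obtain f where f: "bij_betw f (itv B S x y) {..<w}"
    "\<And>u v. u \<in> itv B S x y \<Longrightarrow> v \<in> itv B S x y \<Longrightarrow> (u, v) \<in> S \<longleftrightarrow> f u \<le> f v"
    "\<And>v. v \<in> itv B S x y \<Longrightarrow> f v < w" "\<And>u. u < w \<Longrightarrow> \<exists>v\<in>itv B S x y. f v = u"
    "\<And>u v. u \<in> itv B S x y \<Longrightarrow> v \<in> itv B S x y \<Longrightarrow> u = v \<longleftrightarrow> f u = f v"
    by (rule otyp_isoE[OF assms(4)]) (rule that)
  note * = otyp_initial_at[OF assms(1-3) _ f(1,2)]
  show "v \<in> itv B S x y \<Longrightarrow> \<exists>w'<w. otyp B S x v w'"
    using *[of v] f(3)[of v] by blast
  show "w' < w \<Longrightarrow> \<exists>v\<in>itv B S x y. otyp B S x v w'"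
    using f(4)[of w'] * by blast
qed

lemma otyp_strict_mono:
  assumes B: "lin B S" "x \<in> B" "v \<in> B" "u \<in> itv B S x v" and "otyp B S x u w" "otyp B S x v w'"
  shows "w < w'"
  using otyp_initial(1)[OF B(1-3) assms(6) B(4)] otyp_unique[OF assms(5)] by blast

text \<open>Sending \<open>v\<close> to the type of the interval from \<open>x\<close> to
  \<open>v\<close> is strictly increasing, and the two assumptions make it a bijection onto the
  ordinals below \<open>w\<close>. The criterion is expressible by recursion on
  \<open>w\<close>.\<close>

lemma otypI:
  assumes B: "lin B S" "x \<in> B" "y \<in> B"
    and 1: "\<And>v. v \<in> itv B S x y \<Longrightarrow> \<exists>w'<w. otyp B S x v w'"
    and 2: "\<And>w'. w' < w \<Longrightarrow> \<exists>v\<in>itv B S x y. otyp B S x v w'"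
  shows "otyp B S x y w"
proof -
  obtain f where f: "\<And>v. v \<in> itv B S x y \<Longrightarrow> f v < w \<and> otyp B S x v (f v)"
    using 1 by metis
  have BI: "v \<in> B" "(x, v) \<in> S" if "v \<in> itv B S x y" for v
    using that by (auto simp: itv_def)
  have lt: "f u < f v" if "u \<in> itv B S x y" "v \<in> itv B S x y" "slt S u v" for u v
  proof (rule otyp_strict_mono[OF B(1,2)])
    show "v \<in> B" "otyp B S x u (f u)" "otyp B S x v (f v)" using that f BI by blast+
    show "u \<in> itv B S x v" using that BI[OF that(1)] by (simp add: itv_def)
  qed
  have le: "(u, v) \<in> S \<longleftrightarrow> f u \<le> f v" and eq: "u = v \<longleftrightarrow> f u = f v"
    if "u \<in> itv B S x y" "v \<in> itv B S x y" for u v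
  proof -
    note l = linD[OF B(1) BI(1)[OF that(1)] BI(1)[OF that(2)]]
    consider "u = v" | "slt S u v" | "slt S v u" using l(3) by blast
    then have *: "((u, v) \<in> S \<longleftrightarrow> f u \<le> f v) \<and> (u = v \<longleftrightarrow> f u = f v)"
    proof cases
      case 1
      then show ?thesis using l(1) by simp
    next
      case 2
      have "f u \<le> f v" "f u \<noteq> f v"
        using lt[OF that 2] by (rule less_imp_le, rule less_imp_neq)
      then show ?thesis using 2 by simp
    next
      case 3
      have "\<not> f u \<le> f v" "f v \<noteq> f u"
        using lt[OF that(2,1) 3] by (simp only: not_le, rule less_imp_neq)
      moreover have "(u, v) \<notin> S" using 3 l(2) by blast
      ultimately show ?thesis using 3 by auto
    qed
    show "(u, v) \<in> S \<longleftrightarrow> f u \<le> f v" using * by (rule conjunct1)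
    show "u = v \<longleftrightarrow> f u = f v" using * by (rule conjunct2)
  qed
  show ?thesis
    unfolding otyp_def
  proof (rule isomorphicI[of f])
    have "f ` itv B S x y = {..<w}"
    proof
      show "f ` itv B S x y \<subseteq> {..<w}"
      proof
        fix u assume "u \<in> f ` itv B S x y"
        then obtain v where "v \<in> itv B S x y" "u = f v" by blast
        then show "u \<in> {..<w}" using f[of v] by simp
      qed
      show "{..<w} \<subseteq> f ` itv B S x y"
      proof
        fix w' assume "w' \<in> {..<w}"
        then obtain v where "v \<in> itv B S x y" "otyp B S x v w'" using 2[of w'] by auto
        then show "w' \<in> f ` itv B S x y" using f[of v] otyp_unique[of B S x v w' "f v"] by blast
      qed
    qed
    moreover have "inj_on f (itv B S x y)"
      by (rule inj_onI) (simp add: eq)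
    ultimately show "bij_betw f (itv B S x y) {..<w}"
      by (simp add: bij_betw_def)
  qed (simp add: le)
qed

text \<open>Both sides are cut, the interval at \<open>y\<close> and the ordinal at
  \<open>w\<close>, and glued again; the upper piece is the image of \<open>v\<close> under left
  translation by \<open>w\<close>.\<close>

lemma otyp_osum:
  assumes B: "lin B S" "x \<in> B" "y \<in> B" "z \<in> B" "(x, y) \<in> S" "(y, z) \<in> S"
    and w: "otyp B S x y w" and v: "otyp B S y z v"
  shows "otyp B S x z (w \<oplus> v)"
  unfolding otyp_def
proof (rule isomorphic_glue[where \<kappa> = "\<lambda>a. slt S a y" and \<kappa>' = "\<lambda>u. u < w" and K = UNIV and f = id])
  have "slt S a z" if "a \<in> B" "slt S a y" for a
    using that B linD(2,4)[OF B(1)] by metis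
  then have 1: "{a \<in> itv B S x z. slt S a y = True} = itv B S x y"
    by (auto simp: itv_def)
  have "(x, a) \<in> S" if "a \<in> B" "(y, a) \<in> S" for a
    using that B linD(4)[OF B(1)] by blast
  then have 2: "{a \<in> itv B S x z. slt S a y = False} = itv B S y z"
    using linD(5)[OF B(1,3)] by (auto simp: itv_def)
  have 3: "{u \<in> {..<w \<oplus> v}. (u < w) = id True} = {..<w}"
    by (auto intro: order.strict_trans2)
  have 4: "isomorphic {..<v} ole {u \<in> {..<w \<oplus> v}. (u < w) = id False} ole"
    by (rule isomorphicI[of "\<lambda>u. w \<oplus> u"])
      (auto simp: bij_betw_def inj_on_def image_iff not_less elim: le_imp_osum)
  fix k :: bool
  show "isomorphic {a \<in> itv B S x z. slt S a y = k} S {u \<in> {..<w \<oplus> v}. (u < w) = id k} ole"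
  proof (cases k)
    case True
    then show ?thesis using w 1 3 by (simp add: otyp_def)
  next
    case False
    then show ?thesis using isomorphic_trans[OF v[unfolded otyp_def] 4] 2 by simp
  qed
next
  fix a b a' b' assume ab: "a \<in> itv B S x z" "b \<in> itv B S x z" "a' \<in> {..<w \<oplus> v}" "b' \<in> {..<w \<oplus> v}"
    "(a' < w) = id (slt S a y)" "(b' < w) = id (slt S b y)" "slt S a y \<noteq> slt S b y"
  then have aB: "a \<in> B" "b \<in> B" by (auto simp: itv_def)
  show "(a, b) \<in> S \<longleftrightarrow> (a', b') \<in> ole"
  proof (cases "slt S a y")
    case True
    then have "(y, b) \<in> S" using ab linD(5)[OF B(1,3) aB(2)] by blast
    then have "(a, b) \<in> S" using True linD(4)[OF B(1) aB(1) B(3) aB(2)] by blast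
    moreover have "a' < w" "\<not> b' < w" using True ab by auto
    ultimately show ?thesis by auto
  next
    case False
    then have b: "slt S b y" "(y, a) \<in> S" using ab linD(5)[OF B(1,3) aB(1)] by blast+
    then have "(a, b) \<notin> S" using linD(2,4)[OF B(1) B(3)] aB by metis
    moreover have "b' < w" "\<not> a' < w" using False b ab by auto
    ultimately show ?thesis by auto
  qed
qed auto

lemma otyp_osum_split:
  assumes B: "lin B S" "x \<in> B" "z \<in> B" "(x, z) \<in> S" and w: "otyp B S x z (w \<oplus> v :: 'b::wellorder multiset)"
  obtains y where "y \<in> B" "(x, y) \<in> S" "(y, z) \<in> S" "otyp B S x y w" "otyp B S y z v"
\<comment> \<open>With empty \<open>v\<close> the cut point is \<open>z\<close> itself. Otherwise
  \<open>w\<close> lies below \<open>w \<oplus> v\<close>, and the cut point is the element it comes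
  from.\<close>
proof (cases "v = {#}")
  case True
  have "\<not> u < ({#} :: 'b multiset)" for u
    by (metis le_multiset_empty_left less_asym less_irrefl)
  then have "{..<{#} :: 'b multiset} = {}" by blast
  moreover have "itv B S z z = {}" using linD(2)[OF B(1) B(3)] unfolding itv_def by blast
  ultimately have "otyp B S z z v" using True by (simp add: otyp_def isomorphic_def bij_betw_def)
  then show ?thesis using that[of z] B w True linD(1)[OF B(1)] by simp
next
  case False
  obtain f where f: "bij_betw f (itv B S x z) {..<w \<oplus> v}"
    "\<And>a b. a \<in> itv B S x z \<Longrightarrow> b \<in> itv B S x z \<Longrightarrow> (a, b) \<in> S \<longleftrightarrow> f a \<le> f b"
    "\<And>a. a \<in> itv B S x z \<Longrightarrow> f a < w \<oplus> v" "\<And>u. u < w \<oplus> v \<Longrightarrow> \<exists>a\<in>itv B S x z. f a = u"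
    "\<And>a b. a \<in> itv B S x z \<Longrightarrow> b \<in> itv B S x z \<Longrightarrow> a = b \<longleftrightarrow> f a = f b"
    by (rule otyp_isoE[OF w]) (rule that)
  obtain y where y: "y \<in> itv B S x z" "f y = w"
    using f(4)[of w] False by auto
  have 1: "otyp B S x y w"
    using otyp_initial_at[OF B(1-3) y(1) f(1,2)] y(2) by blast
  note s = itv_sub[OF B(1-3) y(1)]
  have "isomorphic (itv B S y z) S {u. w \<le> u \<and> u < w \<oplus> v} ole"
  proof (rule isomorphicI[of f])
    have "f ` itv B S y z = {u. w \<le> u \<and> u < w \<oplus> v}"
    proof
      show "f ` itv B S y z \<subseteq> {u. w \<le> u \<and> u < w \<oplus> v}" using s(2) f(2,3) y by auto
      show "{u. w \<le> u \<and> u < w \<oplus> v} \<subseteq> f ` itv B S y z"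
      proof
        fix u assume u: "u \<in> {u. w \<le> u \<and> u < w \<oplus> v}"
        then obtain a where a: "a \<in> itv B S x z" "f a = u" using f(4)[of u] by auto
        then have "(y, a) \<in> S" using f(2) y u by auto
        then show "u \<in> f ` itv B S y z" using a s(2) by auto
      qed
    qed
    then show "bij_betw f (itv B S y z) {u. w \<le> u \<and> u < w \<oplus> v}"
      using f(5) s(2) by (auto simp: bij_betw_def inj_on_def)
    show "(a, b) \<in> S \<longleftrightarrow> (f a, f b) \<in> ole" if "a \<in> itv B S y z" "b \<in> itv B S y z" for a b
      using f(2)[of a b] that s(2) by auto
  qed
  moreover have "isomorphic {..<v} ole {u. w \<le> u \<and> u < w \<oplus> v} ole"
    by (rule isomorphicI[of "\<lambda>u. w \<oplus> u"])
      (auto simp: bij_betw_def inj_on_def image_iff not_less elim: le_imp_osum)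
  ultimately have "otyp B S y z v"
    unfolding otyp_def using isomorphic_sym isomorphic_trans by blast
  then show ?thesis using that[OF s(3,4)] s(5) 1 by blast
qed


section \<open>Infinitary formulas\<close>

lemma sat_iso:
  assumes f: "bij_betw f A B" "\<And>x y. x \<in> A \<Longrightarrow> y \<in> A \<Longrightarrow> (x, y) \<in> R \<longleftrightarrow> (f x, f y) \<in> S"
  shows "range e \<subseteq> A \<Longrightarrow> sat A R \<phi> e \<longleftrightarrow> sat B S \<phi> (f \<circ> e)"
proof (induction \<phi> arbitrary: e)
  case (Eq x y)
  then have "e x \<in> A" "e y \<in> A" by auto
  then show ?case using f(1) by (auto simp: bij_betw_def inj_on_def)
next
  case (Le x y)
  then have "e x \<in> A" "e y \<in> A" by auto
  then show ?case by (simp add: f(2))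
next
  case (Ex x \<phi>)
  have "sat A R \<phi> (e(x := a)) \<longleftrightarrow> sat B S \<phi> ((f \<circ> e)(x := f a))" if "a \<in> A" for a
  proof -
    have "range (e(x := a)) \<subseteq> A" using Ex.prems that by auto
    moreover have "f \<circ> e(x := a) = (f \<circ> e)(x := f a)" by auto
    ultimately show ?thesis using Ex.IH[of "e(x := a)"] by metis
  qed
  moreover have "B = f ` A" using f(1) by (auto simp: bij_betw_def)
  ultimately show ?case by (auto simp: comp_def)
next
  case (All x \<phi>)
  have "sat A R \<phi> (e(x := a)) \<longleftrightarrow> sat B S \<phi> ((f \<circ> e)(x := f a))" if "a \<in> A" for a
  proof -
    have "range (e(x := a)) \<subseteq> A" using All.prems that by auto
    moreover have "f \<circ> e(x := a) = (f \<circ> e)(x := f a)" by auto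
    ultimately show ?thesis using All.IH[of "e(x := a)"] by metis
  qed
  moreover have "B = f ` A" using f(1) by (auto simp: bij_betw_def)
  ultimately show ?case by (auto simp: comp_def)
qed auto

lemma models_iso:
  assumes "isomorphic A R B S" "models A R \<phi>"
  shows "models B S \<phi>"
proof -
  obtain f where f: "bij_betw f A B" "\<And>x y. x \<in> A \<Longrightarrow> y \<in> A \<Longrightarrow> (x, y) \<in> R \<longleftrightarrow> (f x, f y) \<in> S"
    using assms(1) unfolding isomorphic_def by blast
  have "sat B S \<phi> e" if e: "range e \<subseteq> B" for e
  proof -
    let ?e = "inv_into A f \<circ> e"
    have "range ?e \<subseteq> A" "f \<circ> ?e = e"
      using f(1) e by (auto simp: bij_betw_def inv_into_into f_inv_into_f fun_eq_iff image_subset_iff)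
    then show ?thesis using sat_iso[OF f, of ?e \<phi>] assms(2) by (simp add: models_def)
  qed
  then show ?thesis by (simp add: models_def)
qed

section \<open>Quantifier blocks and duality\<close>

lemma sat_Exs:
  "sat A R (Exs xs \<phi>) e \<longleftrightarrow>
    (\<exists>e'. (\<forall>v. v \<notin> set xs \<longrightarrow> e' v = e v) \<and> (\<forall>v\<in>set xs. e' v \<in> A) \<and> sat A R \<phi> e')"
proof (induction xs arbitrary: e)
  case Nil
  have "(\<forall>v. e' v = e v) \<longleftrightarrow> e' = e" for e' by auto
  then show ?case by (simp add: Exs_def)
next
  case (Cons x xs)
  have "Exs (x # xs) \<phi> = Ex x (Exs xs \<phi>)" by (simp add: Exs_def)
  then have "sat A R (Exs (x # xs) \<phi>) e \<longleftrightarrow> (\<exists>a\<in>A. \<exists>e'. (\<forall>v. v \<notin> set xs \<longrightarrow> e' v = (e(x := a)) v) \<and>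
      (\<forall>v\<in>set xs. e' v \<in> A) \<and> sat A R \<phi> e')" (is "_ \<longleftrightarrow> ?L")
    by (simp only: sat.simps Cons.IH)
  also have "\<dots> \<longleftrightarrow> (\<exists>e'. (\<forall>v. v \<notin> set (x # xs) \<longrightarrow> e' v = e v) \<and> (\<forall>v\<in>set (x # xs). e' v \<in> A) \<and> sat A R \<phi> e')"
    (is "_ \<longleftrightarrow> ?R")
  proof
    assume ?L
    then obtain a e' where e': "a \<in> A" "\<forall>v. v \<notin> set xs \<longrightarrow> e' v = (e(x := a)) v"
      "\<forall>v\<in>set xs. e' v \<in> A" "sat A R \<phi> e'" by blast
    then have "e' x \<in> A" by (metis fun_upd_same)
    then show ?R using e' by (intro exI[of _ e']) auto
  next
    assume ?R
    then obtain e' where e': "\<forall>v. v \<notin> set (x # xs) \<longrightarrow> e' v = e v" "\<forall>v\<in>set (x # xs). e' v \<in> A"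
      "sat A R \<phi> e'" by blast
    then show ?L by (intro bexI[of _ "e' x"] exI[of _ e']) auto
  qed
  finally show ?case .
qed

lemma fv_Exs [simp]: "fv (Exs xs \<phi>) = fv \<phi> - set xs"
  by (induction xs) (auto simp: Exs_def)

lemma fv_Alls [simp]: "fv (Alls xs \<phi>) = fv \<phi> - set xs"
  by (induction xs) (auto simp: Alls_def)

text \<open>The classes are syntactic, so negation has to be pushed through infinitary connectives
  and quantifiers. In \<open>Sigma_in\<close> and \<open>Pi_in\<close> the finitary connectives
  occur only within quantifier-free formulas, where a leading \<open>Neg\<close> is
  harmless.\<close>

primrec dual :: "form \<Rightarrow> form" where
  "dual Bot = Neg Bot"
| "dual (Eq x y) = Neg (Eq x y)"
| "dual (Le x y) = Neg (Le x y)"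
| "dual (Neg \<phi>) = Neg (Neg \<phi>)"
| "dual (And \<phi> \<psi>) = Neg (And \<phi> \<psi>)"
| "dual (Or \<phi> \<psi>) = Neg (Or \<phi> \<psi>)"
| "dual (Conj \<Phi>) = Disj (\<lambda>i. dual (\<Phi> i))"
| "dual (Disj \<Phi>) = Conj (\<lambda>i. dual (\<Phi> i))"
| "dual (Ex x \<phi>) = All x (dual \<phi>)"
| "dual (All x \<phi>) = Ex x (dual \<phi>)"

lemma sat_dual [simp]: "sat A R (dual \<phi>) e \<longleftrightarrow> \<not> sat A R \<phi> e"
  by (induction \<phi> arbitrary: e) auto

lemma fv_dual [simp]: "fv (dual \<phi>) = fv \<phi>"
  by (induction \<phi>) auto

lemma dual_qf: "finitary_qf \<phi> \<Longrightarrow> finitary_qf (dual \<phi>)"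
  by (cases \<phi>) auto

lemma dual_Exs: "dual (Exs xs \<phi>) = Alls xs (dual \<phi>)"
  by (induction xs) (auto simp: Exs_def Alls_def)

lemma dual_Alls: "dual (Alls xs \<phi>) = Exs xs (dual \<phi>)"
  by (induction xs) (auto simp: Exs_def Alls_def)

lemma sat_Alls:
  "sat A R (Alls xs \<phi>) e \<longleftrightarrow>
    (\<forall>e'. (\<forall>v. v \<notin> set xs \<longrightarrow> e' v = e v) \<and> (\<forall>v\<in>set xs. e' v \<in> A) \<longrightarrow> sat A R \<phi> e')"
proof -
  have "sat A R (Alls xs \<phi>) e \<longleftrightarrow> \<not> sat A R (Exs xs (dual \<phi>)) e"
    by (simp flip: dual_Alls)
  then show ?thesis unfolding sat_Exs sat_dual by blast
qed

lemma dual_Sigma_Pi: "(Sigma_in \<alpha> \<phi> \<longrightarrow> Pi_in \<alpha> (dual \<phi>)) \<and> (Pi_in \<beta> \<psi> \<longrightarrow> Sigma_in \<beta> (dual \<psi>))"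
proof -
  have "(Sigma_in \<alpha> \<phi> \<Longrightarrow> Pi_in \<alpha> (dual \<phi>))" and "(Pi_in \<beta> \<psi> \<Longrightarrow> Sigma_in \<beta> (dual \<psi>))"
  proof (induction rule: Sigma_in_Pi_in.inducts)
    case (Sigma_pos \<beta> \<alpha> \<Phi> xs)
    then show ?case
      by (simp add: dual_Exs) (intro Pi_pos[where \<beta> = \<beta>], blast)
  next
    case (Pi_pos \<beta> \<alpha> \<Phi> xs)
    then show ?case
      by (simp add: dual_Alls) (intro Sigma_pos[where \<beta> = \<beta>], blast)
  qed (auto intro: Sigma_zero Pi_zero dual_qf)
  then show ?thesis by blast
qed

lemma Sigma_dual: "Pi_in \<alpha> \<phi> \<Longrightarrow> Sigma_in \<alpha> (dual \<phi>)"
  using dual_Sigma_Pi by blast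

lemma Pi_posE:
  assumes "Pi_in \<alpha> \<phi>" "0 < \<alpha>"
  obtains \<beta> \<Phi> xs where "\<phi> = Conj (\<lambda>i. Alls (xs i) (\<Phi> i))" "\<And>i. \<beta> i < \<alpha>" "\<And>i. Sigma_in (\<beta> i) (\<Phi> i)"
  using assms by (cases rule: Pi_in.cases) auto

lemma Sigma_posE:
  assumes "Sigma_in \<alpha> \<phi>" "0 < \<alpha>"
  obtains \<beta> \<Phi> xs where "\<phi> = Disj (\<lambda>i. Exs (xs i) (\<Phi> i))" "\<And>i. \<beta> i < \<alpha>" "\<And>i. Pi_in (\<beta> i) (\<Phi> i)"
  using assms by (cases rule: Sigma_in.cases) auto

lemma Pi_in_zero: "Pi_in 0 \<phi> \<Longrightarrow> finitary_qf \<phi>"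
  by (cases rule: Pi_in.cases) (auto simp: leD)

lemma Sigma_in_zero: "Sigma_in 0 \<phi> \<Longrightarrow> finitary_qf \<phi>"
  by (cases rule: Sigma_in.cases) (auto simp: leD)

text \<open>Level 0 is excluded because a quantifier-free formula is not literally a
  \<open>Conj\<close>; it is lifted by \<open>Pi_in_of_Sigma\<close>, which wraps it in a constant
  conjunction with empty quantifier blocks.\<close>

lemma Pi_in_mono: "Pi_in \<alpha> \<phi> \<Longrightarrow> 0 < \<alpha> \<Longrightarrow> \<alpha> \<le> \<beta> \<Longrightarrow> Pi_in \<beta> \<phi>"
  by (erule Pi_posE, assumption) (simp, rule Pi_pos, blast intro: order.strict_trans2)

lemma Sigma_in_mono: "Sigma_in \<alpha> \<phi> \<Longrightarrow> 0 < \<alpha> \<Longrightarrow> \<alpha> \<le> \<beta> \<Longrightarrow> Sigma_in \<beta> \<phi>"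
  by (erule Sigma_posE, assumption) (simp, rule Sigma_pos, blast intro: order.strict_trans2)

lemma Pi_in_of_Sigma: "Sigma_in \<alpha> \<phi> \<Longrightarrow> \<alpha> < \<beta> \<Longrightarrow> Pi_in \<beta> (Conj (\<lambda>i. Alls [] \<phi>))"
  by (rule Pi_pos[where \<beta> = "\<lambda>_. \<alpha>"]) simp


section \<open>Back-and-forth systems\<close>

text \<open>Each extension costs a level and may take in a whole finite set at once, matching the
  fact that a block of quantifiers costs one level whatever its length. Levels are bounded by \<mu>,
  and agreement is obtained for formulas up to level \<mu>.\<close>

locale back_forth_system =
  fixes A :: "'a set" and R and B :: "'b set" and S and J :: "omega1 \<Rightarrow> ('a \<times> 'b) set \<Rightarrow> bool"
    and \<mu> :: omega1
  assumes dom: "J \<alpha> p \<Longrightarrow> \<alpha> \<le> \<mu> \<Longrightarrow> p \<subseteq> A \<times> B"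
    and atomic: "J \<alpha> p \<Longrightarrow> \<alpha> \<le> \<mu> \<Longrightarrow> (a, b) \<in> p \<Longrightarrow> (a', b') \<in> p \<Longrightarrow>
      (a = a' \<longleftrightarrow> b = b') \<and> ((a, a') \<in> R \<longleftrightarrow> (b, b') \<in> S)"
    and forth: "J \<alpha> p \<Longrightarrow> \<alpha> \<le> \<mu> \<Longrightarrow> \<beta> < \<alpha> \<Longrightarrow> finite F \<Longrightarrow> F \<subseteq> A \<Longrightarrow> \<exists>q. p \<subseteq> q \<and> J \<beta> q \<and> F \<subseteq> fst ` q"
    and backw: "J \<alpha> p \<Longrightarrow> \<alpha> \<le> \<mu> \<Longrightarrow> \<beta> < \<alpha> \<Longrightarrow> finite G \<Longrightarrow> G \<subseteq> B \<Longrightarrow> \<exists>q. p \<subseteq> q \<and> J \<beta> q \<and> G \<subseteq> snd ` q"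
begin

lemma qf_agree:
  assumes "J \<alpha> p" "\<alpha> \<le> \<mu>"
  shows "finitary_qf \<phi> \<Longrightarrow> (\<And>v. v \<in> fv \<phi> \<Longrightarrow> (e v, e' v) \<in> p) \<Longrightarrow> sat A R \<phi> e \<longleftrightarrow> sat B S \<phi> e'"
proof (induction \<phi>)
  case (Eq x y)
  then show ?case using atomic[OF assms, of "e x" "e' x" "e y" "e' y"] by simp
next
  case (Le x y)
  then show ?case using atomic[OF assms, of "e x" "e' x" "e y" "e' y"] by simp
qed auto

text \<open>Values for a quantifier block are prescribed on one side and answered on the other.
  Variables outside the block keep their values, and only the free variables of \<Phi> have to be
  paired.\<close>

lemma extend_assignment:
  assumes p: "J \<alpha> p" "\<alpha> \<le> \<mu>" "\<beta> < \<alpha>" and v: "\<forall>v\<in>fv \<Phi> - set xs. (e v, e' v) \<in> p"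
  shows "(\<forall>v\<in>set xs. e\<^sub>1 v \<in> A) \<Longrightarrow> (\<forall>v. v \<notin> set xs \<longrightarrow> e\<^sub>1 v = e v) \<Longrightarrow>
      \<exists>e\<^sub>2 q. (\<forall>v\<in>set xs. e\<^sub>2 v \<in> B) \<and> (\<forall>v. v \<notin> set xs \<longrightarrow> e\<^sub>2 v = e' v) \<and> J \<beta> q \<and>
        (\<forall>v\<in>fv \<Phi>. (e\<^sub>1 v, e\<^sub>2 v) \<in> q)"
    and "(\<forall>v\<in>set xs. e\<^sub>2 v \<in> B) \<Longrightarrow> (\<forall>v. v \<notin> set xs \<longrightarrow> e\<^sub>2 v = e' v) \<Longrightarrow>
      \<exists>e\<^sub>1 q. (\<forall>v\<in>set xs. e\<^sub>1 v \<in> A) \<and> (\<forall>v. v \<notin> set xs \<longrightarrow> e\<^sub>1 v = e v) \<and> J \<beta> q \<and>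
        (\<forall>v\<in>fv \<Phi>. (e\<^sub>1 v, e\<^sub>2 v) \<in> q)"
proof -
  have bm: "\<beta> \<le> \<mu>" using p by simp
  assume 1: "\<forall>v\<in>set xs. e\<^sub>1 v \<in> A" "\<forall>v. v \<notin> set xs \<longrightarrow> e\<^sub>1 v = e v"
  obtain q where q: "p \<subseteq> q" "J \<beta> q" "e\<^sub>1 ` set xs \<subseteq> fst ` q"
    using forth[OF p, of "e\<^sub>1 ` set xs"] 1 by auto
  then have "\<exists>b. (e\<^sub>1 v, b) \<in> q" if "v \<in> set xs" for v
    using that by force
  then obtain g where g: "\<And>v. v \<in> set xs \<Longrightarrow> (e\<^sub>1 v, g v) \<in> q" by metis
  let ?e2 = "\<lambda>v. if v \<in> set xs then g v else e' v"
  have "(e\<^sub>1 v, ?e2 v) \<in> q" if "v \<in> fv \<Phi>" for v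
    using g v q(1) 1(2) that by (cases "v \<in> set xs") auto
  moreover have "\<forall>v\<in>set xs. ?e2 v \<in> B" using g dom[OF q(2) bm] by auto
  ultimately show "\<exists>e\<^sub>2 q. (\<forall>v\<in>set xs. e\<^sub>2 v \<in> B) \<and> (\<forall>v. v \<notin> set xs \<longrightarrow> e\<^sub>2 v = e' v) \<and> J \<beta> q \<and>
        (\<forall>v\<in>fv \<Phi>. (e\<^sub>1 v, e\<^sub>2 v) \<in> q)"
    using q(2) by (intro exI[of _ ?e2] exI[of _ q]) simp
next
  have bm: "\<beta> \<le> \<mu>" using p by simp
  assume 1: "\<forall>v\<in>set xs. e\<^sub>2 v \<in> B" "\<forall>v. v \<notin> set xs \<longrightarrow> e\<^sub>2 v = e' v"
  obtain q where q: "p \<subseteq> q" "J \<beta> q" "e\<^sub>2 ` set xs \<subseteq> snd ` q"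
    using backw[OF p, of "e\<^sub>2 ` set xs"] 1 by auto
  then have "\<exists>a. (a, e\<^sub>2 v) \<in> q" if "v \<in> set xs" for v
    using that by force
  then obtain g where g: "\<And>v. v \<in> set xs \<Longrightarrow> (g v, e\<^sub>2 v) \<in> q" by metis
  let ?e1 = "\<lambda>v. if v \<in> set xs then g v else e v"
  have "(?e1 v, e\<^sub>2 v) \<in> q" if "v \<in> fv \<Phi>" for v
    using g v q(1) 1(2) that by (cases "v \<in> set xs") auto
  moreover have "\<forall>v\<in>set xs. ?e1 v \<in> A" using g dom[OF q(2) bm] by auto
  ultimately show "\<exists>e\<^sub>1 q. (\<forall>v\<in>set xs. e\<^sub>1 v \<in> A) \<and> (\<forall>v. v \<notin> set xs \<longrightarrow> e\<^sub>1 v = e v) \<and> J \<beta> q \<and>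
        (\<forall>v\<in>fv \<Phi>. (e\<^sub>1 v, e\<^sub>2 v) \<in> q)"
    using q(2) by (intro exI[of _ ?e1] exI[of _ q]) simp
qed

lemma Exs_agree:
  assumes p: "J \<alpha> p" "\<alpha> \<le> \<mu>" "\<beta> < \<alpha>"
    and IH: "\<And>q e e'. J \<beta> q \<Longrightarrow> \<beta> \<le> \<mu> \<Longrightarrow> (\<And>v. v \<in> fv \<Phi> \<Longrightarrow> (e v, e' v) \<in> q) \<Longrightarrow> sat A R \<Phi> e \<longleftrightarrow> sat B S \<Phi> e'"
    and v: "\<And>v. v \<in> fv \<Phi> - set xs \<Longrightarrow> (e v, e' v) \<in> p"
  shows "sat A R (Exs xs \<Phi>) e \<longleftrightarrow> sat B S (Exs xs \<Phi>) e'"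
proof -
  have bm: "\<beta> \<le> \<mu>" using p by simp
  have v': "\<forall>v\<in>fv \<Phi> - set xs. (e v, e' v) \<in> p" using v by blast
  show ?thesis
  proof
    assume "sat A R (Exs xs \<Phi>) e"
    then obtain e1 where e1: "\<forall>v. v \<notin> set xs \<longrightarrow> e1 v = e v" "\<forall>v\<in>set xs. e1 v \<in> A" "sat A R \<Phi> e1"
      unfolding sat_Exs by (elim exE conjE) (rule that)
    from extend_assignment(1)[OF p v' e1(2,1)]
    obtain e2 q where e2: "\<forall>v\<in>set xs. e2 v \<in> B" "\<forall>v. v \<notin> set xs \<longrightarrow> e2 v = e' v" "J \<beta> q"
      "\<forall>v\<in>fv \<Phi>. (e1 v, e2 v) \<in> q"
      by (elim exE conjE) (rule that)
    have "sat B S \<Phi> e2"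
      using IH[OF e2(3) bm, of e1 e2] e2(4) e1(3) by simp
    then show "sat B S (Exs xs \<Phi>) e'"
      unfolding sat_Exs using e2(1,2) by (intro exI[of _ e2]) simp
  next
    assume "sat B S (Exs xs \<Phi>) e'"
    then obtain e2 where e2: "\<forall>v. v \<notin> set xs \<longrightarrow> e2 v = e' v" "\<forall>v\<in>set xs. e2 v \<in> B" "sat B S \<Phi> e2"
      unfolding sat_Exs by (elim exE conjE) (rule that)
    from extend_assignment(2)[OF p v' e2(2,1)]
    obtain e1 q where e1: "\<forall>v\<in>set xs. e1 v \<in> A" "\<forall>v. v \<notin> set xs \<longrightarrow> e1 v = e v" "J \<beta> q"
      "\<forall>v\<in>fv \<Phi>. (e1 v, e2 v) \<in> q"
      by (elim exE conjE) (rule that)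
    have "sat A R \<Phi> e1"
      using IH[OF e1(3) bm, of e1 e2] e1(4) e2(3) by simp
    then show "sat A R (Exs xs \<Phi>) e"
      unfolding sat_Exs using e1(1,2) by (intro exI[of _ e1]) simp
  qed
qed

text \<open>The levels of the formula and of the system descend together. Universal blocks are
  passed through \<open>dual\<close>, so that only the existential case is argued.\<close>

lemma agree:
  shows "Sigma_in \<alpha> \<phi> \<Longrightarrow> J \<alpha> p \<Longrightarrow> \<alpha> \<le> \<mu> \<Longrightarrow> (\<And>v. v \<in> fv \<phi> \<Longrightarrow> (e v, e' v) \<in> p) \<Longrightarrow> sat A R \<phi> e \<longleftrightarrow> sat B S \<phi> e'"
    and "Pi_in \<alpha>' \<phi>' \<Longrightarrow> J \<alpha>' p \<Longrightarrow> \<alpha>' \<le> \<mu> \<Longrightarrow> (\<And>v. v \<in> fv \<phi>' \<Longrightarrow> (e v, e' v) \<in> p) \<Longrightarrow> sat A R \<phi>' e \<longleftrightarrow> sat B S \<phi>' e'"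
proof (induction arbitrary: p e e' and p e e' rule: Sigma_in_Pi_in.inducts)
  case (Sigma_pos \<beta> \<alpha> \<Phi> xs)
  have "sat A R (Exs (xs i) (\<Phi> i)) e \<longleftrightarrow> sat B S (Exs (xs i) (\<Phi> i)) e'" for i
  proof (rule Exs_agree[OF Sigma_pos.prems(1,2), of "\<beta> i"])
    show "\<beta> i < \<alpha>" using Sigma_pos.IH by blast
    fix q e1 e2 assume "J (\<beta> i) q" "\<beta> i \<le> \<mu>" "\<And>v. v \<in> fv ((\<Phi> i)) \<Longrightarrow> (e1 v, e2 v) \<in> q"
    then show "sat A R ((\<Phi> i)) e1 \<longleftrightarrow> sat B S ((\<Phi> i)) e2"
      using Sigma_pos.IH[of i] by simp
  next
    fix v assume "v \<in> fv ((\<Phi> i)) - set (xs i)"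
    then show "(e v, e' v) \<in> p" by (intro Sigma_pos.prems(3)) auto
  qed
  then show ?case by simp
next
  case (Pi_pos \<beta> \<alpha> \<Phi> xs)
  have "sat A R (dual (Alls (xs i) (\<Phi> i))) e \<longleftrightarrow> sat B S (dual (Alls (xs i) (\<Phi> i))) e'" for i
    unfolding dual_Alls
  proof (rule Exs_agree[OF Pi_pos.prems(1,2), of "\<beta> i"])
    show "\<beta> i < \<alpha>" using Pi_pos.IH by blast
    fix q e1 e2 assume "J (\<beta> i) q" "\<beta> i \<le> \<mu>" "\<And>v. v \<in> fv (dual (\<Phi> i)) \<Longrightarrow> (e1 v, e2 v) \<in> q"
    then show "sat A R (dual (\<Phi> i)) e1 \<longleftrightarrow> sat B S (dual (\<Phi> i)) e2"
      using Pi_pos.IH[of i] by simp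
  next
    fix v assume "v \<in> fv (dual (\<Phi> i)) - set (xs i)"
    then show "(e v, e' v) \<in> p" by (intro Pi_pos.prems(3)) auto
  qed
  then show ?case by simp
qed (use qf_agree in blast)+

end


section \<open>Definable predicates\<close>

type_synonym 'a pred = "'a set \<Rightarrow> 'a rel \<Rightarrow> (nat \<Rightarrow> 'a) \<Rightarrow> bool"

text \<open>Semantic predicates hide the syntax; one formula has to define \<open>P\<close> in all
  linear orders on the type at once. Keeping track of \<Pi> alone suffices because a negation costs
  one level.\<close>

definition Pi_definable :: "omega1 \<Rightarrow> nat set \<Rightarrow> 'a pred \<Rightarrow> bool" where
  "Pi_definable \<alpha> V P \<longleftrightarrow> (\<exists>\<phi>. Pi_in \<alpha> \<phi> \<and> fv \<phi> \<subseteq> V \<and>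
     (\<forall>B S e. lin B S \<longrightarrow> range e \<subseteq> B \<longrightarrow> (sat B S \<phi> e \<longleftrightarrow> P B S e)))"

lemma Pi_definableI:
  "Pi_in \<alpha> \<phi> \<Longrightarrow> fv \<phi> \<subseteq> V \<Longrightarrow>
    (\<And>B S e. lin B S \<Longrightarrow> range e \<subseteq> B \<Longrightarrow> sat B S \<phi> e \<longleftrightarrow> P B S e) \<Longrightarrow> Pi_definable \<alpha> V P"
  unfolding Pi_definable_def by blast

lemma Pi_definableE:
  assumes "Pi_definable \<alpha> V P"
  obtains \<phi> where "Pi_in \<alpha> \<phi>" "fv \<phi> \<subseteq> V"
    "\<And>B S e. lin B S \<Longrightarrow> range e \<subseteq> B \<Longrightarrow> sat B S \<phi> e \<longleftrightarrow> P B S e"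
  using assms unfolding Pi_definable_def by blast

lemma Pi_definable_cong:
  assumes "Pi_definable \<alpha> V P" "\<And>B S e. lin B S \<Longrightarrow> range e \<subseteq> B \<Longrightarrow> P B S e \<longleftrightarrow> Q B S e"
  shows "Pi_definable \<alpha> V Q"
proof -
  obtain \<phi> where \<phi>: "Pi_in \<alpha> \<phi>" "fv \<phi> \<subseteq> V"
    "\<And>B S e. lin B S \<Longrightarrow> range e \<subseteq> B \<Longrightarrow> sat B S \<phi> e \<longleftrightarrow> P B S e"
    by (rule Pi_definableE[OF assms(1)]) (rule that)
  show ?thesis
    by (rule Pi_definableI[OF \<phi>(1,2)]) (use \<phi>(3) assms(2) in simp)
qed

lemma Pi_definable_mono:
  assumes "Pi_definable \<alpha> V P" "\<alpha> \<le> \<beta>" "V \<subseteq> W"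
  shows "Pi_definable \<beta> W P"
proof -
  obtain \<phi> where \<phi>: "Pi_in \<alpha> \<phi>" "fv \<phi> \<subseteq> V"
    "\<And>B S e. lin B S \<Longrightarrow> range e \<subseteq> B \<Longrightarrow> sat B S \<phi> e \<longleftrightarrow> P B S e"
    by (rule Pi_definableE[OF assms(1)]) (rule that)
  show ?thesis
  proof (cases "\<alpha> = \<beta>")
    case True
    show ?thesis
      by (rule Pi_definableI[of _ \<phi>]) (use \<phi> assms(3) True in auto)
  next
    case F: False
    then have lt: "\<alpha> < \<beta>" using assms(2) by simp
    show ?thesis
    \<comment> \<open>A quantifier-free formula has to be wrapped into a conjunction; from level 1
      on the formula itself can be kept.\<close>
    proof (cases "\<alpha> = 0")
      case True
      then have "Sigma_in \<alpha> \<phi>" using Pi_in_zero \<phi>(1) Sigma_zero by blast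
      then have "Pi_in \<beta> (Conj (\<lambda>i. Alls [] \<phi>))" using lt by (rule Pi_in_of_Sigma)
      then show ?thesis
        by (rule Pi_definableI) (use \<phi> assms(3) in \<open>auto simp: Alls_def\<close>)
    next
      case False
      then have "Pi_in \<beta> \<phi>" using Pi_in_mono[OF \<phi>(1)] assms(2) by (simp add: order_less_le)
      then show ?thesis
        by (rule Pi_definableI) (use \<phi> assms(3) in auto)
    qed
  qed
qed

text \<open>A block of any finite length costs one level. The negated existential form is chosen so
  that \<open>Pi_definable_not\<close> turns it into the positive one.\<close>

lemma Pi_definable_block:
  assumes "Pi_definable \<alpha> W P" "\<alpha> < \<beta>" "W \<subseteq> V \<union> set zs"
  shows "Pi_definable \<beta> V (\<lambda>B S e. \<not> (\<exists>e'. (\<forall>v. v \<notin> set zs \<longrightarrow> e' v = e v) \<and> (\<forall>v\<in>set zs. e' v \<in> B) \<and> P B S e'))"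
proof -
  obtain \<phi> where \<phi>: "Pi_in \<alpha> \<phi>" "fv \<phi> \<subseteq> W"
    "\<And>B S e. lin B S \<Longrightarrow> range e \<subseteq> B \<Longrightarrow> sat B S \<phi> e \<longleftrightarrow> P B S e"
    by (rule Pi_definableE[OF assms(1)]) (rule that)
  show ?thesis
  proof (rule Pi_definableI)
    show "Pi_in \<beta> (Conj (\<lambda>i. Alls zs (dual \<phi>)))"
      by (rule Pi_pos[where \<beta> = "\<lambda>_. \<alpha>"]) (use Sigma_dual[OF \<phi>(1)] assms(2) in simp)
    show "fv (Conj (\<lambda>i. Alls zs (dual \<phi>))) \<subseteq> V" using \<phi>(2) assms(3) by auto
    fix B S and e :: "nat \<Rightarrow> 'a" assume B: "lin B S" "range e \<subseteq> B"
    have *: "sat B S \<phi> e' \<longleftrightarrow> P B S e'"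
      if "\<forall>v. v \<notin> set zs \<longrightarrow> e' v = e v" "\<forall>v\<in>set zs. e' v \<in> B" for e'
    proof (rule \<phi>(3)[OF B(1)])
      show "range e' \<subseteq> B"
      proof
        fix x assume "x \<in> range e'"
        then obtain v where "x = e' v" by blast
        then show "x \<in> B" using that B(2) by (cases "v \<in> set zs") auto
      qed
    qed
    show "sat B S (Conj (\<lambda>i. Alls zs (dual \<phi>))) e \<longleftrightarrow>
      (\<not> (\<exists>e'. (\<forall>v. v \<notin> set zs \<longrightarrow> e' v = e v) \<and> (\<forall>v\<in>set zs. e' v \<in> B) \<and> P B S e'))"
      unfolding sat.simps sat_Alls sat_dual using * by metis
  qed
qed

lemma Pi_definable_not:
  assumes "Pi_definable \<alpha> V (\<lambda>B S e. \<not> P B S e)" "\<alpha> < \<beta>"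
  shows "Pi_definable \<beta> V P"
proof -
  have *: "(\<forall>v. e' v = e v) \<longleftrightarrow> e' = e" for e' e :: "nat \<Rightarrow> 'a" by auto
  show ?thesis
    by (rule Pi_definable_cong[OF Pi_definable_block[OF assms, of V "[]"]]) (simp_all add: *)
qed

lemma Pi_definable_Not:
  assumes "Pi_definable \<alpha> V P" "\<alpha> < \<beta>"
  shows "Pi_definable \<beta> V (\<lambda>B S e. \<not> P B S e)"
  by (rule Pi_definable_not[where \<alpha> = \<alpha>]) (use assms in simp_all)

text \<open>A conjunction of conjunctions is flattened by the pairing function, hence costs no
  level.\<close>

lemma Pi_definable_all_nat:
  assumes "\<And>i :: nat. Pi_definable \<alpha> V (P i)" "0 < \<alpha>"
  shows "Pi_definable \<alpha> V (\<lambda>B S e. \<forall>i. P i B S e)"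
proof -
  have "\<exists>\<phi>. Pi_in \<alpha> \<phi> \<and> fv \<phi> \<subseteq> V \<and>
     (\<forall>B S e. lin B S \<longrightarrow> range e \<subseteq> B \<longrightarrow> (sat B S \<phi> e \<longleftrightarrow> P i B S e))" for i
    using assms(1) unfolding Pi_definable_def by blast
  then obtain \<phi> where \<phi>: "\<And>i. Pi_in \<alpha> (\<phi> i)" "\<And>i. fv (\<phi> i) \<subseteq> V"
    "\<And>i B S e. lin B S \<Longrightarrow> range e \<subseteq> B \<Longrightarrow> sat B S (\<phi> i) e \<longleftrightarrow> P i B S e"
    by metis
  have "\<exists>\<Phi> xs \<beta>. \<phi> i = Conj (\<lambda>j. Alls (xs j) (\<Phi> j)) \<and> (\<forall>j. \<beta> j < \<alpha>) \<and> (\<forall>j. Sigma_in (\<beta> j) (\<Phi> j))" for i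
    by (rule Pi_posE[OF \<phi>(1)[of i] assms(2)]) blast
  then obtain \<Phi> xs \<beta> where \<Phi>: "\<And>i. \<phi> i = Conj (\<lambda>j. Alls (xs i j) (\<Phi> i j))" "\<And>i j. \<beta> i j < \<alpha>"
    "\<And>i j. Sigma_in (\<beta> i j) (\<Phi> i j)"
    by metis
  let ?f = "\<lambda>n. fst (prod_decode n)" and ?s = "\<lambda>n. snd (prod_decode n)"
  let ?\<psi> = "Conj (\<lambda>n. Alls (xs (?f n) (?s n)) (\<Phi> (?f n) (?s n)))"
  have all: "(\<forall>n. Q (?f n) (?s n)) \<longleftrightarrow> (\<forall>i j. Q i j)" for Q :: "nat \<Rightarrow> nat \<Rightarrow> bool"
    by (metis fst_conv snd_conv prod_encode_inverse)
  show ?thesis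
  proof (rule Pi_definableI)
    show "Pi_in \<alpha> ?\<psi>"
      by (rule Pi_pos[where \<beta> = "\<lambda>n. \<beta> (?f n) (?s n)"]) (simp add: \<Phi>)
    have "fv (Alls (xs i j) (\<Phi> i j)) \<subseteq> V" for i j
      using \<phi>(2)[of i] unfolding \<Phi>(1) fv.simps by blast
    then show "fv ?\<psi> \<subseteq> V" unfolding fv.simps by blast
    fix B S and e :: "nat \<Rightarrow> 'a" assume "lin B S" "range e \<subseteq> B"
    then have "P i B S e \<longleftrightarrow> (\<forall>j. sat B S (Alls (xs i j) (\<Phi> i j)) e)" for i
      using \<phi>(3)[of B S e i] by (simp add: \<Phi>(1))
    moreover have "sat B S ?\<psi> e \<longleftrightarrow> (\<forall>i j. sat B S (Alls (xs i j) (\<Phi> i j)) e)"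
      unfolding sat.simps by (rule all)
    ultimately show "sat B S ?\<psi> e \<longleftrightarrow> (\<forall>i. P i B S e)" by simp
  qed
qed

lemma Pi_definable_True: "0 < \<alpha> \<Longrightarrow> Pi_definable \<alpha> V (\<lambda>B S e. True)"
  by (rule Pi_definableI, rule Pi_in_of_Sigma[of 0 "Neg Bot"], rule Sigma_zero) (simp_all add: Alls_def)

lemma Pi_definable_ball:
  assumes "\<And>k. k \<in> K \<Longrightarrow> Pi_definable \<alpha> V (P k)" "0 < \<alpha>" "countable K"
  shows "Pi_definable \<alpha> V (\<lambda>B S e. \<forall>k\<in>K. P k B S e)"
proof (cases "K = {}")
  case True
  then show ?thesis using Pi_definable_True[OF assms(2)] by simp
next
  case False
  have "Pi_definable \<alpha> V (\<lambda>B S e. \<forall>i. P (from_nat_into K i) B S e)"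
    by (rule Pi_definable_all_nat[OF _ assms(2)]) (use assms(1) False in \<open>auto intro: from_nat_into\<close>)
  moreover have "(\<forall>i. Q (from_nat_into K i)) \<longleftrightarrow> (\<forall>k\<in>K. Q k)" for Q
    using False assms(3) by (metis from_nat_into from_nat_into_to_nat_on)
  ultimately show ?thesis by (rule Pi_definable_cong)
qed

lemma Pi_definable_conj:
  assumes "Pi_definable \<alpha> V P" "Pi_definable \<alpha> V Q" "0 < \<alpha>"
  shows "Pi_definable \<alpha> V (\<lambda>B S e. P B S e \<and> Q B S e)"
proof -
  have "Pi_definable \<alpha> V (\<lambda>B S e. \<forall>b\<in>UNIV. (if b then P else Q) B S e)"
    by (rule Pi_definable_ball) (use assms in auto)
  then show ?thesis by (rule Pi_definable_cong) (auto simp: all_bool_eq split: if_splits)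
qed

text \<open>The new quantifier is prepended to the block of every conjunct, hence costs no
  level.\<close>

lemma Pi_definable_All:
  assumes "Pi_definable \<alpha> W P" "0 < \<alpha>" "W \<subseteq> insert z V"
  shows "Pi_definable \<alpha> V (\<lambda>B S e. \<forall>a\<in>B. P B S (e(z := a)))"
proof -
  obtain \<phi> where \<phi>: "Pi_in \<alpha> \<phi>" "fv \<phi> \<subseteq> W"
    "\<And>B S e. lin B S \<Longrightarrow> range e \<subseteq> B \<Longrightarrow> sat B S \<phi> e \<longleftrightarrow> P B S e"
    by (rule Pi_definableE[OF assms(1)]) (rule that)
  obtain \<beta> \<Phi> xs where \<Phi>: "\<phi> = Conj (\<lambda>i. Alls (xs i) (\<Phi> i))" "\<And>i. \<beta> i < \<alpha>" "\<And>i. Sigma_in (\<beta> i) (\<Phi> i)"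
    by (rule Pi_posE[OF \<phi>(1) assms(2)]) (rule that)
  let ?\<psi> = "Conj (\<lambda>i. Alls (z # xs i) (\<Phi> i))"
  show ?thesis
  proof (rule Pi_definableI)
    show "Pi_in \<alpha> ?\<psi>"
      by (rule Pi_pos[where \<beta> = \<beta>]) (simp add: \<Phi>)
    have "fv (Alls (xs i) (\<Phi> i)) \<subseteq> insert z V" for i
      using \<phi>(2) assms(3) unfolding \<Phi>(1) fv.simps by blast
    then show "fv ?\<psi> \<subseteq> V" unfolding fv.simps fv_Alls by force
    fix B S and e :: "nat \<Rightarrow> 'a" assume B: "lin B S" "range e \<subseteq> B"
    have "sat B S \<phi> (e(z := a)) \<longleftrightarrow> P B S (e(z := a))" if "a \<in> B" for a
      by (rule \<phi>(3)[OF B(1)]) (use B(2) that in auto)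
    moreover have "sat B S ?\<psi> e \<longleftrightarrow> (\<forall>a\<in>B. sat B S \<phi> (e(z := a)))"
      by (auto simp: \<Phi>(1) Alls_def)
    ultimately show "sat B S ?\<psi> e \<longleftrightarrow> (\<forall>a\<in>B. P B S (e(z := a)))" by simp
  qed
qed

lemma Pi_definable_qf:
  assumes "finitary_qf \<phi>" "fv \<phi> \<subseteq> V"
  shows "Pi_definable \<alpha> V (\<lambda>B S e. sat B S \<phi> e)"
  by (rule Pi_definable_mono[of 0 V], rule Pi_definableI[OF Pi_zero]) (use assms in simp_all)

text \<open>A countable conjunction of formulas raises the complexity only if the complexities of the
  conjuncts are uniformly bounded, so definability is tracked for families.\<close>

definition fam_definable :: "omega1 \<Rightarrow> 'k set \<Rightarrow> ('k \<Rightarrow> nat set) \<Rightarrow> ('k \<Rightarrow> 'a pred) \<Rightarrow> bool" where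
  "fam_definable \<alpha> K V P \<longleftrightarrow> (\<exists>n. \<forall>k\<in>K. Pi_definable ((succ_ord ^^ n) \<alpha>) (V k) (P k))"

lemma fam_definableI:
  "(\<And>k. k \<in> K \<Longrightarrow> Pi_definable ((succ_ord ^^ n) \<alpha>) (V k) (P k)) \<Longrightarrow> fam_definable \<alpha> K V P"
  unfolding fam_definable_def by blast

lemma fam_definableE:
  assumes "fam_definable \<alpha> K V P"
  obtains n where "\<And>m k. n \<le> m \<Longrightarrow> k \<in> K \<Longrightarrow> Pi_definable ((succ_ord ^^ m) \<alpha>) (V k) (P k)"
proof -
  obtain n where n: "\<And>k. k \<in> K \<Longrightarrow> Pi_definable ((succ_ord ^^ n) \<alpha>) (V k) (P k)"
    using assms unfolding fam_definable_def by blast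
  show ?thesis
    by (rule that[of n], rule Pi_definable_mono[OF n]) (simp_all add: funpow_succ_mono_exp)
qed

text \<open>A limit is closed under successor, so the unknown finite excess is immaterial. This is
  the only precision about levels that is needed below \<open>l\<close>.\<close>

lemma fam_definable_below:
  assumes "fam_definable \<alpha> K V P" "limit_ord l" "\<alpha> < l" "k \<in> K"
  shows "\<exists>\<beta><l. Pi_definable \<beta> (V k) (P k)"
proof -
  obtain n where "Pi_definable ((succ_ord ^^ n) \<alpha>) (V k) (P k)"
    using assms(1,4) unfolding fam_definable_def by blast
  then show ?thesis using limit_ord_funpow_succ[OF assms(2,3)] by blast
qed

lemma fam_definable_cong:
  assumes "fam_definable \<alpha> K V P"
    and "\<And>k B S e. k \<in> K \<Longrightarrow> lin B S \<Longrightarrow> range e \<subseteq> B \<Longrightarrow> P k B S e \<longleftrightarrow> Q k B S e"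
  shows "fam_definable \<alpha> K V Q"
proof -
  obtain n where n: "\<And>k. k \<in> K \<Longrightarrow> Pi_definable ((succ_ord ^^ n) \<alpha>) (V k) (P k)"
    using assms(1) unfolding fam_definable_def by blast
  show ?thesis
    by (rule fam_definableI[of _ n], rule Pi_definable_cong[OF n]) (simp_all add: assms(2))
qed

lemma fam_definable_reindex:
  assumes "fam_definable \<alpha> K V P" "\<And>j. j \<in> J \<Longrightarrow> h j \<in> K \<and> V (h j) \<subseteq> W j"
  shows "fam_definable \<alpha> J W (\<lambda>j. P (h j))"
proof -
  obtain n where "\<And>k. k \<in> K \<Longrightarrow> Pi_definable ((succ_ord ^^ n) \<alpha>) (V k) (P k)"
    using assms(1) unfolding fam_definable_def by blast
  then show ?thesis
    by (intro fam_definableI[of _ n]) (rule Pi_definable_mono, use assms(2) in auto)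
qed

lemma fam_definable_mono:
  assumes "fam_definable \<alpha> K V P" "\<alpha> \<le> \<beta>"
  shows "fam_definable \<beta> K V P"
proof -
  obtain n where "\<And>k. k \<in> K \<Longrightarrow> Pi_definable ((succ_ord ^^ n) \<alpha>) (V k) (P k)"
    using assms(1) unfolding fam_definable_def by blast
  then show ?thesis
    by (intro fam_definableI[of _ n]) (rule Pi_definable_mono, use funpow_succ_mono[OF assms(2)] in auto)
qed

lemma fam_definable_Un:
  assumes "fam_definable \<alpha> K V P" "fam_definable \<alpha> K' V P"
  shows "fam_definable \<alpha> (K \<union> K') V P"
proof -
  obtain n where n: "\<And>m k. n \<le> m \<Longrightarrow> k \<in> K \<Longrightarrow> Pi_definable ((succ_ord ^^ m) \<alpha>) (V k) (P k)"
    by (rule fam_definableE[OF assms(1)]) (rule that)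
  obtain n' where n': "\<And>m k. n' \<le> m \<Longrightarrow> k \<in> K' \<Longrightarrow> Pi_definable ((succ_ord ^^ m) \<alpha>) (V k) (P k)"
    by (rule fam_definableE[OF assms(2)]) (rule that)
  show ?thesis
    by (rule fam_definableI[of _ "max n n'"]) (use n n' in auto)
qed

lemma fam_definable_not:
  assumes "fam_definable \<alpha> K V P"
  shows "fam_definable \<alpha> K V (\<lambda>k B S e. \<not> P k B S e)"
proof -
  obtain n where n: "\<And>m k. n \<le> m \<Longrightarrow> k \<in> K \<Longrightarrow> Pi_definable ((succ_ord ^^ m) \<alpha>) (V k) (P k)"
    by (rule fam_definableE[OF assms(1)]) (rule that)
  show ?thesis
    by (rule fam_definableI[of _ "Suc n"], rule Pi_definable_Not[OF n[OF order_refl]]) auto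
qed

lemma fam_definable_conj:
  assumes "fam_definable \<alpha> K V P" "fam_definable \<alpha> K V Q"
  shows "fam_definable \<alpha> K V (\<lambda>k B S e. P k B S e \<and> Q k B S e)"
proof -
  obtain n where n: "\<And>m k. n \<le> m \<Longrightarrow> k \<in> K \<Longrightarrow> Pi_definable ((succ_ord ^^ m) \<alpha>) (V k) (P k)"
    by (rule fam_definableE[OF assms(1)]) (rule that)
  obtain n' where n': "\<And>m k. n' \<le> m \<Longrightarrow> k \<in> K \<Longrightarrow> Pi_definable ((succ_ord ^^ m) \<alpha>) (V k) (Q k)"
    by (rule fam_definableE[OF assms(2)]) (rule that)
  have "n \<le> Suc (max n n')" "n' \<le> Suc (max n n')" by auto
  then show ?thesis
    by (intro fam_definableI[of _ "Suc (max n n')"] Pi_definable_conj funpow_Suc_pos n n')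
qed

lemma fam_definable_disj:
  assumes "fam_definable \<alpha> K V P" "fam_definable \<alpha> K V Q"
  shows "fam_definable \<alpha> K V (\<lambda>k B S e. P k B S e \<or> Q k B S e)"
  using fam_definable_not[OF fam_definable_conj[OF assms[THEN fam_definable_not]]] by simp

lemma fam_definable_imp:
  assumes "fam_definable \<alpha> K V P" "fam_definable \<alpha> K V Q"
  shows "fam_definable \<alpha> K V (\<lambda>k B S e. P k B S e \<longrightarrow> Q k B S e)"
  unfolding imp_conv_disj by (rule fam_definable_disj[OF fam_definable_not[OF assms(1)] assms(2)])

lemma fam_definable_all:
  assumes "fam_definable \<alpha> K W P" "\<And>k. k \<in> K \<Longrightarrow> W k \<subseteq> insert (z k) (V k)"
  shows "fam_definable \<alpha> K V (\<lambda>k B S e. \<forall>a\<in>B. P k B S (e(z k := a)))"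
proof -
  obtain n where n: "\<And>m k. n \<le> m \<Longrightarrow> k \<in> K \<Longrightarrow> Pi_definable ((succ_ord ^^ m) \<alpha>) (W k) (P k)"
    by (rule fam_definableE[OF assms(1)]) (rule that)
  show ?thesis
    by (rule fam_definableI[of _ "Suc n"], rule Pi_definable_All[OF n funpow_Suc_pos]) (use assms(2) in auto)
qed

lemma fam_definable_ball:
  assumes "fam_definable \<alpha> (Sigma K J) (\<lambda>(k, j). V k) (\<lambda>(k, j). P k j)" "\<And>k. k \<in> K \<Longrightarrow> countable (J k)"
  shows "fam_definable \<alpha> K V (\<lambda>k B S e. \<forall>j\<in>J k. P k j B S e)"
proof -
  obtain n where n: "\<And>m k. n \<le> m \<Longrightarrow> k \<in> Sigma K J \<Longrightarrow>
      Pi_definable ((succ_ord ^^ m) \<alpha>) ((\<lambda>(k, j). V k) k) ((\<lambda>(k, j). P k j) k)"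
    by (rule fam_definableE[OF assms(1)]) (rule that)
  have "Pi_definable ((succ_ord ^^ Suc n) \<alpha>) (V k) (P k j)" if "k \<in> K" "j \<in> J k" for k j
    using n[of "Suc n" "(k, j)"] that by simp
  then show ?thesis
    by (intro fam_definableI[of _ "Suc n"] Pi_definable_ball funpow_Suc_pos assms(2))
qed

lemma fam_definable_qf:
  assumes "\<And>k. k \<in> K \<Longrightarrow> finitary_qf (\<phi> k) \<and> fv (\<phi> k) \<subseteq> V k"
  shows "fam_definable \<alpha> K V (\<lambda>k B S e. sat B S (\<phi> k) e)"
  by (rule fam_definableI[of _ 0], rule Pi_definable_qf) (use assms in simp_all)

lemma fam_definable_le: "(\<And>k. k \<in> K \<Longrightarrow> {x k, y k} \<subseteq> V k) \<Longrightarrow> fam_definable \<alpha> K V (\<lambda>k B S e. (e (x k), e (y k)) \<in> S)"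
  using fam_definable_qf[of K "\<lambda>k. Le (x k) (y k)" V \<alpha>] by simp

lemma fam_definable_slt: "(\<And>k. k \<in> K \<Longrightarrow> {x k, y k} \<subseteq> V k) \<Longrightarrow> fam_definable \<alpha> K V (\<lambda>k B S e. slt S (e (x k)) (e (y k)))"
  using fam_definable_qf[of K "\<lambda>k. And (Le (x k) (y k)) (Neg (Eq (x k) (y k)))" V \<alpha>] by simp

text \<open>Predicates of \<open>n\<close> arguments are given by the list of their arguments, so that quantification
  becomes consing and no bookkeeping of variable names is needed.\<close>

definition n_definable ::
  "omega1 \<Rightarrow> 'k set \<Rightarrow> nat \<Rightarrow> ('k \<Rightarrow> 'a set \<Rightarrow> 'a rel \<Rightarrow> 'a list \<Rightarrow> bool) \<Rightarrow> bool" where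
  "n_definable \<alpha> K n P \<longleftrightarrow> fam_definable \<alpha> (K \<times> {xs. length xs = n}) (\<lambda>k. set (snd k))
     (\<lambda>k B S e. P (fst k) B S (map e (snd k)))"

lemma n_definable_cong:
  assumes "n_definable \<alpha> K n P"
    and "\<And>k B S xs. k \<in> K \<Longrightarrow> lin B S \<Longrightarrow> set xs \<subseteq> B \<Longrightarrow> length xs = n \<Longrightarrow> P k B S xs \<longleftrightarrow> Q k B S xs"
  shows "n_definable \<alpha> K n Q"
  unfolding n_definable_def
proof (rule fam_definable_cong[OF assms(1)[unfolded n_definable_def]])
  fix k :: "'a \<times> nat list" and B S and e :: "nat \<Rightarrow> 'b"
  assume "k \<in> K \<times> {xs. length xs = n}" "lin B S" "range e \<subseteq> B"
  then show "P (fst k) B S (map e (snd k)) \<longleftrightarrow> Q (fst k) B S (map e (snd k))"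
    by (intro assms(2)) auto
qed

lemma n_definable_reindex:
  assumes "n_definable \<alpha> K n P" "\<And>j. j \<in> J \<Longrightarrow> h j \<in> K"
  shows "n_definable \<alpha> J n (\<lambda>j. P (h j))"
  using fam_definable_reindex[OF assms(1)[unfolded n_definable_def],
      of "J \<times> {xs. length xs = n}" "\<lambda>k. (h (fst k), snd k)" "\<lambda>k. set (snd k)"] assms(2)
  unfolding n_definable_def by auto

lemma n_definable_subset: "n_definable \<alpha> K n P \<Longrightarrow> J \<subseteq> K \<Longrightarrow> n_definable \<alpha> J n P"
  using n_definable_reindex[of \<alpha> K n P J id] by auto

lemma n_definable_mono: "n_definable \<alpha> K n P \<Longrightarrow> \<alpha> \<le> \<beta> \<Longrightarrow> n_definable \<beta> K n P"
  unfolding n_definable_def by (rule fam_definable_mono)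

lemma n_definable_not: "n_definable \<alpha> K n P \<Longrightarrow> n_definable \<alpha> K n (\<lambda>k B S xs. \<not> P k B S xs)"
  unfolding n_definable_def by (rule fam_definable_not)

lemma n_definable_conj:
  "n_definable \<alpha> K n P \<Longrightarrow> n_definable \<alpha> K n Q \<Longrightarrow> n_definable \<alpha> K n (\<lambda>k B S xs. P k B S xs \<and> Q k B S xs)"
  unfolding n_definable_def by (rule fam_definable_conj)

lemma n_definable_imp:
  "n_definable \<alpha> K n P \<Longrightarrow> n_definable \<alpha> K n Q \<Longrightarrow> n_definable \<alpha> K n (\<lambda>k B S xs. P k B S xs \<longrightarrow> Q k B S xs)"
  unfolding n_definable_def by (rule fam_definable_imp)

lemma n_definable_proj:
  assumes "n_definable \<alpha> K m P" "length is = m" "\<And>i. i \<in> set is \<Longrightarrow> i < n"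
  shows "n_definable \<alpha> K n (\<lambda>k B S xs. P k B S (map ((!) xs) is))"
proof -
  have "fam_definable \<alpha> (K \<times> {xs. length xs = n}) (\<lambda>k. set (snd k))
     (\<lambda>j B S e. P (fst (fst j, map ((!) (snd j)) is)) B S (map e (snd (fst j, map ((!) (snd j)) is))))"
    by (rule fam_definable_reindex[OF assms(1)[unfolded n_definable_def]])
      (use assms(2,3) in auto)
  then show ?thesis
    unfolding n_definable_def
    by (rule fam_definable_cong) (use assms(3) in \<open>auto simp: comp_def cong: map_cong\<close>)
qed

lemma n_definable_at1:
  assumes "n_definable \<alpha> K 1 (\<lambda>k B S xs. Q k B S (xs ! 0))" "i < n"
  shows "n_definable \<alpha> K n (\<lambda>k B S xs. Q k B S (xs ! i))"
  using n_definable_proj[OF assms(1), of "[i]" n] assms(2) by simp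

lemma n_definable_at2:
  assumes "n_definable \<alpha> K 2 (\<lambda>k B S xs. Q k B S (xs ! 0) (xs ! 1))" "i < n" "j < n"
  shows "n_definable \<alpha> K n (\<lambda>k B S xs. Q k B S (xs ! i) (xs ! j))"
proof -
  have "n_definable \<alpha> K n (\<lambda>k B S xs. Q k B S (map ((!) xs) [i, j] ! 0) (map ((!) xs) [i, j] ! 1))"
    by (rule n_definable_proj[OF assms(1)]) (use assms(2,3) in auto)
  then show ?thesis by simp
qed

text \<open>The bound variable becomes argument 0 and all other arguments move up by one, which
  explains the index shifts in the definability proofs below.\<close>

lemma n_definable_all:
  assumes "n_definable \<alpha> K m P" "m = Suc n"
  shows "n_definable \<alpha> K n (\<lambda>k B S xs. \<forall>a\<in>B. P k B S (a # xs))"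
proof -
  \<comment> \<open>A fresh variable: it exceeds the sum, hence every member, of the list.\<close>
  define z where "z xs = Suc (sum_list xs)" for xs :: "nat list"
  have z: "z xs \<notin> set xs" for xs
    unfolding z_def using member_le_sum_list[of "Suc (sum_list xs)" xs] by auto
  have "fam_definable \<alpha> (K \<times> {xs. length xs = n}) (\<lambda>k. insert (z (snd k)) (set (snd k)))
     (\<lambda>j B S e. P (fst (fst j, z (snd j) # snd j)) B S (map e (snd (fst j, z (snd j) # snd j))))"
    by (rule fam_definable_reindex[OF assms(1)[unfolded n_definable_def]])
      (use assms(2) in auto)
  from fam_definable_all[OF this, of "\<lambda>k. z (snd k)" "\<lambda>k. set (snd k)", OF subset_refl]
  show ?thesis
    unfolding n_definable_def by (rule fam_definable_cong) (simp add: z)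
qed

lemma n_definable_ex:
  assumes "n_definable \<alpha> K m P" "m = Suc n"
  shows "n_definable \<alpha> K n (\<lambda>k B S xs. \<exists>a\<in>B. P k B S (a # xs))"
  using n_definable_not[OF n_definable_all[OF n_definable_not[OF assms(1)] assms(2)]] by simp

lemma n_definable_ball:
  assumes "n_definable \<alpha> (Sigma K J) n (\<lambda>k. P (fst k) (snd k))" "\<And>k. k \<in> K \<Longrightarrow> countable (J k)"
  shows "n_definable \<alpha> K n (\<lambda>k B S xs. \<forall>j\<in>J k. P k j B S xs)"
proof -
  have "fam_definable \<alpha> (Sigma (K \<times> {xs. length xs = n}) (\<lambda>k. J (fst k))) (\<lambda>kj. set (snd (fst kj)))
     (\<lambda>kj B S e. P (fst (fst kj)) (snd kj) B S (map e (snd (fst kj))))"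
    using fam_definable_reindex[OF assms(1)[unfolded n_definable_def],
        of "Sigma (K \<times> {xs. length xs = n}) (\<lambda>k. J (fst k))"
          "\<lambda>kj. ((fst (fst kj), snd kj), snd (fst kj))" "\<lambda>kj. set (snd (fst kj))"] by auto
  then show ?thesis
    unfolding n_definable_def
    by (intro fam_definable_ball) (use assms(2) in \<open>auto simp: case_prod_unfold\<close>)
qed

lemma n_definable_bex:
  assumes "n_definable \<alpha> (Sigma K J) n (\<lambda>k. P (fst k) (snd k))" "\<And>k. k \<in> K \<Longrightarrow> countable (J k)"
  shows "n_definable \<alpha> K n (\<lambda>k B S xs. \<exists>j\<in>J k. P k j B S xs)"
  using n_definable_not[OF n_definable_ball[OF n_definable_not[OF assms(1)] assms(2)]] by simp

lemma n_definable_le: "i < n \<Longrightarrow> j < n \<Longrightarrow> n_definable \<alpha> K n (\<lambda>k B S xs. (xs ! i, xs ! j) \<in> S)"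
  unfolding n_definable_def
  by (rule fam_definable_cong[OF fam_definable_le[of _ "\<lambda>k. snd k ! i" "\<lambda>k. snd k ! j"]]) auto

lemma n_definable_slt: "i < n \<Longrightarrow> j < n \<Longrightarrow> n_definable \<alpha> K n (\<lambda>k B S xs. slt S (xs ! i) (xs ! j))"
  unfolding n_definable_def
  by (rule fam_definable_cong[OF fam_definable_slt[of _ "\<lambda>k. snd k ! i" "\<lambda>k. snd k ! j"]]) auto

lemma n_definable_below:
  assumes "n_definable \<alpha> K n P" "limit_ord l" "\<alpha> < l" "k \<in> K"
  shows "\<exists>\<beta><l. Pi_definable \<beta> {..<n} (\<lambda>B S e. P k B S (map e [0..<n]))"
  using fam_definable_below[OF assms(1)[unfolded n_definable_def] assms(2,3), of "(k, [0..<n])"] assms(4)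
  by (simp add: atLeast0LessThan)


section \<open>Definability of order types\<close>

lemma otyp_empty_iff: "otyp B S u v ({#} :: 'b::wellorder multiset) \<longleftrightarrow> itv B S u v = {}"
proof -
  have "\<not> w < ({#} :: 'b multiset)" for w
    by (metis le_multiset_empty_left less_asym less_irrefl)
  then have *: "{..<{#} :: 'b multiset} = {}" by blast
  show ?thesis
    unfolding otyp_def isomorphic_def * by (auto simp: bij_betw_def)
qed

lemma otyp_nonempty:
  assumes "otyp B S u v (w :: 'b::wellorder multiset)" "w \<noteq> {#}" "lin B S" "u \<in> B" "v \<in> B"
  shows "slt S u v"
proof -
  have "itv B S u v \<noteq> {}"
    using assms(1,2) otyp_unique otyp_empty_iff by metis
  then obtain z where "z \<in> B" "(u, z) \<in> S" "slt S z v"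
    by (auto simp: itv_def)
  then show ?thesis using linD(2,4)[OF assms(3)] assms(4,5) by metis
qed

text \<open>An interval of type \<omega>^b1 + ... + \<omega>^bk is cut at the partial sums. Since
  the exponents are listed in decreasing order, no summand is absorbed and the sum is the multiset
  itself.\<close>

lemma otyp_mset_iff_chain:
  fixes bs :: "'b::wellorder list"
  assumes "lin B S" "v \<in> B"
  shows "sorted_wrt (\<ge>) bs \<Longrightarrow> u \<in> B \<Longrightarrow> (u, v) \<in> S \<and> otyp B S u v (mset bs) \<longleftrightarrow>
    (\<exists>w. w 0 = u \<and> w (length bs) = v \<and> (\<forall>i\<le>length bs. w i \<in> B) \<and>
      (\<forall>i<length bs. otyp B S (w i) (w (Suc i)) {#bs ! i#}))"
proof (induction bs arbitrary: u)
  case Nil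
  have "(u, v) \<in> S \<and> itv B S u v = {} \<longleftrightarrow> u = v"
    using linD[OF assms(1) Nil(2) assms(2)] Nil(2) linD(2)[OF assms] unfolding itv_def by blast
  moreover have "u = v \<longleftrightarrow> (\<exists>w. w 0 = u \<and> w 0 = v \<and> w 0 \<in> B)"
    using assms(2) by (auto intro: exI[of _ "\<lambda>_. v"])
  ultimately show ?case by (simp add: otyp_empty_iff)
next
  case (Cons b bs)
  have ms: "mset (b # bs) = {#b#} \<oplus> mset bs"
    using Cons.prems(1) by (subst singleton_osum) auto
  have so: "sorted_wrt (\<ge>) bs" using Cons.prems(1) by simp
  show ?case
  proof
    assume L: "(u, v) \<in> S \<and> otyp B S u v (mset (b # bs))"
    obtain y where y: "y \<in> B" "(u, y) \<in> S" "(y, v) \<in> S" "otyp B S u y {#b#}" "otyp B S y v (mset bs)"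
      by (rule otyp_osum_split[OF assms(1) Cons.prems(2) assms(2), of "{#b#}" "mset bs"])
        (use L ms that in auto)
    obtain w where w: "w 0 = y" "w (length bs) = v" "\<forall>i\<le>length bs. w i \<in> B"
      "\<forall>i<length bs. otyp B S (w i) (w (Suc i)) {#bs ! i#}"
      using Cons.IH[OF so y(1)] y(3,5) by blast
    let ?w = "case_nat u w"
    have "?w 0 = u \<and> ?w (length (b # bs)) = v \<and> (\<forall>i\<le>length (b # bs). ?w i \<in> B) \<and>
      (\<forall>i<length (b # bs). otyp B S (?w i) (?w (Suc i)) {#(b # bs) ! i#})"
      using w y Cons.prems(2) by (auto split: nat.split simp: nth_Cons)
    then show "\<exists>w. w 0 = u \<and> w (length (b # bs)) = v \<and> (\<forall>i\<le>length (b # bs). w i \<in> B) \<and>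
      (\<forall>i<length (b # bs). otyp B S (w i) (w (Suc i)) {#(b # bs) ! i#})" by blast
  next
    assume "\<exists>w. w 0 = u \<and> w (length (b # bs)) = v \<and> (\<forall>i\<le>length (b # bs). w i \<in> B) \<and>
      (\<forall>i<length (b # bs). otyp B S (w i) (w (Suc i)) {#(b # bs) ! i#})"
    then obtain w where w: "w 0 = u" "w (length (b # bs)) = v" "\<forall>i\<le>length (b # bs). w i \<in> B"
      "\<forall>i<length (b # bs). otyp B S (w i) (w (Suc i)) {#(b # bs) ! i#}" by blast
    have y: "w 1 \<in> B" "otyp B S u (w 1) {#b#}" using w by auto
    have uy: "(u, w 1) \<in> S"
      using otyp_nonempty[OF y(2) _ assms(1) Cons.prems(2) y(1)] by simp
    have "\<forall>i\<le>length bs. (w \<circ> Suc) i \<in> B"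
      "\<forall>i<length bs. otyp B S ((w \<circ> Suc) i) ((w \<circ> Suc) (Suc i)) {#bs ! i#}"
      using w(3,4) by (auto simp: Suc_le_eq)
    moreover have "(w \<circ> Suc) 0 = w 1" "(w \<circ> Suc) (length bs) = v" using w(2) by auto
    ultimately have "(w 1, v) \<in> S \<and> otyp B S (w 1) v (mset bs)"
      using Cons.IH[OF so y(1)] by blast
    then show "(u, v) \<in> S \<and> otyp B S u v (mset (b # bs))"
      using otyp_osum[OF assms(1) Cons.prems(2) y(1) assms(2) uy _ y(2)] ms
        linD(4)[OF assms(1) Cons.prems(2) y(1) assms(2) uy] by auto
  qed
qed

lemma countable_less_singleton_mset: "countable {w. w < {#\<alpha> :: omega1#}}"
proof (rule countable_subset)
  show "{w. w < {#\<alpha>#}} \<subseteq> mset ` lists {..<\<alpha>}"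
  proof
    fix w assume "w \<in> {w. w < {#\<alpha>#}}"
    then have "\<forall>b\<in>#w. b < \<alpha>" by (simp add: mset_lt_single_right_iff)
    moreover obtain xs where "w = mset xs" by (metis ex_mset)
    ultimately show "w \<in> mset ` lists {..<\<alpha>}" by auto
  qed
  show "countable (mset ` lists {..<\<alpha>})"
    by (intro countable_image countable_lists countable_below)
qed

text \<open>The number of cut points varies with \<open>w\<close>, but they are quantified in one
  block, so the number of additional levels is the same for all \<open>w\<close>.\<close>

lemma n_definable_otyp_below:
  assumes "n_definable \<alpha> {..<\<alpha>} 2 (\<lambda>\<gamma> B S (xs :: 'a list). otyp B S (xs ! 0) (xs ! 1) {#\<gamma>#})"
  shows "n_definable \<alpha> {w. w < {#\<alpha>#}} 2
    (\<lambda>w B S (xs :: 'a list). (xs ! 0, xs ! 1) \<in> S \<and> otyp B S (xs ! 0) (xs ! 1) w)"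
proof -
  obtain n where n: "\<And>m k. n \<le> m \<Longrightarrow> k \<in> {..<\<alpha>} \<times> {xs. length xs = 2} \<Longrightarrow>
      Pi_definable ((succ_ord ^^ m) \<alpha>) (set (snd k))
        (\<lambda>B S (e :: nat \<Rightarrow> 'a). otyp B S (map e (snd k) ! 0) (map e (snd k) ! 1) {#fst k#})"
    by (rule fam_definableE[OF assms[unfolded n_definable_def]]) (rule that)
  \<comment> \<open>\<open>Suc n\<close> makes the level positive, as conjunctions require.\<close>
  have n: "Pi_definable ((succ_ord ^^ Suc n) \<alpha>) {x, y} (\<lambda>B S (e :: nat \<Rightarrow> 'a). otyp B S (e x) (e y) {#\<gamma>#})"
    if "\<gamma> < \<alpha>" for \<gamma> x y
    using n[of "Suc n" "(\<gamma>, [x, y])"] that by simp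
  define bs where "bs w = rev (sorted_list_of_multiset w)" for w :: "omega1 multiset"
  have bs: "mset (bs w) = w" "sorted_wrt (\<ge>) (bs w)" for w
    by (auto simp: bs_def sorted_wrt_rev)
  have bsa: "bs w ! i < \<alpha>" if "w < {#\<alpha>#}" "i < length (bs w)" for w i
    using that bs(1)[of w] nth_mem[of i "bs w"] unfolding mset_lt_single_right_iff by (metis set_mset_mset)
  show ?thesis
    unfolding n_definable_def
  proof (rule fam_definableI[of _ "Suc (Suc (Suc n))"])
    fix k :: "omega1 multiset \<times> nat list"
    assume k: "k \<in> {w. w < {#\<alpha>#}} \<times> {xs. length xs = 2}"
    obtain w x y where kw: "k = (w, [x, y])" "w < {#\<alpha>#}"
      using k by (cases k) (auto simp: length_Suc_conv numeral_2_eq_2)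
    define m where "m = Suc (max x y)"
    define L where "L = length (bs w)"
    \<comment> \<open>These are \<open>L + 1\<close> fresh variables for the cut points; the first
      and the last are equated with \<open>x\<close> and \<open>y\<close> in
      \<open>?P\<close>.\<close>
    define zs where "zs = [m..<Suc (m + L)]"
    have zs: "set zs = {m..m + L}" "x \<notin> set zs" "y \<notin> set zs"
      by (auto simp: zs_def m_def)
    let ?P = "\<lambda>B S (e :: nat \<Rightarrow> 'a). (\<forall>i\<in>{..<L}. otyp B S (e (m + i)) (e (Suc (m + i))) {#bs w ! i#}) \<and>
      sat B S (And (Eq m x) (Eq (m + L) y)) e"
    have 1: "Pi_definable ((succ_ord ^^ Suc n) \<alpha>) ({x, y} \<union> set zs) ?P"
    proof (intro Pi_definable_conj Pi_definable_ball Pi_definable_qf funpow_Suc_pos)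
      fix i assume i: "i \<in> {..<L}"
      show "Pi_definable ((succ_ord ^^ Suc n) \<alpha>) ({x, y} \<union> set zs)
         (\<lambda>B S (e :: nat \<Rightarrow> 'a). otyp B S (e (m + i)) (e (Suc (m + i))) {#bs w ! i#})"
        by (rule Pi_definable_mono[OF n]) (use i bsa[OF kw(2)] zs(1) in \<open>auto simp: L_def\<close>)
    qed (auto simp: zs(1))
    have "Pi_definable ((succ_ord ^^ Suc (Suc (Suc n))) \<alpha>) {x, y}
       (\<lambda>B S e. \<exists>e'. (\<forall>v. v \<notin> set zs \<longrightarrow> e' v = e v) \<and> (\<forall>v\<in>set zs. e' v \<in> B) \<and> ?P B S e')"
      by (rule Pi_definable_not, rule Pi_definable_block[OF 1, of "(succ_ord ^^ Suc (Suc n)) \<alpha>"]) auto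
    then have "Pi_definable ((succ_ord ^^ Suc (Suc (Suc n))) \<alpha>) {x, y}
       (\<lambda>B S (e :: nat \<Rightarrow> 'a). (e x, e y) \<in> S \<and> otyp B S (e x) (e y) w)"
    proof (rule Pi_definable_cong)
      fix B S and e :: "nat \<Rightarrow> 'a" assume B: "lin B S" "range e \<subseteq> B"
      then have ex: "e x \<in> B" "e y \<in> B" by auto
      have "(e x, e y) \<in> S \<and> otyp B S (e x) (e y) w \<longleftrightarrow>
        (\<exists>c. c 0 = e x \<and> c L = e y \<and> (\<forall>i\<le>L. c i \<in> B) \<and> (\<forall>i<L. otyp B S (c i) (c (Suc i)) {#bs w ! i#}))"
        using otyp_mset_iff_chain[OF B(1) ex(2) bs(2)[of w] ex(1)] unfolding bs(1) L_def .
      also have "\<dots> \<longleftrightarrow> (\<exists>e'. (\<forall>v. v \<notin> set zs \<longrightarrow> e' v = e v) \<and> (\<forall>v\<in>set zs. e' v \<in> B) \<and> ?P B S e')"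
        (is "?C \<longleftrightarrow> ?E")
      proof
        assume ?C
        then obtain c where c: "c 0 = e x" "c L = e y" "\<forall>i\<le>L. c i \<in> B"
          "\<forall>i<L. otyp B S (c i) (c (Suc i)) {#bs w ! i#}" by blast
        let ?e = "\<lambda>v. if v \<in> set zs then c (v - m) else e v"
        have e: "?e (m + i) = c i" if "i \<le> L" for i using that zs(1) by simp
        have "otyp B S (?e (m + i)) (?e (Suc (m + i))) {#bs w ! i#}" if "i < L" for i
          using c(4) e[of i] e[of "Suc i"] that unfolding add_Suc_right by (simp only: Suc_leI less_imp_le)
        moreover have "?e m = ?e x" "?e (m + L) = ?e y"
          using e[of 0] e[of L] c(1,2) zs(2,3) by auto
        moreover have "\<forall>v\<in>set zs. ?e v \<in> B" using c(3) zs(1) by auto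
        ultimately show ?E by (intro exI[of _ ?e]) auto
      next
        assume ?E
        then obtain e' where e': "\<forall>v. v \<notin> set zs \<longrightarrow> e' v = e v" "\<forall>v\<in>set zs. e' v \<in> B" "?P B S e'"
          by blast
        have "e' x = e x" "e' y = e y" using e'(1) zs by auto
        then show ?C
          using e'(2,3) zs(1) by (intro exI[of _ "\<lambda>i. e' (m + i)"]) auto
      qed
      finally show "(\<exists>e'. (\<forall>v. v \<notin> set zs \<longrightarrow> e' v = e v) \<and> (\<forall>v\<in>set zs. e' v \<in> B) \<and> ?P B S e') \<longleftrightarrow>
         (e x, e y) \<in> S \<and> otyp B S (e x) (e y) w" by (rule sym)
    qed
    then show "Pi_definable ((succ_ord ^^ Suc (Suc (Suc n))) \<alpha>) (set (snd k))
       (\<lambda>B S (e :: nat \<Rightarrow> 'a). (map e (snd k) ! 0, map e (snd k) ! 1) \<in> S \<and>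
          otyp B S (map e (snd k) ! 0) (map e (snd k) ! 1) (fst k))"
      by (simp add: kw(1))
  qed
qed

text \<open>The recursion behind the definability of order types: the types of proper initial
  intervals are exactly the smaller ordinals. Each type is conjoined with
  \<open>(x, v) \<in> S\<close>, the form in which \<open>n_definable_otyp_below\<close> provides
  it.\<close>

lemma otyp_iff_initial:
  assumes "lin B S" "x \<in> B" "y \<in> B"
  shows "otyp B S x y w0 \<longleftrightarrow>
    (\<forall>v\<in>B. (x, v) \<in> S \<and> slt S v y \<longrightarrow> (\<exists>w\<in>{w. w < w0}. (x, v) \<in> S \<and> otyp B S x v w)) \<and>
    (\<forall>w\<in>{w. w < w0}. \<exists>v\<in>B. slt S v y \<and> ((x, v) \<in> S \<and> otyp B S x v w))" (is "_ \<longleftrightarrow> ?R")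
proof
  assume o: "otyp B S x y w0"
  have "\<exists>w\<in>{w. w < w0}. (x, v) \<in> S \<and> otyp B S x v w" if "v \<in> B" "(x, v) \<in> S" "slt S v y" for v
    using otyp_initial(1)[OF assms o, of v] that by (auto simp: itv_def)
  moreover have "\<exists>v\<in>B. slt S v y \<and> ((x, v) \<in> S \<and> otyp B S x v w)" if "w < w0" for w
    using otyp_initial(2)[OF assms o that] by (auto simp: itv_def)
  ultimately show ?R by blast
next
  assume R: ?R
  show "otyp B S x y w0"
  proof (rule otypI[OF assms])
    show "\<exists>w'<w0. otyp B S x v w'" if "v \<in> itv B S x y" for v
      using R that by (auto simp: itv_def)
    show "\<exists>v\<in>itv B S x y. otyp B S x v w'" if "w' < w0" for w'
      using R that by (auto simp: itv_def)
  qed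
qed

lemma n_definable_otyp_step:
  assumes "n_definable \<alpha> {..<\<alpha>} 2 (\<lambda>\<gamma> B S (xs :: 'a list). otyp B S (xs ! 0) (xs ! 1) {#\<gamma>#})"
  shows "n_definable \<alpha> {\<alpha>} 2 (\<lambda>\<gamma> B S (xs :: 'a list). otyp B S (xs ! 0) (xs ! 1) {#\<gamma>#})"
proof -
  let ?W = "{w. w < {#\<alpha>#}}"
  let ?J = "\<lambda>_ :: omega1. ?W"
  let ?o = "\<lambda>w B S x (v :: 'a). (x, v) \<in> S \<and> otyp B S x v w"
  have o: "n_definable \<alpha> (Sigma {\<alpha>} ?J) n (\<lambda>k B S xs. ?o (snd k) B S (xs ! i) (xs ! j))"
    if "i < n" "j < n" for n i j
    by (rule n_definable_reindex[where h = snd],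
        rule n_definable_at2[OF n_definable_otyp_below[OF assms] that]) auto
  have o3: "n_definable \<alpha> (Sigma {\<alpha>} ?J) 3 (\<lambda>k B S xs. ?o (snd k) B S (xs ! 1) (xs ! 0))"
    by (rule o) auto
  have cW: "countable ?W" by (rule countable_less_singleton_mset)
  have "n_definable \<alpha> {\<alpha>} 3 (\<lambda>\<gamma> B S xs. \<exists>w\<in>?W. ?o w B S (xs ! 1) (xs ! 0))"
    using n_definable_bex[OF o3 cW] by simp
  then have "n_definable \<alpha> {\<alpha>} 3 (\<lambda>\<gamma> B S xs. ((xs ! 1, xs ! 0) \<in> S \<and> slt S (xs ! 0) (xs ! 2)) \<longrightarrow>
      (\<exists>w\<in>?W. ?o w B S (xs ! 1) (xs ! 0)))"
    by (intro n_definable_imp n_definable_conj n_definable_le n_definable_slt) auto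
  from n_definable_all[OF this, of 2]
  have A: "n_definable \<alpha> {\<alpha>} 2 (\<lambda>\<gamma> B S xs. \<forall>v\<in>B. ((xs ! 0, v) \<in> S \<and> slt S v (xs ! 1)) \<longrightarrow>
      (\<exists>w\<in>?W. ?o w B S (xs ! 0) v))"
    by simp
  have "n_definable \<alpha> (Sigma {\<alpha>} ?J) 3 (\<lambda>k B S xs. slt S (xs ! 0) (xs ! 2) \<and> ?o (snd k) B S (xs ! 1) (xs ! 0))"
    by (intro n_definable_conj[OF n_definable_slt o3]) auto
  from n_definable_ex[OF this, of 2]
  have "n_definable \<alpha> (Sigma {\<alpha>} ?J) 2 (\<lambda>k B S xs. \<exists>v\<in>B. slt S v (xs ! 1) \<and> ?o (snd k) B S (xs ! 0) v)"
    by simp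
  from n_definable_ball[OF this cW]
  have B: "n_definable \<alpha> {\<alpha>} 2 (\<lambda>\<gamma> B S xs. \<forall>w\<in>?W. \<exists>v\<in>B. slt S v (xs ! 1) \<and> ?o w B S (xs ! 0) v)"
    by simp
  from n_definable_conj[OF A B] show ?thesis
  proof (rule n_definable_cong)
    fix \<gamma> B S and xs :: "'a list"
    assume g: "\<gamma> \<in> {\<alpha>}" "lin B S" "set xs \<subseteq> B" "length xs = 2"
    then have "xs ! 0 \<in> B" "xs ! 1 \<in> B" by auto
    note * = otyp_iff_initial[OF g(2) this, of "{#\<alpha>#}"]
    show "((\<forall>v\<in>B. ((xs ! 0, v) \<in> S \<and> slt S v (xs ! 1)) \<longrightarrow> (\<exists>w\<in>?W. ?o w B S (xs ! 0) v)) \<and>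
       (\<forall>w\<in>?W. \<exists>v\<in>B. slt S v (xs ! 1) \<and> ?o w B S (xs ! 0) v)) \<longleftrightarrow> otyp B S (xs ! 0) (xs ! 1) {#\<gamma>#}"
      using *[symmetric] g(1) by simp
  qed
qed

lemma n_definable_Un:
  "n_definable \<alpha> K n P \<Longrightarrow> n_definable \<alpha> K' n P \<Longrightarrow> n_definable \<alpha> (K \<union> K') n P"
  unfolding n_definable_def Sigma_Un_distrib1 by (rule fam_definable_Un)

text \<open>Each step adds finitely many levels to the base. At a limit \<alpha> the bounds for the
  smaller exponents need not share a finite excess, but all of them lie below \<alpha>, so \<alpha>
  itself is a common bound.\<close>

lemma n_definable_otyp:
  "n_definable \<alpha> {..\<alpha>} 2 (\<lambda>\<gamma> B S (xs :: 'a list). otyp B S (xs ! 0) (xs ! 1) {#\<gamma>#})" (is "n_definable _ _ _ ?P")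
proof (induction \<alpha> rule: less_induct)
  case (less \<alpha>)
  have below: "n_definable \<alpha> {..<\<alpha>} 2 ?P"
  proof (cases "limit_ord \<alpha>")
    case True
    have *: "\<exists>\<beta><\<alpha>. Pi_definable \<beta> (set (snd k)) (\<lambda>B S (e :: nat \<Rightarrow> 'a). ?P (fst k) B S (map e (snd k)))"
      if "k \<in> {..<\<alpha>} \<times> {xs. length xs = 2}" for k
      by (rule fam_definable_below[OF less[of "fst k", unfolded n_definable_def] True]) (use that in auto)
    have "Pi_definable ((succ_ord ^^ 0) \<alpha>) (set (snd k)) (\<lambda>B S (e :: nat \<Rightarrow> 'a). ?P (fst k) B S (map e (snd k)))"
      if "k \<in> {..<\<alpha>} \<times> {xs. length xs = 2}" for k
    proof -
      from *[OF that] obtain \<beta> where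
        b: "\<beta> < \<alpha>" and P: "Pi_definable \<beta> (set (snd k)) (\<lambda>B S (e :: nat \<Rightarrow> 'a). ?P (fst k) B S (map e (snd k)))" by blast
      show ?thesis using Pi_definable_mono[OF P less_imp_le[OF b] subset_refl] by simp
    qed
    then show ?thesis unfolding n_definable_def by (rule fam_definableI)
  next
    case False
    show ?thesis
    proof (cases "\<alpha> = 0")
      case True
      then have "{..<\<alpha>} = {}" using leD[OF omega1_zero_le] by auto
      then show ?thesis unfolding n_definable_def fam_definable_def by blast
    next
      case F: False
      then obtain \<beta> where b: "\<alpha> = succ_ord \<beta>"
        using False by (auto simp: limit_ord_def)
      then have "{..<\<alpha>} = {..\<beta>}" by (auto simp: less_succ_ord_iff)
      then show ?thesis
        using n_definable_mono[OF less[of \<beta>], of \<alpha>] b less_imp_le[OF less_succ_ord[of \<beta>]] by simp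
    qed
  qed
  have "{..\<alpha>} = {..<\<alpha>} \<union> {\<alpha>}" by auto
  then show ?case
    using n_definable_Un[OF below n_definable_otyp_step[OF below]] by simp
qed


section \<open>Blocks\<close>

text \<open>In a densely ordered sum of blocks \<open>\<omega>\<^bsup>\<gamma>\<^esup> + 1\<close>, the last elements of the blocks are exactly the
  elements without immediate successor.\<close>

definition no_succ :: "'a set \<Rightarrow> 'a rel \<Rightarrow> 'a \<Rightarrow> bool" where
  "no_succ B S x \<longleftrightarrow> \<not> (\<exists>y\<in>B. slt S x y \<and> \<not> (\<exists>z\<in>B. slt S x z \<and> slt S z y))"

text \<open>A first element is separated from everything smaller by the end of an earlier block; an
  inner element is not separated from the first element of its own block.\<close>

definition blk_start :: "'a set \<Rightarrow> 'a rel \<Rightarrow> 'a \<Rightarrow> bool" where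
  "blk_start B S s \<longleftrightarrow> (\<forall>z\<in>B. slt S z s \<longrightarrow> (\<exists>n\<in>B. no_succ B S n \<and> (z, n) \<in> S \<and> slt S n s))"

definition block :: "omega1 \<Rightarrow> 'a set \<Rightarrow> 'a rel \<Rightarrow> 'a \<Rightarrow> 'a \<Rightarrow> bool" where
  "block \<gamma> B S s e \<longleftrightarrow> blk_start B S s \<and> no_succ B S e \<and>
     (\<forall>n\<in>B. (s, n) \<in> S \<and> slt S n e \<longrightarrow> \<not> no_succ B S n) \<and> otyp B S s e {#\<gamma>#}"

definition blk_type :: "omega1 \<Rightarrow> 'a set \<Rightarrow> 'a rel \<Rightarrow> 'a \<Rightarrow> bool" where
  "blk_type \<gamma> B S s \<longleftrightarrow> (\<exists>e\<in>B. block \<gamma> B S s e)"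

definition in_block :: "omega1 \<Rightarrow> 'a set \<Rightarrow> 'a rel \<Rightarrow> 'a \<Rightarrow> bool" where
  "in_block \<gamma> B S x \<longleftrightarrow> (\<exists>s\<in>B. \<exists>e\<in>B. block \<gamma> B S s e \<and> (s, x) \<in> S \<and> (x, e) \<in> S)"

text \<open>Requiring that \<beta> be attained from \<open>s\<close> on, and not merely be a bound,
  makes \<beta> unique, so that it can name the summand.\<close>

definition in_part :: "omega1 \<Rightarrow> 'a set \<Rightarrow> 'a rel \<Rightarrow> 'a \<Rightarrow> 'a \<Rightarrow> bool" where
  "in_part \<beta> B S p s \<longleftrightarrow> slt S p s \<and> blk_start B S s \<and> (\<exists>t\<in>B. (s, t) \<in> S \<and> blk_type \<beta> B S t) \<and>
     (\<forall>t\<in>B. (s, t) \<in> S \<and> blk_start B S t \<longrightarrow> (\<exists>\<gamma>\<in>{..\<beta>}. blk_type \<gamma> B S t))"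

text \<open>Blocks above a given one are covered by the second clause with \<open>t = p\<close>: the
  first element \<open>p\<close> bounds the dense part on the right without belonging to it.\<close>

definition left_dense :: "omega1 \<Rightarrow> 'a set \<Rightarrow> 'a rel \<Rightarrow> 'a \<Rightarrow> bool" where
  "left_dense \<gamma> B S p \<longleftrightarrow> (\<forall>x\<in>B. (x, p) \<in> S \<longrightarrow> (\<exists>u\<in>B. blk_type \<gamma> B S u \<and> slt S u x)) \<and>
     (\<forall>s\<in>B. \<forall>t\<in>B. blk_start B S s \<and> slt S s t \<and> blk_start B S t \<and> (t, p) \<in> S \<longrightarrow>
        (\<exists>u\<in>B. blk_type \<gamma> B S u \<and> slt S s u \<and> slt S u t))"

definition part_dense :: "omega1 \<Rightarrow> omega1 \<Rightarrow> 'a set \<Rightarrow> 'a rel \<Rightarrow> 'a \<Rightarrow> bool" where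
  "part_dense \<beta> \<gamma> B S p \<longleftrightarrow> (\<exists>s\<in>B. in_part \<beta> B S p s) \<and>
     (\<forall>s\<in>B. in_part \<beta> B S p s \<longrightarrow> (\<exists>u\<in>B. blk_type \<gamma> B S u \<and> in_part \<beta> B S p u \<and> slt S u s) \<and>
        (\<exists>u\<in>B. blk_type \<gamma> B S u \<and> in_part \<beta> B S p u \<and> slt S s u)) \<and>
     (\<forall>s\<in>B. \<forall>t\<in>B. in_part \<beta> B S p s \<and> slt S s t \<and> in_part \<beta> B S p t \<longrightarrow>
        (\<exists>u\<in>B. blk_type \<gamma> B S u \<and> slt S s u \<and> slt S u t))"

text \<open>In the third clause the choice of \<beta> stands outside the implication, so that the
  clause has the universal-over-countable-disjunction shape of
  \<open>Pi_definable_all_bex\<close>.\<close>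

definition canonical :: "omega1 \<Rightarrow> 'a set \<Rightarrow> 'a rel \<Rightarrow> 'a \<Rightarrow> bool" where
  "canonical l B S p \<longleftrightarrow> blk_type 0 B S p \<and> (\<forall>x\<in>B. \<exists>\<gamma>\<in>{..<l}. in_block \<gamma> B S x) \<and>
     (\<forall>s\<in>B. \<exists>\<beta>\<in>{..<l}. slt S p s \<and> blk_start B S s \<longrightarrow> in_part \<beta> B S p s) \<and>
     (\<forall>\<gamma>\<in>{..<l}. left_dense \<gamma> B S p) \<and> (\<forall>\<beta>\<in>{..<l}. \<forall>\<gamma>\<in>{..\<beta>}. part_dense \<beta> \<gamma> B S p)"

section \<open>Levels of the predicates on blocks\<close>

lemma n_definable_no_succ: "n_definable \<alpha> K 1 (\<lambda>k B S xs. no_succ B S (xs ! 0))"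
proof -
  have "n_definable \<alpha> K 3 (\<lambda>k B S xs. slt S (xs ! 2) (xs ! 0) \<and> slt S (xs ! 0) (xs ! 1))"
    by (intro n_definable_conj n_definable_slt) auto
  from n_definable_ex[OF this, of 2]
  have "n_definable \<alpha> K 2 (\<lambda>k B S xs. \<exists>z\<in>B. slt S (xs ! 1) z \<and> slt S z (xs ! 0))" by simp
  then have "n_definable \<alpha> K 2 (\<lambda>k B S xs. slt S (xs ! 1) (xs ! 0) \<and>
      \<not> (\<exists>z\<in>B. slt S (xs ! 1) z \<and> slt S z (xs ! 0)))"
    by (intro n_definable_conj n_definable_slt n_definable_not) auto
  from n_definable_not[OF n_definable_ex[OF this, of 1]]
  show ?thesis by (simp add: no_succ_def)
qed

lemma n_definable_blk_start: "n_definable \<alpha> K 1 (\<lambda>k B S xs. blk_start B S (xs ! 0))"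
proof -
  have "n_definable \<alpha> K 3 (\<lambda>k B S xs. no_succ B S (xs ! 0) \<and> (xs ! 1, xs ! 0) \<in> S \<and> slt S (xs ! 0) (xs ! 2))"
    by (intro n_definable_conj n_definable_slt n_definable_le n_definable_at1[OF n_definable_no_succ]) auto
  from n_definable_ex[OF this, of 2]
  have "n_definable \<alpha> K 2 (\<lambda>k B S xs. \<exists>n\<in>B. no_succ B S n \<and> (xs ! 0, n) \<in> S \<and> slt S n (xs ! 1))" by simp
  then have "n_definable \<alpha> K 2 (\<lambda>k B S xs. slt S (xs ! 0) (xs ! 1) \<longrightarrow>
      (\<exists>n\<in>B. no_succ B S n \<and> (xs ! 0, n) \<in> S \<and> slt S n (xs ! 1)))"
    by (intro n_definable_imp n_definable_slt) auto
  from n_definable_all[OF this, of 1]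
  show ?thesis by (simp add: blk_start_def)
qed

lemma n_definable_block:
  "n_definable \<alpha> {..\<alpha>} 2 (\<lambda>\<gamma> B S (xs :: 'a list). block \<gamma> B S (xs ! 0) (xs ! 1))"
proof -
  have "n_definable \<alpha> {..\<alpha>} 3 (\<lambda>\<gamma> B S (xs :: 'a list). (xs ! 1, xs ! 0) \<in> S \<and> slt S (xs ! 0) (xs ! 2) \<longrightarrow>
      \<not> no_succ B S (xs ! 0))"
    by (intro n_definable_conj n_definable_imp n_definable_not n_definable_slt n_definable_le
        n_definable_at1[OF n_definable_no_succ]) auto
  from n_definable_all[OF this, of 2]
  have 1: "n_definable \<alpha> {..\<alpha>} 2 (\<lambda>\<gamma> B S (xs :: 'a list). \<forall>n\<in>B. (xs ! 0, n) \<in> S \<and> slt S n (xs ! 1) \<longrightarrow>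
      \<not> no_succ B S n)" by simp
  show ?thesis
    unfolding block_def
    by (intro n_definable_conj 1 n_definable_otyp n_definable_at1[OF n_definable_no_succ]
        n_definable_at1[OF n_definable_blk_start]) auto
qed

lemma n_definable_blk_type:
  "n_definable \<alpha> {..\<alpha>} 1 (\<lambda>\<gamma> B S (xs :: 'a list). blk_type \<gamma> B S (xs ! 0))"
proof -
  have "n_definable \<alpha> {..\<alpha>} 2 (\<lambda>\<gamma> B S (xs :: 'a list). block \<gamma> B S (xs ! 1) (xs ! 0))"
    by (rule n_definable_at2[OF n_definable_block]) auto
  from n_definable_ex[OF this, of 1] show ?thesis by (simp add: blk_type_def)
qed

lemma n_definable_in_block:
  "n_definable \<alpha> {..\<alpha>} 1 (\<lambda>\<gamma> B S (xs :: 'a list). in_block \<gamma> B S (xs ! 0))"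
proof -
  have "n_definable \<alpha> {..\<alpha>} 3 (\<lambda>\<gamma> B S (xs :: 'a list). block \<gamma> B S (xs ! 1) (xs ! 0) \<and>
      (xs ! 1, xs ! 2) \<in> S \<and> (xs ! 2, xs ! 0) \<in> S)"
    by (intro n_definable_conj n_definable_le n_definable_at2[OF n_definable_block]) auto
  from n_definable_ex[OF this, of 2]
  have "n_definable \<alpha> {..\<alpha>} 2 (\<lambda>\<gamma> B S (xs :: 'a list). \<exists>e\<in>B. block \<gamma> B S (xs ! 0) e \<and>
      (xs ! 0, xs ! 1) \<in> S \<and> (xs ! 1, e) \<in> S)" by simp
  from n_definable_ex[OF this, of 1] show ?thesis by (simp add: in_block_def)
qed

lemma n_definable_in_part:
  "n_definable \<beta> {\<beta>} 2 (\<lambda>\<beta> B S (xs :: 'a list). in_part \<beta> B S (xs ! 0) (xs ! 1))"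
proof -
  note st = n_definable_at1[OF n_definable_blk_start]
  have T: "n_definable \<beta> {\<beta>} 1 (\<lambda>\<beta> B S (xs :: 'a list). blk_type \<beta> B S (xs ! 0))"
    by (rule n_definable_subset[OF n_definable_blk_type]) auto
  have "n_definable \<beta> {\<beta>} 3 (\<lambda>\<beta> B S (xs :: 'a list). (xs ! 2, xs ! 0) \<in> S \<and> blk_type \<beta> B S (xs ! 0))"
    by (intro n_definable_conj n_definable_le n_definable_at1[OF T]) auto
  from n_definable_ex[OF this, of 2]
  have 1: "n_definable \<beta> {\<beta>} 2 (\<lambda>\<beta> B S (xs :: 'a list). \<exists>t\<in>B. (xs ! 1, t) \<in> S \<and> blk_type \<beta> B S t)" by simp
  have "n_definable \<beta> (Sigma {\<beta>} (\<lambda>\<beta>. {..\<beta>})) 1 (\<lambda>k B S (xs :: 'a list). blk_type (snd k) B S (xs ! 0))"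
    by (rule n_definable_reindex[OF n_definable_blk_type, where h = snd]) auto
  from n_definable_bex[OF this]
  have T': "n_definable \<beta> {\<beta>} 1 (\<lambda>\<beta> B S (xs :: 'a list). \<exists>\<gamma>\<in>{..\<beta>}. blk_type \<gamma> B S (xs ! 0))"
    using countable_below[of "succ_ord \<beta>"] by (simp add: less_succ_ord_iff lessThan_def atMost_def)
  have "n_definable \<beta> {\<beta>} 3 (\<lambda>\<beta> B S (xs :: 'a list). (xs ! 2, xs ! 0) \<in> S \<and> blk_start B S (xs ! 0) \<longrightarrow>
      (\<exists>\<gamma>\<in>{..\<beta>}. blk_type \<gamma> B S (xs ! 0)))"
    by (intro n_definable_imp n_definable_conj n_definable_le st n_definable_at1[OF T']) auto
  from n_definable_all[OF this, of 2]
  have 2: "n_definable \<beta> {\<beta>} 2 (\<lambda>\<beta> B S (xs :: 'a list). \<forall>t\<in>B. (xs ! 1, t) \<in> S \<and> blk_start B S t \<longrightarrow>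
      (\<exists>\<gamma>\<in>{..\<beta>}. blk_type \<gamma> B S t))" by simp
  show ?thesis
    unfolding in_part_def by (intro n_definable_conj n_definable_slt st 1 2) auto
qed

lemma n_definable_left_dense:
  "n_definable \<alpha> {..\<alpha>} 1 (\<lambda>\<gamma> B S (xs :: 'a list). left_dense \<gamma> B S (xs ! 0))"
proof -
  note st = n_definable_at1[OF n_definable_blk_start]
  have "n_definable \<alpha> {..\<alpha>} 3 (\<lambda>\<gamma> B S (xs :: 'a list). blk_type \<gamma> B S (xs ! 0) \<and> slt S (xs ! 0) (xs ! 1))"
    by (intro n_definable_conj n_definable_slt n_definable_at1[OF n_definable_blk_type]) auto
  from n_definable_ex[OF this, of 2]
  have "n_definable \<alpha> {..\<alpha>} 2 (\<lambda>\<gamma> B S (xs :: 'a list). \<exists>u\<in>B. blk_type \<gamma> B S u \<and> slt S u (xs ! 0))" by simp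
  then have "n_definable \<alpha> {..\<alpha>} 2 (\<lambda>\<gamma> B S (xs :: 'a list). (xs ! 0, xs ! 1) \<in> S \<longrightarrow>
      (\<exists>u\<in>B. blk_type \<gamma> B S u \<and> slt S u (xs ! 0)))"
    by (intro n_definable_imp n_definable_le) auto
  from n_definable_all[OF this, of 1]
  have 1: "n_definable \<alpha> {..\<alpha>} 1 (\<lambda>\<gamma> B S (xs :: 'a list). \<forall>x\<in>B. (x, xs ! 0) \<in> S \<longrightarrow>
      (\<exists>u\<in>B. blk_type \<gamma> B S u \<and> slt S u x))" by simp
  have "n_definable \<alpha> {..\<alpha>} 4 (\<lambda>\<gamma> B S (xs :: 'a list). blk_type \<gamma> B S (xs ! 0) \<and>
      slt S (xs ! 2) (xs ! 0) \<and> slt S (xs ! 0) (xs ! 1))"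
    by (intro n_definable_conj n_definable_slt n_definable_at1[OF n_definable_blk_type]) auto
  from n_definable_ex[OF this, of 3]
  have "n_definable \<alpha> {..\<alpha>} 3 (\<lambda>\<gamma> B S (xs :: 'a list). \<exists>u\<in>B. blk_type \<gamma> B S u \<and>
      slt S (xs ! 1) u \<and> slt S u (xs ! 0))" by simp
  then have "n_definable \<alpha> {..\<alpha>} 3 (\<lambda>\<gamma> B S (xs :: 'a list). blk_start B S (xs ! 1) \<and> slt S (xs ! 1) (xs ! 0) \<and>
      blk_start B S (xs ! 0) \<and> (xs ! 0, xs ! 2) \<in> S \<longrightarrow> (\<exists>u\<in>B. blk_type \<gamma> B S u \<and> slt S (xs ! 1) u \<and> slt S u (xs ! 0)))"
    by (intro n_definable_imp n_definable_conj n_definable_le n_definable_slt st) auto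
  from n_definable_all[OF this, of 2]
  have "n_definable \<alpha> {..\<alpha>} 2 (\<lambda>\<gamma> B S (xs :: 'a list). \<forall>t\<in>B. blk_start B S (xs ! 0) \<and> slt S (xs ! 0) t \<and>
      blk_start B S t \<and> (t, xs ! 1) \<in> S \<longrightarrow> (\<exists>u\<in>B. blk_type \<gamma> B S u \<and> slt S (xs ! 0) u \<and> slt S u t))" by simp
  from n_definable_all[OF this, of 1]
  have 2: "n_definable \<alpha> {..\<alpha>} 1 (\<lambda>\<gamma> B S (xs :: 'a list). \<forall>s\<in>B. \<forall>t\<in>B. blk_start B S s \<and> slt S s t \<and>
      blk_start B S t \<and> (t, xs ! 0) \<in> S \<longrightarrow> (\<exists>u\<in>B. blk_type \<gamma> B S u \<and> slt S s u \<and> slt S u t))" by simp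
  show ?thesis
    unfolding left_dense_def by (intro n_definable_conj 1 2)
qed

lemma n_definable_part_dense:
  assumes "\<gamma> \<le> \<beta>"
  shows "n_definable \<beta> {\<beta>} 1 (\<lambda>\<beta> B S (xs :: 'a list). part_dense \<beta> \<gamma> B S (xs ! 0))"
proof -
  have T: "n_definable \<beta> {\<beta>} 1 (\<lambda>_ B S (xs :: 'a list). blk_type \<gamma> B S (xs ! 0))"
    by (rule n_definable_reindex[OF n_definable_blk_type, where h = "\<lambda>_. \<gamma>"]) (use assms in auto)
  note P = n_definable_at2[OF n_definable_in_part] and T = n_definable_at1[OF T]
  have "n_definable \<beta> {\<beta>} 2 (\<lambda>\<beta> B S (xs :: 'a list). in_part \<beta> B S (xs ! 1) (xs ! 0))"
    by (rule P) auto
  from n_definable_ex[OF this, of 1]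
  have 1: "n_definable \<beta> {\<beta>} 1 (\<lambda>\<beta> B S (xs :: 'a list). \<exists>s\<in>B. in_part \<beta> B S (xs ! 0) s)" by simp
  have "n_definable \<beta> {\<beta>} 3 (\<lambda>\<beta> B S (xs :: 'a list). blk_type \<gamma> B S (xs ! 0) \<and> in_part \<beta> B S (xs ! 2) (xs ! 0) \<and>
      slt S (xs ! 0) (xs ! 1))"
    by (intro n_definable_conj n_definable_slt P T) auto
  from n_definable_ex[OF this, of 2]
  have 2: "n_definable \<beta> {\<beta>} 2 (\<lambda>\<beta> B S (xs :: 'a list). \<exists>u\<in>B. blk_type \<gamma> B S u \<and> in_part \<beta> B S (xs ! 1) u \<and>
      slt S u (xs ! 0))" by simp
  have "n_definable \<beta> {\<beta>} 3 (\<lambda>\<beta> B S (xs :: 'a list). blk_type \<gamma> B S (xs ! 0) \<and> in_part \<beta> B S (xs ! 2) (xs ! 0) \<and>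
      slt S (xs ! 1) (xs ! 0))"
    by (intro n_definable_conj n_definable_slt P T) auto
  from n_definable_ex[OF this, of 2]
  have 3: "n_definable \<beta> {\<beta>} 2 (\<lambda>\<beta> B S (xs :: 'a list). \<exists>u\<in>B. blk_type \<gamma> B S u \<and> in_part \<beta> B S (xs ! 1) u \<and>
      slt S (xs ! 0) u)" by simp
  have "n_definable \<beta> {\<beta>} 2 (\<lambda>\<beta> B S (xs :: 'a list). in_part \<beta> B S (xs ! 1) (xs ! 0) \<longrightarrow>
      (\<exists>u\<in>B. blk_type \<gamma> B S u \<and> in_part \<beta> B S (xs ! 1) u \<and> slt S u (xs ! 0)) \<and>
      (\<exists>u\<in>B. blk_type \<gamma> B S u \<and> in_part \<beta> B S (xs ! 1) u \<and> slt S (xs ! 0) u))"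
    by (intro n_definable_imp n_definable_conj P 2 3) auto
  from n_definable_all[OF this, of 1]
  have 4: "n_definable \<beta> {\<beta>} 1 (\<lambda>\<beta> B S (xs :: 'a list). \<forall>s\<in>B. in_part \<beta> B S (xs ! 0) s \<longrightarrow>
      (\<exists>u\<in>B. blk_type \<gamma> B S u \<and> in_part \<beta> B S (xs ! 0) u \<and> slt S u s) \<and>
      (\<exists>u\<in>B. blk_type \<gamma> B S u \<and> in_part \<beta> B S (xs ! 0) u \<and> slt S s u))" by simp
  have "n_definable \<beta> {\<beta>} 4 (\<lambda>\<beta> B S (xs :: 'a list). blk_type \<gamma> B S (xs ! 0) \<and>
      slt S (xs ! 2) (xs ! 0) \<and> slt S (xs ! 0) (xs ! 1))"
    by (intro n_definable_conj n_definable_slt T) auto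
  from n_definable_ex[OF this, of 3]
  have "n_definable \<beta> {\<beta>} 3 (\<lambda>\<beta> B S (xs :: 'a list). \<exists>u\<in>B. blk_type \<gamma> B S u \<and>
      slt S (xs ! 1) u \<and> slt S u (xs ! 0))" by simp
  then have "n_definable \<beta> {\<beta>} 3 (\<lambda>\<beta> B S (xs :: 'a list). in_part \<beta> B S (xs ! 2) (xs ! 1) \<and>
      slt S (xs ! 1) (xs ! 0) \<and> in_part \<beta> B S (xs ! 2) (xs ! 0) \<longrightarrow>
      (\<exists>u\<in>B. blk_type \<gamma> B S u \<and> slt S (xs ! 1) u \<and> slt S u (xs ! 0)))"
    by (intro n_definable_imp n_definable_conj n_definable_slt P) auto
  from n_definable_all[OF this, of 2]
  have "n_definable \<beta> {\<beta>} 2 (\<lambda>\<beta> B S (xs :: 'a list). \<forall>t\<in>B. in_part \<beta> B S (xs ! 1) (xs ! 0) \<and>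
      slt S (xs ! 0) t \<and> in_part \<beta> B S (xs ! 1) t \<longrightarrow>
      (\<exists>u\<in>B. blk_type \<gamma> B S u \<and> slt S (xs ! 0) u \<and> slt S u t))" by simp
  from n_definable_all[OF this, of 1]
  have 5: "n_definable \<beta> {\<beta>} 1 (\<lambda>\<beta> B S (xs :: 'a list). \<forall>s\<in>B. \<forall>t\<in>B. in_part \<beta> B S (xs ! 0) s \<and>
      slt S s t \<and> in_part \<beta> B S (xs ! 0) t \<longrightarrow>
      (\<exists>u\<in>B. blk_type \<gamma> B S u \<and> slt S s u \<and> slt S u t))" by simp
  show ?thesis
    unfolding part_dense_def by (intro n_definable_conj 1 4 5)
qed

text \<open>The disjuncts lie below \<open>l\<close>, so the negated disjunction is a conjunction at
  level \<open>l\<close>; undoing the negation costs the one level above \<open>l\<close>, and the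
  outer quantifier is free.\<close>

lemma Pi_definable_all_bex:
  assumes "\<And>k. k \<in> K \<Longrightarrow> \<exists>\<beta><l. Pi_definable \<beta> {..<2} (Q k)" "countable K" "0 < l"
  shows "Pi_definable (succ_ord l) {0} (\<lambda>B S e. \<forall>a\<in>B. \<exists>k\<in>K. Q k B S (e(1 := a)))"
proof -
  have "Pi_definable l {..<2} (\<lambda>B S e. \<not> Q k B S e)" if "k \<in> K" for k
    using assms(1)[OF that] Pi_definable_Not by blast
  then have "Pi_definable l {..<2} (\<lambda>B S e. \<forall>k\<in>K. \<not> Q k B S e)"
    by (intro Pi_definable_ball assms)
  then have "Pi_definable l {..<2} (\<lambda>B S e. \<not> (\<exists>k\<in>K. Q k B S e))" by simp
  then have *: "Pi_definable (succ_ord l) {..<2} (\<lambda>B S e. \<exists>k\<in>K. Q k B S e)"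
    by (rule Pi_definable_not) simp
  show ?thesis
    by (rule Pi_definable_All[OF *]) (auto simp: less_2_cases_iff intro: order.strict_trans[OF assms(3)])
qed

text \<open>Every single density condition is definable below \<open>l\<close>. Only the two clauses
  that choose a label or key for each element, with no bound below \<open>l\<close>, are placed at
  \<open>succ_ord l\<close> by \<open>Pi_definable_all_bex\<close>.\<close>

lemma Pi_definable_canonical:
  assumes l: "limit_ord l"
  shows "Pi_definable (succ_ord l) {0} (\<lambda>B S (e :: nat \<Rightarrow> 'a). canonical l B S (e 0))"
proof -
  have l0: "0 < l" using l by (rule limit_ord_pos)
  have sl: "0 < succ_ord l" using l0 order.strict_trans less_succ_ord by blast
  have low1: "Pi_definable (succ_ord l) {0} (\<lambda>B S (e :: nat \<Rightarrow> 'a). P k B S (e 0))"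
    if d: "n_definable \<alpha> K 1 (\<lambda>k B S xs. P k B S (xs ! 0))" "\<alpha> < l" "k \<in> K" for \<alpha> and K :: "omega1 set" and P k
  proof -
    obtain \<beta> where b: "\<beta> < l" and P: "Pi_definable \<beta> {..<1} (\<lambda>B S (e :: nat \<Rightarrow> 'a). P k B S (map e [0..<1] ! 0))"
      using n_definable_below[OF d(1) l d(2,3)] by blast
    have "\<beta> \<le> succ_ord l" by (rule less_imp_le[OF order.strict_trans[OF b less_succ_ord]])
    from Pi_definable_mono[OF P this, of "{0}"] show ?thesis by (simp add: lessThan_Suc)
  qed
  have 1: "Pi_definable (succ_ord l) {0} (\<lambda>B S (e :: nat \<Rightarrow> 'a). blk_type 0 B S (e 0))"
    by (rule low1[OF n_definable_blk_type l0]) simp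
  have "\<exists>\<beta><l. Pi_definable \<beta> {..<2} (\<lambda>B S (e :: nat \<Rightarrow> 'a). in_block \<gamma> B S (e 1))" if "\<gamma> \<in> {..<l}" for \<gamma>
  proof -
    have "n_definable \<gamma> {..\<gamma>} 2 (\<lambda>\<gamma> B S (xs :: 'a list). in_block \<gamma> B S (xs ! 1))"
      by (rule n_definable_at1[OF n_definable_in_block]) simp
    from n_definable_below[OF this l, of \<gamma>] that show ?thesis by (simp add: upt_rec)
  qed
  from Pi_definable_all_bex[OF this countable_below l0]
  have 2: "Pi_definable (succ_ord l) {0} (\<lambda>B S (e :: nat \<Rightarrow> 'a). \<forall>x\<in>B. \<exists>\<gamma>\<in>{..<l}. in_block \<gamma> B S x)" by simp
  have "\<exists>\<beta>'<l. Pi_definable \<beta>' {..<2} (\<lambda>B S (e :: nat \<Rightarrow> 'a). slt S (e 0) (e 1) \<and> blk_start B S (e 1) \<longrightarrow> in_part \<beta> B S (e 0) (e 1))"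
    if "\<beta> \<in> {..<l}" for \<beta>
  proof -
    have "n_definable \<beta> {\<beta>} 2 (\<lambda>\<beta> B S (xs :: 'a list). slt S (xs ! 0) (xs ! 1) \<and> blk_start B S (xs ! 1) \<longrightarrow>
        in_part \<beta> B S (xs ! 0) (xs ! 1))"
      by (intro n_definable_imp n_definable_conj n_definable_slt n_definable_at1[OF n_definable_blk_start]
          n_definable_in_part) auto
    from n_definable_below[OF this l, of \<beta>] that show ?thesis by (simp add: upt_rec)
  qed
  from Pi_definable_all_bex[OF this countable_below l0]
  have 3: "Pi_definable (succ_ord l) {0} (\<lambda>B S (e :: nat \<Rightarrow> 'a).
      \<forall>s\<in>B. \<exists>\<beta>\<in>{..<l}. slt S (e 0) s \<and> blk_start B S s \<longrightarrow> in_part \<beta> B S (e 0) s)" by simp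
  have 4: "Pi_definable (succ_ord l) {0} (\<lambda>B S (e :: nat \<Rightarrow> 'a). \<forall>\<gamma>\<in>{..<l}. left_dense \<gamma> B S (e 0))"
    by (intro Pi_definable_ball countable_below sl low1[OF n_definable_left_dense]) auto
  have cl: "countable {..\<beta>}" for \<beta> :: omega1
    using countable_below[of "succ_ord \<beta>"] by (simp add: less_succ_ord_iff lessThan_def atMost_def)
  have 5: "Pi_definable (succ_ord l) {0} (\<lambda>B S (e :: nat \<Rightarrow> 'a). \<forall>\<beta>\<in>{..<l}. \<forall>\<gamma>\<in>{..\<beta>}. part_dense \<beta> \<gamma> B S (e 0))"
    by (intro Pi_definable_ball countable_below cl sl low1[OF n_definable_part_dense]) auto
  show ?thesis
    unfolding canonical_def by (intro Pi_definable_conj sl 1 2 3 4 5)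
qed


section \<open>Uniqueness of canonical orders\<close>

lemma succ_ord_neq [simp]: "succ_ord a \<noteq> a" "a \<noteq> succ_ord a" "\<not> succ_ord a < a"
  using less_succ_ord[of a] less_irrefl less_asym by metis+

text \<open>The closed interval has type \<open>w + 1\<close>: its end point is matched with
  \<open>w\<close> itself.\<close>

lemma otyp_closed:
  assumes "lin B S" "s \<in> B" "e \<in> B" "(s, e) \<in> S" "otyp B S s e w"
  shows "isomorphic {x \<in> B. (s, x) \<in> S \<and> (x, e) \<in> S} S {..w} ole"
proof (rule isomorphic_glue[where \<kappa> = "\<lambda>x. x = e" and \<kappa>' = "\<lambda>u. u = w" and K = UNIV and f = id])
  have e: "(e, e) \<in> S" using linD(1)[OF assms(1)] assms(3) by blast
  fix k :: bool
  show "isomorphic {x \<in> {x \<in> B. (s, x) \<in> S \<and> (x, e) \<in> S}. (x = e) = k} S {u \<in> {..w}. (u = w) = id k} ole"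
  proof (cases k)
    case True
    then have "{x \<in> {x \<in> B. (s, x) \<in> S \<and> (x, e) \<in> S}. (x = e) = k} = {e}" "{u \<in> {..w}. (u = w) = id k} = {w}"
      using assms e by auto
    then show ?thesis using e by (auto intro!: isomorphicI[of "\<lambda>_. w"] simp: bij_betw_def)
  next
    case False
    then have "{x \<in> {x \<in> B. (s, x) \<in> S \<and> (x, e) \<in> S}. (x = e) = k} = itv B S s e" "{u \<in> {..w}. (u = w) = id k} = {..<w}"
      by (auto simp: itv_def)
    then show ?thesis using assms(5) by (simp add: otyp_def)
  qed
next
  fix x y x' y'
  assume xy: "x \<in> {x \<in> B. (s, x) \<in> S \<and> (x, e) \<in> S}" "y \<in> {x \<in> B. (s, x) \<in> S \<and> (x, e) \<in> S}"
    "x' \<in> {..w}" "y' \<in> {..w}" "(x' = w) = id (x = e)" "(y' = w) = id (y = e)" "(x = e) \<noteq> (y = e)"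
  show "(x, y) \<in> S \<longleftrightarrow> (x', y') \<in> ole"
  proof (cases "x = e")
    case True
    then have "(x, y) \<notin> S" using xy linD(2)[OF assms(1), of e y] assms(3) by blast
    moreover have "y' < x'" using xy True by auto
    ultimately show ?thesis by (simp add: not_le)
  next
    case False
    then have "y = e" using xy by blast
    then show ?thesis using xy by auto
  qed
qed auto

locale canonical_order =
  fixes l :: omega1 and B :: "'a set" and S and p
  assumes lim: "limit_ord l" and lin: "lin B S" and ctbl: "countable B" and pB: "p \<in> B"
    and canon: "canonical l B S p"
begin

lemma canonD:
  "blk_type 0 B S p"
  "x \<in> B \<Longrightarrow> \<exists>\<gamma><l. in_block \<gamma> B S x"
  "s \<in> B \<Longrightarrow> slt S p s \<Longrightarrow> blk_start B S s \<Longrightarrow> \<exists>\<beta><l. in_part \<beta> B S p s"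
  "\<gamma> < l \<Longrightarrow> left_dense \<gamma> B S p"
  "\<beta> < l \<Longrightarrow> \<gamma>' \<le> \<beta> \<Longrightarrow> part_dense \<beta> \<gamma>' B S p"
proof -
  note c0 = canon[unfolded canonical_def]
  note c = c0[THEN conjunct1] c0[THEN conjunct2, THEN conjunct1] c0[THEN conjunct2, THEN conjunct2, THEN conjunct1]
    c0[THEN conjunct2, THEN conjunct2, THEN conjunct2, THEN conjunct1]
    c0[THEN conjunct2, THEN conjunct2, THEN conjunct2, THEN conjunct2]
  show "blk_type 0 B S p" by (rule c(1))
  show "\<exists>\<gamma><l. in_block \<gamma> B S x" if "x \<in> B" using bspec[OF c(2) that] by auto
  show "\<exists>\<beta><l. in_part \<beta> B S p s" if "s \<in> B" "slt S p s" "blk_start B S s"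
    using bspec[OF c(3) that(1)] that(2,3) by auto
  show "left_dense \<gamma> B S p" if "\<gamma> < l" using c(4) that by simp
  show "part_dense \<beta> \<gamma>' B S p" if "\<beta> < l" "\<gamma>' \<le> \<beta>" using c(5) that by simp
qed

lemmas le_refl = linD(1)[OF lin] and le_antisym = linD(2)[OF lin] and le_total = linD(3)[OF lin]
  and le_trans = linD(4)[OF lin]

lemma slt_le_trans: "slt S x y \<Longrightarrow> (y, z) \<in> S \<Longrightarrow> x \<in> B \<Longrightarrow> y \<in> B \<Longrightarrow> z \<in> B \<Longrightarrow> slt S x z"
  using le_trans le_antisym by metis

lemma le_slt_trans: "(x, y) \<in> S \<Longrightarrow> slt S y z \<Longrightarrow> x \<in> B \<Longrightarrow> y \<in> B \<Longrightarrow> z \<in> B \<Longrightarrow> slt S x z"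
  using le_trans le_antisym by metis

lemma not_slt: "x \<in> B \<Longrightarrow> y \<in> B \<Longrightarrow> \<not> slt S x y \<longleftrightarrow> (y, x) \<in> S"
  using linD(5)[OF lin] by blast

section \<open>Decomposition of a canonical order into blocks\<close>

lemma block_slt:
  assumes "block \<gamma> B S s e" "s \<in> B" "e \<in> B"
  shows "slt S s e"
  using otyp_nonempty[of B S s e "{#\<gamma>#}"] assms lin unfolding block_def by simp

lemma block_end_le:
  assumes "block \<gamma> B S s e" "s \<in> B" "e \<in> B" "n \<in> B" "no_succ B S n" "(s, n) \<in> S"
  shows "(e, n) \<in> S"
  using assms not_slt[of n e] unfolding block_def by blast

lemma block_unique:
  assumes "block \<gamma> B S s e" "block \<gamma>' B S s e'" "s \<in> B" "e \<in> B" "e' \<in> B"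
  shows "e = e'" "\<gamma> = \<gamma>'"
proof -
  have "no_succ B S e" "no_succ B S e'" "slt S s e" "slt S s e'"
    using assms(1,2) block_slt[OF assms(1,3,4)] block_slt[OF assms(2,3,5)] by (simp_all add: block_def)
  then have "(e, e') \<in> S" "(e', e) \<in> S"
    using block_end_le[OF assms(1,3,4,5)] block_end_le[OF assms(2,3,5,4)] by blast+
  then show e: "e = e'" using le_antisym[OF assms(4,5)] by blast
  have "{#\<gamma>#} = {#\<gamma>'#}"
    by (rule otyp_unique[of B S s e]) (use assms(1,2) e in \<open>simp_all add: block_def\<close>)
  then show "\<gamma> = \<gamma>'" by simp
qed

lemma block_before_start:
  assumes "block \<gamma> B S s e" "s \<in> B" "e \<in> B" "t \<in> B" "blk_start B S t" "slt S s t"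
  shows "slt S e t"
proof -
  obtain n where n: "n \<in> B" "no_succ B S n" "(s, n) \<in> S" "slt S n t"
    using assms unfolding blk_start_def by blast
  show ?thesis
    by (rule le_slt_trans[OF block_end_le[OF assms(1-3) n(1-3)] n(4) assms(3) n(1) assms(4)])
qed

definition starts where "starts = {s \<in> B. blk_start B S s}"

definition lab where "lab s = (THE \<gamma>. blk_type \<gamma> B S s)"

lemma blk_type_start: "blk_type \<gamma> B S s \<Longrightarrow> blk_start B S s"
  by (auto simp: blk_type_def block_def)

lemma blk_type_unique: "blk_type \<gamma> B S s \<Longrightarrow> blk_type \<gamma>' B S s \<Longrightarrow> s \<in> B \<Longrightarrow> \<gamma> = \<gamma>'"
  using block_unique(2) unfolding blk_type_def by blast

lemma blk_type_lab: "blk_type \<gamma> B S s \<Longrightarrow> s \<in> B \<Longrightarrow> lab s = \<gamma>"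
  unfolding lab_def using blk_type_unique by blast

lemma ex_block:
  assumes "x \<in> B"
  shows "\<exists>s\<in>starts. \<exists>e\<in>B. lab s < l \<and> block (lab s) B S s e \<and> (s, x) \<in> S \<and> (x, e) \<in> S"
proof -
  obtain \<gamma> s e where g: "\<gamma> < l" "s \<in> B" "e \<in> B" "block \<gamma> B S s e" "(s, x) \<in> S" "(x, e) \<in> S"
    using canonD(2)[OF assms] unfolding in_block_def by blast
  have "blk_type \<gamma> B S s" using g by (auto simp: blk_type_def)
  then have "lab s = \<gamma>" "s \<in> starts"
    using blk_type_lab g(2) blk_type_start by (auto simp: starts_def)
  then show ?thesis using g by blast
qed

text \<open>Of two blocks with different first elements one ends before the other begins, so they
  have no common element.\<close>

lemma block_of_unique:
  assumes "s \<in> B" "e \<in> B" "s' \<in> B" "e' \<in> B" "x \<in> B" "block \<gamma> B S s e" "(s, x) \<in> S" "(x, e) \<in> S"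
    "block \<gamma>' B S s' e'" "(s', x) \<in> S" "(x, e') \<in> S"
  shows "s = s'"
proof -
  have "\<not> slt S s s'"
  proof
    assume "slt S s s'"
    then have "slt S e s'" using block_before_start[OF assms(6,1,2,3)] assms(9) by (simp add: block_def)
    then have "slt S x s'" by (rule le_slt_trans[OF assms(8) _ assms(5,2,3)])
    then show False using le_antisym[OF assms(3,5)] assms(10) by blast
  qed
  moreover have "\<not> slt S s' s"
  proof
    assume "slt S s' s"
    then have "slt S e' s" using block_before_start[OF assms(9,3,4,1)] assms(6) by (simp add: block_def)
    then have "slt S x s" by (rule le_slt_trans[OF assms(11) _ assms(5,4,1)])
    then show False using le_antisym[OF assms(1,5)] assms(7) by blast
  qed
  ultimately show ?thesis
    using not_slt[OF assms(1,3)] not_slt[OF assms(3,1)] le_antisym[OF assms(1,3)] by blast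
qed

definition fin where "fin s = (THE e. e \<in> B \<and> block (lab s) B S s e)"

text \<open>A start lies in some block by canonicity, and it is the first element there: a start
  strictly after the first element comes after the whole block.\<close>

lemma start_block:
  assumes "s \<in> starts"
  shows "s \<in> B" "fin s \<in> B" "block (lab s) B S s (fin s)" "lab s < l" "blk_type (lab s) B S s" "slt S s (fin s)"
    "e \<in> B \<Longrightarrow> block \<gamma> B S s e \<Longrightarrow> e = fin s"
proof -
  show sB: "s \<in> B" using assms by (simp add: starts_def)
  obtain t e where t: "t \<in> starts" "e \<in> B" "lab t < l" "block (lab t) B S t e" "(t, s) \<in> S" "(s, e) \<in> S"
    using ex_block[OF sB] by blast
  have tB: "t \<in> B" using t by (simp add: starts_def)
  have "\<not> slt S t s"
  proof
    assume "slt S t s"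
    then have "slt S e s" using block_before_start[OF t(4) tB t(2) sB] assms by (simp add: starts_def)
    then show False using t(6) le_antisym[OF sB t(2)] by blast
  qed
  then have ts: "t = s" using t(5) by blast
  have be: "block (lab s) B S s e" using t(4) ts by simp
  have "fin s = e"
    unfolding fin_def
  proof (rule the_equality)
    show "e \<in> B \<and> block (lab s) B S s e" using t(2) be by blast
    show "e' = e" if "e' \<in> B \<and> block (lab s) B S s e'" for e'
      using block_unique(1)[of "lab s" s e' "lab s" e] that be sB t(2) by blast
  qed
  then show f: "fin s \<in> B" "block (lab s) B S s (fin s)" using t(2) be by auto
  show "lab s < l" using t(3) ts by simp
  show "blk_type (lab s) B S s" using f by (auto simp: blk_type_def)
  show "slt S s (fin s)" by (rule block_slt[OF f(2) sB f(1)])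
  show "e = fin s" if "e \<in> B" "block \<gamma> B S s e" for e
    by (rule block_unique(1)[OF that(2) f(2) sB that(1) f(1)])
qed

definition sof where "sof x = (THE s. s \<in> starts \<and> (s, x) \<in> S \<and> (x, fin s) \<in> S)"

lemma sofI:
  assumes "s \<in> starts" "x \<in> B" "(s, x) \<in> S" "(x, fin s) \<in> S"
  shows "sof x = s"
  unfolding sof_def
proof (rule the_equality)
  show "s \<in> starts \<and> (s, x) \<in> S \<and> (x, fin s) \<in> S" using assms by blast
  fix t assume t: "t \<in> starts \<and> (t, x) \<in> S \<and> (x, fin t) \<in> S"
  then have t1: "t \<in> starts" by blast
  note a = start_block[OF assms(1)] and b = start_block[OF t1]
  show "t = s"
    using block_of_unique[OF b(1,2) a(1,2) assms(2) b(3) _ _ a(3) assms(3,4)] t by blast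
qed

lemma sof:
  assumes "x \<in> B"
  shows "sof x \<in> starts" "(sof x, x) \<in> S" "(x, fin (sof x)) \<in> S"
proof -
  obtain s e where s: "s \<in> starts" "e \<in> B" "block (lab s) B S s e" "(s, x) \<in> S" "(x, e) \<in> S"
    using ex_block[OF assms] by blast
  have e: "e = fin s" by (rule start_block(7)[OF s(1,2,3)])
  then have xf: "(x, fin s) \<in> S" using s(5) by simp
  have "sof x = s" by (rule sofI[OF s(1) assms s(4) xf])
  then show "sof x \<in> starts" "(sof x, x) \<in> S" "(x, fin (sof x)) \<in> S" using s(1,4) xf by simp_all
qed

lemma fiber_sof:
  assumes "s \<in> starts"
  shows "{x \<in> B. sof x = s} = {x \<in> B. (s, x) \<in> S \<and> (x, fin s) \<in> S}"
proof (intro Collect_cong conj_cong refl iffI)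
  fix x assume x: "x \<in> B"
  show "(s, x) \<in> S \<and> (x, fin s) \<in> S" if "sof x = s" using sof[OF x] that by simp
  show "sof x = s" if "(s, x) \<in> S \<and> (x, fin s) \<in> S" using sofI[OF assms x] that by blast
qed

lemma fiber_iso:
  assumes "s \<in> starts"
  shows "isomorphic {x \<in> B. sof x = s} S {..{#lab s#}} ole"
  unfolding fiber_sof[OF assms]
  by (rule otyp_closed[OF lin]) (use start_block(1,2,3,6)[OF assms] in \<open>simp_all add: block_def\<close>)

lemma sof_le:
  assumes "x \<in> B" "y \<in> B" "sof x \<noteq> sof y"
  shows "(x, y) \<in> S \<longleftrightarrow> (sof x, sof y) \<in> S"
proof -
  have *: "slt S x y" if xy: "x \<in> B" "y \<in> B" "slt S (sof x) (sof y)" for x y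
  proof -
    note a = sof[OF xy(1)] and b = sof[OF xy(2)]
    note a' = start_block[OF a(1)] and b' = start_block[OF b(1)]
    have "blk_start B S (sof y)" using b(1) by (simp add: starts_def)
    then have "slt S (fin (sof x)) (sof y)"
      by (rule block_before_start[OF a'(3,1,2) b'(1) _ xy(3)])
    then have "slt S x (sof y)" by (rule le_slt_trans[OF a(3) _ xy(1) a'(2) b'(1)])
    then show ?thesis by (rule slt_le_trans[OF _ b(2) xy(1) b'(1) xy(2)])
  qed
  have s: "sof x \<in> B" "sof y \<in> B"
    using start_block(1)[OF sof(1)[OF assms(1)]] start_block(1)[OF sof(1)[OF assms(2)]] by auto
  show ?thesis
  proof
    assume "(x, y) \<in> S"
    then have "\<not> slt S y x" using le_antisym[OF assms(1,2)] by blast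
    then show "(sof x, sof y) \<in> S" using *[OF assms(2,1)] assms(3)[symmetric] le_total[OF s] by blast
  next
    assume "(sof x, sof y) \<in> S"
    then show "(x, y) \<in> S" using *[OF assms(1,2)] assms(3) by blast
  qed
qed

text \<open>The label \<beta>' attained after \<open>t\<close> is also attained after
  \<open>s\<close>, where \<beta> is a bound. For \<open>s = t\<close> this gives uniqueness, in
  general that summands decrease to the right.\<close>

lemma in_part_unique:
  assumes "in_part \<beta> B S p s" "in_part \<beta>' B S p t" "(s, t) \<in> S" "s \<in> B" "t \<in> B"
  shows "\<beta>' \<le> \<beta>"
proof -
  obtain u where u: "u \<in> B" "(t, u) \<in> S" "blk_type \<beta>' B S u"
    using assms(2) unfolding in_part_def by blast
  then have "(s, u) \<in> S" "blk_start B S u"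
    using le_trans[OF assms(4,5) u(1) assms(3)] blk_type_start by blast+
  then obtain \<gamma> where "\<gamma> \<le> \<beta>" "blk_type \<gamma> B S u" using assms(1) u(1) unfolding in_part_def by blast
  then show ?thesis using blk_type_unique[OF u(3) _ u(1)] by blast
qed

text \<open>The elements \<open>l\<close> and \<open>succ_ord l\<close> serve as tags for the blocks before \<open>p\<close> and for that of \<open>p\<close>.\<close>

definition key where
  "key s = (if slt S s p then l else if s = p then succ_ord l else (THE \<beta>. in_part \<beta> B S p s))"

lemma p_start: "p \<in> starts" "lab p = 0"
  using pB blk_type_start[OF canonD(1)] blk_type_lab[OF canonD(1) pB] unfolding starts_def by auto

lemma key_part:
  assumes "s \<in> starts" "slt S p s"
  shows "key s < l" "in_part (key s) B S p s" "\<And>\<beta>. in_part \<beta> B S p s \<longleftrightarrow> key s = \<beta>"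
proof -
  have s: "s \<in> B" "blk_start B S s" using assms by (auto simp: starts_def)
  obtain \<beta> where b: "\<beta> < l" "in_part \<beta> B S p s"
    using canonD(3)[OF s(1) assms(2) s(2)] by blast
  have u: "\<beta>' = \<beta>" if "in_part \<beta>' B S p s" for \<beta>'
    using in_part_unique[OF b(2) that] in_part_unique[OF that b(2)] le_refl[OF s(1) s(1)] s(1)
    by (simp add: order_antisym)
  have "\<not> slt S s p" "s \<noteq> p" using assms(2) le_antisym[OF s(1) pB] by blast+
  moreover have "(THE \<beta>. in_part \<beta> B S p s) = \<beta>" using b(2) u by (rule the_equality)
  ultimately have "key s = \<beta>" by (simp add: key_def)
  then show "key s < l" "in_part (key s) B S p s" "\<And>\<beta>. in_part \<beta> B S p s \<longleftrightarrow> key s = \<beta>" using b u by blast+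
qed

lemma key_cases:
  assumes "s \<in> starts"
  obtains "slt S s p" "key s = l" | "s = p" "key s = succ_ord l" | "slt S p s" "key s < l"
proof -
  have s: "s \<in> B" using assms by (auto simp: starts_def)
  consider "slt S s p" | "s = p" | "slt S p s" using le_total[OF s pB] by blast
  then show ?thesis
  proof cases
    case 1
    then show ?thesis using that(1) by (simp add: key_def)
  next
    case 2
    then show ?thesis using that(2) by (simp add: key_def)
  next
    case 3
    then show ?thesis using that(3) key_part(1)[OF assms] by blast
  qed
qed

text \<open>The order of the summands: the two tags come first, then the remaining keys in
  decreasing order.\<close>

definition key_less :: "omega1 \<Rightarrow> omega1 \<Rightarrow> bool" where
  "key_less a b \<longleftrightarrow> a = l \<or> b \<noteq> l \<and> (a = succ_ord l \<or> b \<noteq> succ_ord l \<and> b < a)"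

lemma key_le:
  assumes "s \<in> starts" "t \<in> starts" "key s \<noteq> key t"
  shows "(s, t) \<in> S \<longleftrightarrow> key_less (key s) (key t)"
proof -
  have s: "s \<in> B" "t \<in> B" using assms by (auto simp: starts_def)
  note sl = succ_ord_neq[of l]
  show ?thesis
  proof (cases rule: key_cases[OF assms(1)])
    case 1
    note A = this
    show ?thesis
    proof (cases rule: key_cases[OF assms(2)])
      case 1
      then show ?thesis using A assms(3) by simp
    next
      case 2
      then show ?thesis using A by (simp add: key_less_def)
    next
      case 3
      then have "(s, t) \<in> S" using A le_trans[OF s(1) pB s(2)] by blast
      then show ?thesis using A by (simp add: key_less_def)
    qed
  next
    case 2
    note A = this
    show ?thesis
    proof (cases rule: key_cases[OF assms(2)])
      case 1
      then have "(s, t) \<notin> S" using A le_antisym[OF s(2) pB] by blast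
      then show ?thesis using A 1 sl by (simp add: key_less_def)
    next
      case 2
      then show ?thesis using A assms(3) by simp
    next
      case 3
      then have "key t \<noteq> l" "(s, t) \<in> S" using A by auto
      then show ?thesis using A by (simp add: key_less_def)
    qed
  next
    case 3
    note A = this
    show ?thesis
    proof (cases rule: key_cases[OF assms(2)])
      case 1
      then have "slt S t s" using A slt_le_trans[of t p s] s pB by blast
      then have "(s, t) \<notin> S" using le_antisym[OF s] by blast
      moreover have "key s \<noteq> l" using A by simp
      ultimately show ?thesis using 1 by (simp add: key_less_def)
    next
      case 2
      then have "(s, t) \<notin> S" using A le_antisym[OF s(1) pB] by blast
      moreover have "key s \<noteq> l" "key s \<noteq> succ_ord l" using A sl by auto
      ultimately show ?thesis using 2 sl by (simp add: key_less_def)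
    next
      case 3
      have "key t < key s" if "(s, t) \<in> S"
        using in_part_unique[OF key_part(2)[OF assms(1)] key_part(2)[OF assms(2)]] A 3 that s assms(3) by simp
      moreover have "key s < key t" if "(t, s) \<in> S"
        using in_part_unique[OF key_part(2)[OF assms(2)] key_part(2)[OF assms(1)]] A 3 that s assms(3) by simp
      ultimately have "(s, t) \<in> S \<longleftrightarrow> key t < key s" using le_total[OF s] by (meson less_asym)
      moreover have "key s \<noteq> l" "key t \<noteq> l" "key s \<noteq> succ_ord l" "key t \<noteq> succ_ord l"
        using A 3 sl by auto
      ultimately show ?thesis by (simp add: key_less_def)
    qed
  qed
qed

lemma blk_typeD: "blk_type \<gamma> B S u \<Longrightarrow> u \<in> B \<Longrightarrow> u \<in> starts \<and> lab u = \<gamma>"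
  using blk_type_start blk_type_lab by (simp add: starts_def)

lemma dense_left: "labelled_dense {s \<in> starts. key s = l} S lab {..<l}"
proof -
  have I: "{s \<in> starts. key s = l} = {s \<in> starts. slt S s p}" (is "_ = ?I")
  proof (intro Collect_cong conj_cong refl iffI)
    fix s assume s: "s \<in> starts"
    show "slt S s p" if "key s = l"
      by (cases rule: key_cases[OF s]) (use that less_succ_ord[of l] in auto)
    show "key s = l" if "slt S s p" using that by (simp add: key_def)
  qed
  have ps: "blk_start B S p" using p_start by (simp add: starts_def)
  have "(\<exists>z\<in>?I. lab z = \<gamma>) \<and> (\<forall>x\<in>?I. (\<exists>z\<in>?I. lab z = \<gamma> \<and> slt S z x) \<and> (\<exists>z\<in>?I. lab z = \<gamma> \<and> slt S x z)) \<and>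
     (\<forall>x\<in>?I. \<forall>y\<in>?I. slt S x y \<longrightarrow> (\<exists>z\<in>?I. lab z = \<gamma> \<and> slt S x z \<and> slt S z y))" if g: "\<gamma> < l" for \<gamma>
  proof (intro conjI ballI impI)
    have ld: "left_dense \<gamma> B S p" by (rule canonD(4)[OF g])
    have dn: "\<exists>z\<in>starts. lab z = \<gamma> \<and> slt S z x" if "x \<in> B" "(x, p) \<in> S" for x
    proof -
      have "\<exists>u\<in>B. blk_type \<gamma> B S u \<and> slt S u x" using ld that unfolding left_dense_def by blast
      then show ?thesis using blk_typeD by blast
    qed
    have bt: "\<exists>z\<in>starts. lab z = \<gamma> \<and> slt S x z \<and> slt S z y" if "x \<in> starts" "y \<in> starts" "slt S x y" "(y, p) \<in> S" for x y
    proof -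
      have "x \<in> B" "y \<in> B" "blk_start B S x" "blk_start B S y" using that(1,2) by (auto simp: starts_def)
      then have "\<exists>u\<in>B. blk_type \<gamma> B S u \<and> slt S x u \<and> slt S u y"
        using ld that(3,4) unfolding left_dense_def by blast
      then show ?thesis using blk_typeD by blast
    qed
    have st: "s \<in> B" if "s \<in> starts" for s using that by (simp add: starts_def)
    show "\<exists>z\<in>?I. lab z = \<gamma>" using dn[OF pB le_refl[OF pB pB]] by auto
    show "\<exists>z\<in>?I. lab z = \<gamma> \<and> slt S z x" if x: "x \<in> ?I" for x
    proof -
      have xx: "x \<in> B" "slt S x p" using x st by auto
      obtain z where z: "z \<in> starts" "lab z = \<gamma>" "slt S z x" using dn[of x] xx by blast
      then have "slt S z p" using slt_le_trans[of z x p] xx st pB by blast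
      then show ?thesis using z by blast
    qed
    show "\<exists>z\<in>?I. lab z = \<gamma> \<and> slt S x z" if x: "x \<in> ?I" for x
      using bt[of x p] x p_start(1) le_refl[OF pB pB] by blast
    show "\<exists>z\<in>?I. lab z = \<gamma> \<and> slt S x z \<and> slt S z y" if xy: "x \<in> ?I" "y \<in> ?I" "slt S x y" for x y
    proof -
      have y: "y \<in> B" "slt S y p" using xy st by auto
      obtain z where z: "z \<in> starts" "lab z = \<gamma>" "slt S x z" "slt S z y" using bt[of x y] xy by blast
      then have "slt S z p" using slt_le_trans[of z y p] y st pB by blast
      then show ?thesis using z by blast
    qed
  qed
  then show ?thesis unfolding I labelled_dense_def using start_block(4) by auto
qed

lemma dense_part:
  assumes b: "\<beta> < l"
  shows "labelled_dense {s \<in> starts. key s = \<beta>} S lab {..\<beta>}"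
proof -
  let ?I = "{s \<in> starts. in_part \<beta> B S p s}"
  have I: "{s \<in> starts. key s = \<beta>} = ?I"
  proof (rule Collect_cong, rule conj_cong[OF refl])
    fix s assume s: "s \<in> starts"
    show "key s = \<beta> \<longleftrightarrow> in_part \<beta> B S p s"
    proof (cases rule: key_cases[OF s])
      case 3
      then show ?thesis using key_part(3)[OF s] by blast
    next
      case 1
      have "s \<in> B" using s by (simp add: starts_def)
      then have "\<not> in_part \<beta> B S p s" using 1 le_antisym[OF pB, of s] unfolding in_part_def by blast
      then show ?thesis using 1 b by auto
    next
      case 2
      then have "\<not> in_part \<beta> B S p s" unfolding in_part_def by blast
      moreover have "key s \<noteq> \<beta>" using 2 b less_succ_ord[of l] by auto
      ultimately show ?thesis by blast
    qed
  qed
  have lab: "lab s \<le> \<beta>" if "s \<in> ?I" for s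
  proof -
    have s: "s \<in> B" "blk_start B S s" "(s, s) \<in> S" "in_part \<beta> B S p s"
      using that le_refl[of s s] by (auto simp: starts_def)
    then obtain \<gamma> where "\<gamma> \<le> \<beta>" "blk_type \<gamma> B S s" unfolding in_part_def by blast
    then show ?thesis using blk_type_lab s by blast
  qed
  \<comment> \<open>Parts are convex: the bound on labels is inherited from \<open>s\<close>, the
    occurrence of \<beta> from \<open>t\<close>.\<close>
  have mid: "in_part \<beta> B S p u"
    if h: "in_part \<beta> B S p s" "in_part \<beta> B S p t" "slt S s u" "slt S u t" "u \<in> starts" "s \<in> B" "t \<in> B" for s t u
  proof -
    have u: "u \<in> B" "blk_start B S u" using h(5) by (auto simp: starts_def)
    have ps: "slt S p s" using h(1) unfolding in_part_def by blast
    have pu: "slt S p u" using slt_le_trans[OF ps _ pB h(6) u(1)] h(3) by blast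
    obtain v where v: "v \<in> B" "(t, v) \<in> S" "blk_type \<beta> B S v" using h(2) unfolding in_part_def by blast
    have uv: "(u, v) \<in> S" using h(4) le_trans[OF u(1) h(7) v(1)] v(2) by blast
    have "(s, w) \<in> S" if "w \<in> B" "(u, w) \<in> S" for w
      using le_trans[OF h(6) u(1) that(1) _ that(2)] h(3) by blast
    then have "\<forall>w\<in>B. (u, w) \<in> S \<and> blk_start B S w \<longrightarrow> (\<exists>\<gamma>\<in>{..\<beta>}. blk_type \<gamma> B S w)"
      using h(1) unfolding in_part_def by blast
    then show ?thesis unfolding in_part_def using u pu v uv by blast
  qed
  have "(\<exists>z\<in>?I. lab z = \<gamma>) \<and> (\<forall>x\<in>?I. (\<exists>z\<in>?I. lab z = \<gamma> \<and> slt S z x) \<and> (\<exists>z\<in>?I. lab z = \<gamma> \<and> slt S x z)) \<and>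
     (\<forall>x\<in>?I. \<forall>y\<in>?I. slt S x y \<longrightarrow> (\<exists>z\<in>?I. lab z = \<gamma> \<and> slt S x z \<and> slt S z y))" if g: "\<gamma> \<le> \<beta>" for \<gamma>
  proof (intro conjI ballI impI)
    have pd: "part_dense \<beta> \<gamma> B S p" by (rule canonD(5)[OF b g])
    have st: "s \<in> B" "in_part \<beta> B S p s" if "s \<in> ?I" for s using that by (auto simp: starts_def)
    show dn: "\<exists>z\<in>?I. lab z = \<gamma> \<and> slt S z x" if x: "x \<in> ?I" for x
    proof -
      have "\<exists>u\<in>B. blk_type \<gamma> B S u \<and> in_part \<beta> B S p u \<and> slt S u x"
        using pd st[OF x] unfolding part_dense_def by blast
      then show ?thesis using blk_typeD by blast
    qed
    show up: "\<exists>z\<in>?I. lab z = \<gamma> \<and> slt S x z" if x: "x \<in> ?I" for x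
    proof -
      have "\<exists>u\<in>B. blk_type \<gamma> B S u \<and> in_part \<beta> B S p u \<and> slt S x u"
        using pd st[OF x] unfolding part_dense_def by blast
      then show ?thesis using blk_typeD by blast
    qed
    obtain s where "s \<in> B" "in_part \<beta> B S p s" using pd unfolding part_dense_def by blast
    then have "s \<in> ?I" unfolding in_part_def starts_def by blast
    then show "\<exists>z\<in>?I. lab z = \<gamma>" using dn by blast
    show "\<exists>z\<in>?I. lab z = \<gamma> \<and> slt S x z \<and> slt S z y" if xy: "x \<in> ?I" "y \<in> ?I" "slt S x y" for x y
    proof -
      note x = st[OF xy(1)] and y = st[OF xy(2)]
      obtain u where u: "u \<in> B" "blk_type \<gamma> B S u" "slt S x u" "slt S u y"
        using pd x y xy(3) unfolding part_dense_def by blast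
      then have "u \<in> starts" "lab u = \<gamma>" using blk_typeD by blast+
      moreover have "in_part \<beta> B S p u" using mid[OF x(2) y(2) u(3,4)] calculation x y by blast
      ultimately show ?thesis using u by blast
    qed
  qed
  then show ?thesis unfolding I labelled_dense_def using lab by auto
qed

end

text \<open>Cantor's theorem matches first elements with equal labels; the blocks above them have
  the same order type and are glued.\<close>

lemma labelled_pieces_isomorphic:
  fixes B :: "'a set" and B' :: "'b set"
  assumes "canonical_order l B S p" "canonical_order l B' S' p'"
    and I: "I \<subseteq> canonical_order.starts B S" "labelled_dense I S (canonical_order.lab B S) L"
    and I': "I' \<subseteq> canonical_order.starts B' S'" "labelled_dense I' S' (canonical_order.lab B' S') L"
  shows "isomorphic {x \<in> B. canonical_order.sof B S x \<in> I} S {x \<in> B'. canonical_order.sof B' S' x \<in> I'} S'"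
proof -
  interpret A: canonical_order l B S p by fact
  interpret A': canonical_order l B' S' p' by fact
  have sub: "I \<subseteq> B" "I' \<subseteq> B'" using I I' by (auto simp: A.starts_def A'.starts_def)
  obtain f where f: "bij_betw f I I'" "\<And>x y. x \<in> I \<Longrightarrow> y \<in> I \<Longrightarrow> (x, y) \<in> S \<longleftrightarrow> (f x, f y) \<in> S'"
    "\<And>x. x \<in> I \<Longrightarrow> A'.lab (f x) = A.lab x"
    using labelled_cantor[OF lin_subset[OF A.lin sub(1)] countable_subset[OF sub(1) A.ctbl] I(2)
        lin_subset[OF A'.lin sub(2)] countable_subset[OF sub(2) A'.ctbl] I'(2)] by metis
  have fI: "f ` I = I'" "inj_on f I" using f(1) by (auto simp: bij_betw_def)
  show ?thesis
  proof (rule isomorphic_glue[where \<kappa> = A.sof and \<kappa>' = A'.sof and K = I and f = f])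
    fix k assume k: "k \<in> I"
    then have k': "f k \<in> I'" using fI by blast
    have e: "{x \<in> {x \<in> B. A.sof x \<in> I}. A.sof x = k} = {x \<in> B. A.sof x = k}"
      "{x \<in> {x \<in> B'. A'.sof x \<in> I'}. A'.sof x = f k} = {x \<in> B'. A'.sof x = f k}" using k k' by auto
    have 1: "isomorphic {x \<in> B. A.sof x = k} S {..{#A.lab k#}} ole" using A.fiber_iso I(1) k by blast
    have 2: "isomorphic {x \<in> B'. A'.sof x = f k} S' {..{#A.lab k#}} ole"
      using A'.fiber_iso[of "f k"] subsetD[OF I'(1) k'] f(3)[OF k] by simp
    show "isomorphic {x \<in> {x \<in> B. A.sof x \<in> I}. A.sof x = k} S
        {x \<in> {x \<in> B'. A'.sof x \<in> I'}. A'.sof x = f k} S'"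
      unfolding e by (rule isomorphic_trans[OF 1 isomorphic_sym[OF 2]])
  next
    fix x y x' y'
    assume xy: "x \<in> {x \<in> B. A.sof x \<in> I}" "y \<in> {x \<in> B. A.sof x \<in> I}" "x' \<in> {x \<in> B'. A'.sof x \<in> I'}"
      "y' \<in> {x \<in> B'. A'.sof x \<in> I'}" "A'.sof x' = f (A.sof x)" "A'.sof y' = f (A.sof y)" "A.sof x \<noteq> A.sof y"
    then have "A'.sof x' \<noteq> A'.sof y'" using inj_onD[OF fI(2), of "A.sof x" "A.sof y"] by auto
    then show "(x, y) \<in> S \<longleftrightarrow> (x', y') \<in> S'"
      using A.sof_le[of x y] A'.sof_le[of x' y'] f(2)[of "A.sof x" "A.sof y"] xy by simp
  qed (use fI in auto)
qed

text \<open>Gluing over the keys: equal keys carry shuffles of the same label set, or the single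
  block of label 0 at \<open>p\<close> and \<open>p'\<close>, and \<open>key_less\<close> orders the
  summands identically on both sides.\<close>

lemma canonical_isomorphic:
  fixes B :: "'a set" and B' :: "'b set"
  assumes "canonical_order l B S p" "canonical_order l B' S' p'"
  shows "isomorphic B S B' S'"
proof -
  interpret A: canonical_order l B S p by fact
  interpret A': canonical_order l B' S' p' by fact
  have kl: "A'.key_less = A.key_less"
    by (intro ext) (simp add: A.key_less_def A'.key_less_def)
  show ?thesis
  proof (rule isomorphic_glue[where \<kappa> = "A.key \<circ> A.sof" and \<kappa>' = "A'.key \<circ> A'.sof" and K = UNIV and f = id])
    fix k :: omega1
    have 1: "{x \<in> B. (A.key \<circ> A.sof) x = k} = {x \<in> B. A.sof x \<in> {s \<in> A.starts. A.key s = k}}"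
      using A.sof(1) by auto
    have 2: "{x \<in> B'. (A'.key \<circ> A'.sof) x = id k} = {x \<in> B'. A'.sof x \<in> {s \<in> A'.starts. A'.key s = k}}"
      using A'.sof(1) by auto
    consider "k < l" | "k = l" | "k = succ_ord l" | "\<not> k \<le> succ_ord l"
      by (metis less_succ_ord_iff linorder_neqE not_le)
    then show "isomorphic {x \<in> B. (A.key \<circ> A.sof) x = k} S {x \<in> B'. (A'.key \<circ> A'.sof) x = id k} S'"
    proof cases
      case k1: 1
      show ?thesis unfolding 1 2
        by (rule labelled_pieces_isomorphic[OF assms _ A.dense_part[OF k1] _ A'.dense_part[OF k1]]) auto
    next
      case k2: 2
      show ?thesis unfolding 1 2 unfolding k2
        by (rule labelled_pieces_isomorphic[OF assms _ A.dense_left _ A'.dense_left]) auto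
    next
      case 3
      have "s \<in> A.starts \<Longrightarrow> A.key s = k \<longleftrightarrow> s = p" for s
        by (rule A.key_cases[of s]) (use 3 less_succ_ord[of l] in \<open>auto simp: A.key_def\<close>)
      then have "{s \<in> A.starts. A.key s = k} = {p}" using A.p_start by auto
      moreover have "s \<in> A'.starts \<Longrightarrow> A'.key s = k \<longleftrightarrow> s = p'" for s
        by (rule A'.key_cases[of s]) (use 3 less_succ_ord[of l] in \<open>auto simp: A'.key_def\<close>)
      then have "{s \<in> A'.starts. A'.key s = k} = {p'}" using A'.p_start by auto
      ultimately show ?thesis unfolding 1 2
        using A.fiber_iso[OF A.p_start(1)] A'.fiber_iso[OF A'.p_start(1)] isomorphic_sym isomorphic_trans
        by (simp add: A.p_start A'.p_start) blast
    next
      \<comment> \<open>No block has a key beyond the two tags, so both fibres are empty.\<close>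
      case 4
      then have k4: "\<not> k < l" "k \<noteq> l" "k \<noteq> succ_ord l"
        using less_succ_ord[of l] by (metis less_imp_le order.strict_trans order_refl)+
      have "A.key s \<noteq> k" if s: "s \<in> A.starts" for s
        by (cases rule: A.key_cases[OF s]) (use k4 in auto)
      then have e: "{s \<in> A.starts. A.key s = k} = {}" by blast
      have "A'.key s \<noteq> k" if s: "s \<in> A'.starts" for s
        by (cases rule: A'.key_cases[OF s]) (use k4 in auto)
      then have "{s \<in> A'.starts. A'.key s = k} = {}" by blast
      then show ?thesis unfolding 1 2 e by (simp add: isomorphic_def bij_betw_def)
    qed
  next
    fix x y x' y' assume xy: "x \<in> B" "y \<in> B" "x' \<in> B'" "y' \<in> B'" "(A'.key \<circ> A'.sof) x' = id ((A.key \<circ> A.sof) x)"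
      "(A'.key \<circ> A'.sof) y' = id ((A.key \<circ> A.sof) y)" "(A.key \<circ> A.sof) x \<noteq> (A.key \<circ> A.sof) y"
    have "A.sof x \<noteq> A.sof y" "A'.sof x' \<noteq> A'.sof y'" using xy by auto
    then show "(x, y) \<in> S \<longleftrightarrow> (x', y') \<in> S'"
      using A.sof_le[OF xy(1,2)] A'.sof_le[OF xy(3,4)] A.key_le[of "A.sof x" "A.sof y"]
        A'.key_le[of "A'.sof x'" "A'.sof y'"] A.sof(1) A'.sof(1) xy kl by simp
  qed auto
qed


section \<open>The two orders\<close>

lemma ex_irrational: "\<exists>x :: real. x \<notin> \<rat>"
proof -
  have "countable (\<rat> :: real set)"
    unfolding Rats_def by (rule countable_image) simp
  then show ?thesis using uncountable_UNIV_real by (metis UNIV_I subsetI countable_subset)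
qed

text \<open>Distinct natural multiples of an irrational lie in distinct cosets of the rationals,
  which yields disjoint dense sets of positions for the labels.\<close>

definition irr :: real where "irr = (SOME x. x \<notin> \<rat>)"

lemma irr: "irr \<notin> \<rat>"
  unfolding irr_def using someI_ex[OF ex_irrational] .

type_synonym idx = "omega1 \<times> real \<times> omega1"

abbreviation pos :: "idx \<Rightarrow> real" where "pos i \<equiv> fst (snd i)"

abbreviation lb :: "idx \<Rightarrow> omega1" where "lb i \<equiv> snd (snd i)"

text \<open>The first component of an index names the summand \<open>Q\<^sub>\<beta>\<close> it belongs to; summands are arranged
  in decreasing order. The position of a block within its summand is a real number, and its elements are
  the multisets \<open>w \<le> {#\<gamma>#}\<close>, which form a copy of \<open>\<omega>\<^bsup>\<gamma>\<^esup> + 1\<close>.\<close>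

definition ilt :: "idx \<Rightarrow> idx \<Rightarrow> bool" where
  "ilt i j \<longleftrightarrow> fst j < fst i \<or> fst i = fst j \<and> pos i < pos j"

type_synonym elem = "idx \<times> omega1 multiset"

definition El :: "idx set \<Rightarrow> elem set" where
  "El I = {(i, w). i \<in> I \<and> w \<le> {#lb i#}}"

definition ER :: "idx set \<Rightarrow> elem rel" where
  "ER I = {(a, b). a \<in> El I \<and> b \<in> El I \<and> (ilt (fst a) (fst b) \<or> fst a = fst b \<and> snd a \<le> snd b)}"

lemma in_El [simp]: "(i, w) \<in> El I \<longleftrightarrow> i \<in> I \<and> w \<le> {#lb i#}"
  by (simp add: El_def)

lemma ilt_irrefl [simp]: "\<not> ilt i i"
  by (simp add: ilt_def)

lemma ilt_trans: "ilt i j \<Longrightarrow> ilt j k \<Longrightarrow> ilt i k"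
  by (auto simp: ilt_def)

lemma slt_ER: "slt (ER I) (i, v) (j, w) \<longleftrightarrow> (i, v) \<in> El I \<and> (j, w) \<in> El I \<and> (ilt i j \<or> i = j \<and> v < w)"
  by (auto simp: ER_def order_less_le)

lemma le_ER: "((i, v), (j, w)) \<in> ER I \<longleftrightarrow> (i, v) \<in> El I \<and> (j, w) \<in> El I \<and> (ilt i j \<or> i = j \<and> v \<le> w)"
  by (simp add: ER_def)

text \<open>A bound by \<open>{#\<gamma>#}\<close> is to be read as an ordinal inequality and should
  not be unfolded into a condition on exponents.\<close>

declare mset_lt_single_right_iff [simp del] mset_le_single_right_iff [simp del]

locale limit_orders =
  fixes l :: omega1
  assumes lim: "limit_ord l"
begin

lemma l_pos: "0 < l" by (rule limit_ord_pos[OF lim])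

text \<open>One coset of the rationals per label: dense, disjoint for different labels below
  \<open>l\<close>, and invariant under integer translations, which the shifts of the cut
  use.\<close>

definition X :: "omega1 \<Rightarrow> real set" where
  "X \<gamma> = range (\<lambda>q :: rat. of_rat q + irr * of_nat (to_nat_on {..<l} \<gamma>))"

lemma X_dense:
  assumes "a < b"
  shows "\<exists>x\<in>X \<gamma>. a < x \<and> x < b"
proof -
  let ?c = "irr * of_nat (to_nat_on {..<l} \<gamma>)"
  obtain q :: rat where "a - ?c < of_rat q" "of_rat q < b - ?c"
    using of_rat_dense[of "a - ?c" "b - ?c"] assms by auto
  then show ?thesis unfolding X_def by (intro bexI[of _ "of_rat q + ?c"]) auto
qed

lemma X_disjoint:
  assumes "x \<in> X \<gamma>" "x \<in> X \<gamma>'" "\<gamma> < l" "\<gamma>' < l"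
  shows "\<gamma> = \<gamma>'"
proof -
  obtain q :: rat where q: "x = of_rat q + irr * of_nat (to_nat_on {..<l} \<gamma>)"
    using assms(1) unfolding X_def by blast
  obtain q' :: rat where "x = of_rat q' + irr * of_nat (to_nat_on {..<l} \<gamma>')"
    using assms(2) unfolding X_def by blast
  then have eq: "irr * (of_nat (to_nat_on {..<l} \<gamma>) - of_nat (to_nat_on {..<l} \<gamma>')) = of_rat (q' - q)"
    using q by (simp add: algebra_simps of_rat_diff)
  have "to_nat_on {..<l} \<gamma> = to_nat_on {..<l} \<gamma>'"
  proof (rule ccontr)
    assume "to_nat_on {..<l} \<gamma> \<noteq> to_nat_on {..<l} \<gamma>'"
    \<comment> \<open>Different numbers of the labels would allow solving for \<open>irr\<close> as
      a rational.\<close>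
    then have "irr = of_rat (q' - q) / (of_nat (to_nat_on {..<l} \<gamma>) - of_nat (to_nat_on {..<l} \<gamma>'))"
      using eq by (simp add: eq_divide_eq)
    also have "\<dots> \<in> \<rat>" by simp
    finally show False using irr by blast
  qed
  then show ?thesis
    using inj_onD[OF inj_on_to_nat_on[OF countable_below]] assms(3,4) by blast
qed

lemma X_shift:
  assumes "x \<in> X \<gamma>"
  shows "x + of_int k \<in> X \<gamma>"
proof -
  obtain q :: rat where "x = of_rat q + irr * of_nat (to_nat_on {..<l} \<gamma>)"
    using assms unfolding X_def by blast
  then have "x + of_int k = of_rat (q + of_int k) + irr * of_nat (to_nat_on {..<l} \<gamma>)"
    by (simp add: of_rat_add)
  then show ?thesis unfolding X_def by blast
qed

text \<open>The key \<open>l\<close> names the left summand. The two bounds on labels treat both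
  kinds of summand at once: they leave all labels below \<open>l\<close> at key \<open>l\<close>,
  and the labels up to \<beta> at a key \<beta> below \<open>l\<close>.\<close>

definition IB :: "idx set" where
  "IB = {i. fst i \<le> l \<and> lb i < l \<and> lb i \<le> fst i \<and> pos i \<in> X (lb i)}"

text \<open>The block at which the left summand is cut: the position in \<open>X 0\<close> with
  rational part 0.\<close>

definition iD :: idx where
  "iD = (l, irr * of_nat (to_nat_on {..<l} 0), 0)"

definition IA :: "idx set" where
  "IA = {i \<in> IB. fst i = l \<longrightarrow> pos i \<le> pos iD}"

lemma iD: "iD \<in> IA" "iD \<in> IB" "fst iD = l" "lb iD = 0"
proof -
  have "pos iD \<in> X 0" unfolding X_def iD_def by (rule range_eqI[of _ _ 0]) simp
  then show "iD \<in> IB" "fst iD = l" "lb iD = 0" using l_pos by (auto simp: IB_def iD_def)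
  then show "iD \<in> IA" by (simp add: IA_def)
qed

lemma IA_subset: "IA \<subseteq> IB"
  by (auto simp: IA_def)

text \<open>Indices with equal key and position have equal labels because the sets of positions are
  disjoint; \<open>ilt\<close> therefore need not compare labels.\<close>

lemma ilt_total: "i \<in> IB \<Longrightarrow> j \<in> IB \<Longrightarrow> i = j \<or> ilt i j \<or> ilt j i"
  using X_disjoint[of "pos i" "lb i" "lb j"] by (cases i, cases j) (auto simp: IB_def ilt_def)

lemma countable_IB: "countable IB"
proof (rule countable_subset)
  have c: "countable {..<succ_ord l}" by (rule countable_below)
  show "IB \<subseteq> {..<succ_ord l} \<times> (\<Union>\<gamma>\<in>{..<succ_ord l}. X \<gamma>) \<times> {..<succ_ord l}"
    by (force simp: IB_def less_succ_ord_iff)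
  show "countable ({..<succ_ord l} \<times> (\<Union>\<gamma>\<in>{..<succ_ord l}. X \<gamma>) \<times> {..<succ_ord l})"
    by (intro countable_SIGMA countable_UN c) (simp add: X_def)
qed

lemma countable_El: "I \<subseteq> IB \<Longrightarrow> countable (El I)"
proof -
  assume "I \<subseteq> IB"
  then have "El I \<subseteq> (SIGMA i:IB. insert {#lb i#} {w. w < {#lb i#}})"
    by (auto simp: El_def)
  then show ?thesis
    by (rule countable_subset) (intro countable_SIGMA countable_IB countable_insert countable_less_singleton_mset)
qed

lemma linear_order_El:
  assumes "I \<subseteq> IB"
  shows "linear_order_on (El I) (ER I)"
proof -
  have 1: "(a, b) \<in> ER I \<or> (b, a) \<in> ER I" if "a \<in> El I" "b \<in> El I" for a b
    using that ilt_total[of "fst a" "fst b"] assms by (cases a, cases b) (auto simp: le_ER)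
  have 2: "a = b" if "(a, b) \<in> ER I" "(b, a) \<in> ER I" for a b
    using that ilt_trans[of "fst a" "fst b" "fst a"] by (cases a, cases b) (auto simp: le_ER)
  have 3: "(a, c) \<in> ER I" if "(a, b) \<in> ER I" "(b, c) \<in> ER I" for a b c
  proof -
    obtain i u where a: "a = (i, u)" by (cases a)
    obtain j v where b: "b = (j, v)" by (cases b)
    obtain k w where c: "c = (k, w)" by (cases c)
    show ?thesis
      using that ilt_trans[of i j k] order.trans[of u v w] unfolding a b c le_ER by blast
  qed
  have 4: "(a, a) \<in> ER I" if "a \<in> El I" for a
    using that by (cases a) (auto simp: le_ER)
  have 5: "ER I \<subseteq> El I \<times> El I" by (auto simp: ER_def)
  have "refl_on (El I) (ER I)" by (rule refl_onI) (rule 4)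
  moreover have "trans (ER I)" by (rule transI) (rule 3)
  moreover have "antisym (ER I)" by (rule antisymI) (rule 2)
  moreover have "total_on (El I) (ER I)" by (rule total_onI) (rule 1)
  ultimately show ?thesis unfolding order_on_defs using 5 by (intro conjI)
qed

lemma lin_El:
  assumes "I \<subseteq> IB"
  shows "lin (El I) (ER I)"
proof -
  have r: "refl_on (El I) (ER I)" "trans (ER I)" "antisym (ER I)" "total_on (El I) (ER I)"
    using linear_order_El[OF assms] by (auto simp: order_on_defs)
  show ?thesis
    unfolding lin_def
  proof (intro ballI conjI impI)
    fix x y z assume x: "x \<in> El I" and y: "y \<in> El I"
    show refl: "(x, x) \<in> ER I" using r(1) x by (rule refl_onD)
    show "x = y" if "(x, y) \<in> ER I \<and> (y, x) \<in> ER I" using antisymD[OF r(3)] that by blast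
    show "(x, z) \<in> ER I" if "(x, y) \<in> ER I \<and> (y, z) \<in> ER I" using transD[OF r(2)] that by blast
    show "(x, y) \<in> ER I \<or> (y, x) \<in> ER I" using r(4) x y refl unfolding total_on_def by (cases "x = y") auto
  qed
qed

section \<open>Recognising blocks in a sum over indices\<close>

definition dense_idx :: "idx set \<Rightarrow> bool" where
  "dense_idx I \<longleftrightarrow> I \<subseteq> IB \<and> (\<forall>i\<in>I. \<forall>j\<in>I. ilt i j \<longrightarrow> (\<exists>k\<in>I. ilt i k \<and> ilt k j))"

text \<open>An inner element \<open>w\<close> has the ordinal successor
  \<open>w \<oplus> {#0#}\<close> in its block; after the last element of a block, density of the
  indices leaves no next element.\<close>

lemma no_succ_iff:
  assumes I: "dense_idx I" and e: "(i, w) \<in> El I"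
  shows "no_succ (El I) (ER I) (i, w) \<longleftrightarrow> w = {#lb i#}"
proof
  assume n: "no_succ (El I) (ER I) (i, w)"
  show "w = {#lb i#}"
  proof (rule ccontr)
    assume "w \<noteq> {#lb i#}"
    then have "w < {#lb i#}" using e le_neq_trans[of w "{#lb i#}"] by simp
    then obtain r where r: "{#lb i#} = w \<oplus> r" "r \<noteq> {#}" by (metis le_imp_osum less_imp_le less_osum_iff)
    \<comment> \<open>Below \<omega>^0 = 1 there is only 0, so adding \<open>{#0#}\<close> is the
      least possible increase.\<close>
    have min: "v = {#}" if "v < {#0 :: omega1#}" for v
      using that leD[OF omega1_zero_le] unfolding mset_lt_single_right_iff by (metis multiset_nonemptyE)
    then have "{#0#} \<le> r" using r(2) by (meson not_le)
    then have y: "(i, w \<oplus> {#0#}) \<in> El I" using e r(1) by simp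
    have s: "slt (ER I) (i, w) (i, w \<oplus> {#0#})" using e y unfolding slt_ER by simp
    obtain j v where jv: "(j, v) \<in> El I" "slt (ER I) (i, w) (j, v)" "slt (ER I) (j, v) (i, w \<oplus> {#0#})"
      using n s y unfolding no_succ_def by (metis surj_pair)
    then have "j = i" "w < v" "v < w \<oplus> {#0#}"
      using ilt_trans[of i j i] unfolding slt_ER by auto
    moreover obtain u where "v = w \<oplus> u" using \<open>w < v\<close> by (metis le_imp_osum less_imp_le)
    ultimately show False using min[of u] by simp
  qed
next
  assume w: "w = {#lb i#}"
  have "\<exists>z\<in>El I. slt (ER I) (i, w) z \<and> slt (ER I) z y" if y: "y \<in> El I" "slt (ER I) (i, w) y" for y
  proof -
    obtain j v where jv: "y = (j, v)" by (cases y)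
    then have "ilt i j" "i \<in> I" "j \<in> I" using y w unfolding jv slt_ER by auto
    then obtain k where "k \<in> I" "ilt i k" "ilt k j" using I unfolding dense_idx_def by blast
    then show ?thesis using y e unfolding jv by (intro bexI[of _ "(k, {#})"]) (unfold slt_ER, auto)
  qed
  then show "no_succ (El I) (ER I) (i, w)" unfolding no_succ_def by blast
qed

text \<open>Before an element with \<open>w = {#}\<close> come only other blocks, whose last
  elements separate; otherwise nothing separates it from the first element of its own block.\<close>

lemma blk_start_iff:
  assumes I: "dense_idx I" and e: "(i, w) \<in> El I"
  shows "blk_start (El I) (ER I) (i, w) \<longleftrightarrow> w = {#}"
proof
  assume b: "blk_start (El I) (ER I) (i, w)"
  show "w = {#}"
  proof (rule ccontr)
    assume "w \<noteq> {#}"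
    then have "slt (ER I) (i, {#}) (i, w)" "(i, {#}) \<in> El I"
      using e unfolding slt_ER by auto
    then obtain n where n: "n \<in> El I" "no_succ (El I) (ER I) n" "((i, {#}), n) \<in> ER I" "slt (ER I) n (i, w)"
      using b unfolding blk_start_def by blast
    obtain j v where jv: "n = (j, v)" by (cases n)
    have "j = i" "v < w" using n(3,4) ilt_trans[of i j i] unfolding jv slt_ER le_ER by auto
    moreover have "v = {#lb j#}" using no_succ_iff[OF I] n(1,2) jv by blast
    ultimately show False using e by auto
  qed
next
  assume w: "w = {#}"
  have "\<exists>n\<in>El I. no_succ (El I) (ER I) n \<and> (z, n) \<in> ER I \<and> slt (ER I) n (i, w)"
    if z: "z \<in> El I" "slt (ER I) z (i, w)" for z
  proof -
    obtain j v where jv: "z = (j, v)" by (cases z)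
    have "\<not> v < {#}" by (simp add: not_less)
    then have j: "ilt j i" "(j, v) \<in> El I" "(j, {#lb j#}) \<in> El I" using z w unfolding jv slt_ER by auto
    then show ?thesis
      using e no_succ_iff[OF I j(3)] unfolding jv by (intro bexI[of _ "(j, {#lb j#})"]) (unfold slt_ER le_ER, auto)
  qed
  then show "blk_start (El I) (ER I) (i, w)" unfolding blk_start_def by blast
qed

lemma otyp_El:
  assumes "i \<in> I"
  shows "otyp (El I) (ER I) (i, {#}) (i, {#lb i#}) {#lb i#}"
  unfolding otyp_def
proof (rule isomorphic_sym, rule isomorphicI[of "Pair i"])
  have "itv (El I) (ER I) (i, {#}) (i, {#lb i#}) = Pair i ` {..<{#lb i#}}" (is "?L = ?R")
  proof
    show "?R \<subseteq> ?L"
    proof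
      fix z assume "z \<in> ?R"
      then obtain v where v: "z = (i, v)" "v < {#lb i#}" by blast
      then show "z \<in> ?L" using assms unfolding itv_def mem_Collect_eq v(1) slt_ER le_ER by auto
    qed
    show "?L \<subseteq> ?R"
    proof
      fix z assume z: "z \<in> ?L"
      obtain j v where jv: "z = (j, v)" by (cases z)
      have "j = i" "v < {#lb i#}" using z ilt_trans[of i j i] unfolding jv itv_def mem_Collect_eq slt_ER le_ER by auto
      then show "z \<in> ?R" using jv by auto
    qed
  qed
  then show "bij_betw (Pair i) {..<{#lb i#}} (itv (El I) (ER I) (i, {#}) (i, {#lb i#}))"
    by (auto simp: bij_betw_def inj_on_def)
  show "(x, y) \<in> ole \<longleftrightarrow> ((i, x), (i, y)) \<in> ER I" if "x \<in> {..<{#lb i#}}" "y \<in> {..<{#lb i#}}" for x y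
    using that assms by (auto simp: le_ER)
qed

lemma block_El:
  assumes I: "dense_idx I" "i \<in> I"
  shows "block (lb i) (El I) (ER I) (i, {#}) (i, {#lb i#})"
  unfolding block_def
proof (intro conjI ballI impI)
  have e: "(i, {#}) \<in> El I" "(i, {#lb i#}) \<in> El I" using I by auto
  show "blk_start (El I) (ER I) (i, {#})" using blk_start_iff[OF I(1) e(1)] by simp
  show "no_succ (El I) (ER I) (i, {#lb i#})" using no_succ_iff[OF I(1) e(2)] by simp
  show "otyp (El I) (ER I) (i, {#}) (i, {#lb i#}) {#lb i#}" by (rule otyp_El[OF I(2)])
  fix n assume n: "n \<in> El I" "((i, {#}), n) \<in> ER I \<and> slt (ER I) n (i, {#lb i#})"
  obtain j v where jv: "n = (j, v)" by (cases n)
  have "j = i" "v < {#lb i#}" using n(2) ilt_trans[of i j i] unfolding jv slt_ER le_ER by auto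
  then show "\<not> no_succ (El I) (ER I) n" using no_succ_iff[OF I(1)] n(1) jv by auto
qed

lemma blk_type_iff:
  assumes I: "dense_idx I" and s: "s \<in> El I"
  shows "blk_type \<gamma> (El I) (ER I) s \<longleftrightarrow> (\<exists>i\<in>I. s = (i, {#}) \<and> \<gamma> = lb i)"
proof
  assume "\<exists>i\<in>I. s = (i, {#}) \<and> \<gamma> = lb i"
  then show "blk_type \<gamma> (El I) (ER I) s"
    unfolding blk_type_def using block_El[OF I] by force
next
  assume "blk_type \<gamma> (El I) (ER I) s"
  then obtain e where e: "e \<in> El I" "block \<gamma> (El I) (ER I) s e" unfolding blk_type_def by blast
  obtain i w where iw: "s = (i, w)" by (cases s)
  obtain j v where jv: "e = (j, v)" by (cases e)
  have w: "w = {#}" using e(2) s blk_start_iff[OF I] iw unfolding block_def by blast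
  have v: "v = {#lb j#}" using e no_succ_iff[OF I] jv unfolding block_def by blast
  have i: "i \<in> I" using s iw by simp
  have "slt (ER I) s e"
    by (rule otyp_nonempty[of "El I" "ER I" s e "{#\<gamma>#}"])
      (use e s I lin_El in \<open>auto simp: block_def dense_idx_def\<close>)
  then consider "ilt i j" | "i = j" unfolding iw jv slt_ER by auto
  then have "i = j"
  proof cases
    case 1
    \<comment> \<open>If \<open>e\<close> belonged to a later block, the last element of block
      \<open>i\<close> would be an element without successor strictly before
      \<open>e\<close>.\<close>
    have n: "(i, {#lb i#}) \<in> El I" using i by simp
    have "no_succ (El I) (ER I) (i, {#lb i#})" using no_succ_iff[OF I n] by simp
    moreover have "(s, (i, {#lb i#})) \<in> ER I" "slt (ER I) (i, {#lb i#}) e"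
      using 1 n s e(1) w unfolding iw jv slt_ER le_ER by auto
    ultimately show ?thesis using e(2) n unfolding block_def by blast
  qed
  then have "{#\<gamma>#} = {#lb i#}"
    using otyp_unique[OF _ otyp_El[OF i]] e(2) iw jv w v unfolding block_def by blast
  then show "\<exists>i\<in>I. s = (i, {#}) \<and> \<gamma> = lb i" using i iw w by auto
qed

lemma dense_IB: "dense_idx IB"
  unfolding dense_idx_def
proof (intro conjI subset_refl ballI impI)
  fix i j assume i: "i \<in> IB" and j: "j \<in> IB" and lt: "ilt i j"
  show "\<exists>k\<in>IB. ilt i k \<and> ilt k j"
  proof (cases "fst j < fst i")
    case True
    \<comment> \<open>The intermediate block is taken in the summand of \<open>j\<close>, which lies
      entirely after that of \<open>i\<close>; label 0 is available in every summand.\<close>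
    obtain x where x: "x \<in> X 0" "pos j - 1 < x" "x < pos j" using X_dense[of "pos j - 1" "pos j" 0] by auto
    show ?thesis
      by (rule bexI[of _ "(fst j, x, 0)"]) (use True x j l_pos in \<open>auto simp: ilt_def IB_def\<close>)
  next
    case False
    then have eq: "fst i = fst j" "pos i < pos j" using lt by (auto simp: ilt_def)
    obtain x where x: "x \<in> X 0" "pos i < x" "x < pos j" using X_dense[OF eq(2), of 0] by auto
    show ?thesis
      by (rule bexI[of _ "(fst j, x, 0)"]) (use eq x j l_pos in \<open>auto simp: ilt_def IB_def\<close>)
  qed
qed

lemma dense_IA: "dense_idx IA"
  unfolding dense_idx_def
proof (intro conjI IA_subset ballI impI)
  fix i j assume i: "i \<in> IA" and j: "j \<in> IA" and lt: "ilt i j"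
  show "\<exists>k\<in>IA. ilt i k \<and> ilt k j"
  proof (cases "fst j < fst i")
    case True
    obtain x where x: "x \<in> X 0" "pos j - 1 < x" "x < pos j" using X_dense[of "pos j - 1" "pos j" 0] by auto
    show ?thesis
      by (rule bexI[of _ "(fst j, x, 0)"]) (use True x j l_pos in \<open>auto simp: ilt_def IB_def IA_def\<close>)
  next
    case False
    then have eq: "fst i = fst j" "pos i < pos j" using lt by (auto simp: ilt_def)
    obtain x where x: "x \<in> X 0" "pos i < x" "x < pos j" using X_dense[OF eq(2), of 0] by auto
    show ?thesis
      by (rule bexI[of _ "(fst j, x, 0)"]) (use eq x j l_pos in \<open>auto simp: ilt_def IB_def IA_def\<close>)
  qed
qed

abbreviation "A \<equiv> El IA"
abbreviation "RA \<equiv> ER IA"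

text \<open>From \<open>i\<close> on no label exceeds \<open>fst i\<close>, as later summands have
  smaller keys, and \<open>fst i\<close> recurs later in the same summand by \<open>top\<close>. So
  below \<open>l\<close> the greatest label from \<open>i\<close> on recovers the key.\<close>

lemma in_part_iff:
  assumes s: "s \<in> A"
  shows "in_part \<beta> A RA (iD, {#}) s \<longleftrightarrow> (\<exists>i\<in>IA. s = (i, {#}) \<and> fst i = \<beta> \<and> \<beta> < l)"
proof -
  note T = blk_type_iff[OF dense_IA]
  have top: "\<exists>j\<in>IA. ilt i j \<and> fst j = fst i \<and> lb j = fst i" if i: "i \<in> IA" "fst i < l" for i
  proof -
    obtain x where x: "x \<in> X (fst i)" "pos i < x" using X_dense[of "pos i" "pos i + 1" "fst i"] by auto
    show ?thesis
      by (rule bexI[of _ "(fst i, x, fst i)"]) (use i x in \<open>auto simp: ilt_def IB_def IA_def\<close>)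
  qed
  have below: "lb j \<le> fst i" if "j \<in> IA" "ilt i j \<or> i = j" for i j
    using that by (auto simp: IA_def IB_def ilt_def)
  have ltD: "fst i < l" if "i \<in> IA" "ilt iD i" for i
    using that iD(3) by (auto simp: IA_def IB_def ilt_def)
  show ?thesis
  proof
    assume p: "in_part \<beta> A RA (iD, {#}) s"
    obtain i w where iw: "s = (i, w)" by (cases s)
    have i: "i \<in> IA" using s iw by simp
    have w: "w = {#}" using p s iw blk_start_iff[OF dense_IA] unfolding in_part_def by blast
    have "slt RA (iD, {#}) s" using p unfolding in_part_def by blast
    then have fl: "fst i < l" using ltD[OF i] w unfolding iw slt_ER by auto
    obtain t where t: "t \<in> A" "(s, t) \<in> RA" "blk_type \<beta> A RA t" using p unfolding in_part_def by blast
    obtain j where j: "j \<in> IA" "t = (j, {#})" "\<beta> = lb j" using T t by blast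
    have "\<beta> \<le> fst i" using below[OF j(1), of i] t(2) j iw by (auto simp: le_ER)
    moreover obtain k where k: "k \<in> IA" "ilt i k" "fst k = fst i" "lb k = fst i" using top[OF i fl] by blast
    have "(k, {#}) \<in> A" "(s, (k, {#})) \<in> RA" "blk_start A RA (k, {#})"
      using k s iw blk_start_iff[OF dense_IA] by (auto simp: le_ER)
    then obtain \<gamma> where "\<gamma> \<le> \<beta>" "blk_type \<gamma> A RA (k, {#})" using p unfolding in_part_def by blast
    then have "fst i \<le> \<beta>" using T[of "(k, {#})"] \<open>(k, {#}) \<in> A\<close> k by auto
    ultimately show "\<exists>i\<in>IA. s = (i, {#}) \<and> fst i = \<beta> \<and> \<beta> < l" using i iw w fl by auto
  next
    assume "\<exists>i\<in>IA. s = (i, {#}) \<and> fst i = \<beta> \<and> \<beta> < l"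
    then obtain i where i: "i \<in> IA" "s = (i, {#})" "fst i = \<beta>" "\<beta> < l" by blast
    show "in_part \<beta> A RA (iD, {#}) s"
      unfolding in_part_def
    proof (intro conjI ballI impI)
      have "slt RA (iD, {#}) s" using i(1,3,4) s iD unfolding i(2) slt_ER ilt_def by auto
      then show "((iD, {#}), s) \<in> RA" "(iD, {#}) \<noteq> s" by auto
      show "blk_start A RA s" using blk_start_iff[OF dense_IA] s i by blast
      obtain k where k: "k \<in> IA" "ilt i k" "lb k = fst i" using top[of i] i by auto
      then have "(s, (k, {#})) \<in> RA" "blk_type \<beta> A RA (k, {#})" "(k, {#}) \<in> A"
        using s i T[of "(k, {#})"] by (auto simp: le_ER)
      then show "\<exists>t\<in>A. (s, t) \<in> RA \<and> blk_type \<beta> A RA t" by blast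
      fix t assume t: "t \<in> A" "(s, t) \<in> RA \<and> blk_start A RA t"
      obtain j v where jv: "t = (j, v)" by (cases t)
      have v: "v = {#}" using blk_start_iff[OF dense_IA] t jv by blast
      have j: "j \<in> IA" "lb j \<le> \<beta>" using t jv below[of j i] i by (auto simp: le_ER)
      have "blk_type (lb j) A RA t" using T[OF t(1)] jv v j by blast
      then show "\<exists>\<gamma>\<in>{..\<beta>}. blk_type \<gamma> A RA t" using j by blast
    qed
  qed
qed

lemma canonical_A: "canonical l A RA (iD, {#})"
proof -
  note T = blk_type_iff[OF dense_IA]
  have pA: "(iD, {#}) \<in> A" using iD by simp
  have 1: "blk_type 0 A RA (iD, {#})" using T[OF pA] iD by auto
  have 2: "\<exists>\<gamma>\<in>{..<l}. in_block \<gamma> A RA x" if x: "x \<in> A" for x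
  proof -
    obtain i w where iw: "x = (i, w)" by (cases x)
    have i: "i \<in> IA" "lb i < l" using x iw by (auto simp: IA_def IB_def)
    have "block (lb i) A RA (i, {#}) (i, {#lb i#})" by (rule block_El[OF dense_IA i(1)])
    moreover have "(i, {#}) \<in> A" "(i, {#lb i#}) \<in> A" "((i, {#}), x) \<in> RA" "(x, (i, {#lb i#})) \<in> RA"
      using i x iw by (auto simp: le_ER)
    ultimately show ?thesis using i(2) unfolding in_block_def by blast
  qed
  have 3: "\<exists>\<beta>\<in>{..<l}. slt RA (iD, {#}) s \<and> blk_start A RA s \<longrightarrow> in_part \<beta> A RA (iD, {#}) s" if s: "s \<in> A" for s
  proof -
    obtain i w where iw: "s = (i, w)" by (cases s)
    have i: "i \<in> IA" using s iw by simp
    show ?thesis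
    proof (cases "slt RA (iD, {#}) s \<and> blk_start A RA s")
      case True
      then have w: "w = {#}" using blk_start_iff[OF dense_IA] s iw by blast
      then have "ilt iD i" using True unfolding iw slt_ER by auto
      then have "fst i < l" using i iD(3) by (auto simp: IA_def IB_def ilt_def)
      then show ?thesis using in_part_iff[OF s, of "fst i"] i iw w by auto
    next
      case False
      then show ?thesis using l_pos by blast
    qed
  qed
  have El: "((\<beta>, x, \<gamma>), {#}) \<in> A" "blk_type \<gamma> A RA ((\<beta>, x, \<gamma>), {#})" if "(\<beta>, x, \<gamma>) \<in> IA" for \<beta> x \<gamma>
    using that T[of "((\<beta>, x, \<gamma>), {#})"] by auto
  have 4: "left_dense \<gamma> A RA (iD, {#})" if g: "\<gamma> < l" for \<gamma>
  proof -
    have le: "fst i = l \<and> pos i \<le> pos iD" if "i \<in> IA" "ilt i iD \<or> i = iD" for i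
      using that iD(3) by (auto simp: IA_def IB_def ilt_def)
    have mem: "(l, x, \<gamma>) \<in> IA" if "x \<in> X \<gamma>" "x \<le> pos iD" for x
      using that g by (auto simp: IA_def IB_def)
    show ?thesis
      unfolding left_dense_def
    proof (intro conjI ballI impI)
      fix x assume x: "x \<in> A" "(x, (iD, {#})) \<in> RA"
      obtain i w where iw: "x = (i, w)" by (cases x)
      have i: "i \<in> IA" "fst i = l" "pos i \<le> pos iD" using x iw le[of i] by (auto simp: le_ER)
      obtain y where y: "y \<in> X \<gamma>" "y < pos i" using X_dense[of "pos i - 1" "pos i" \<gamma>] by auto
      have m: "(l, y, \<gamma>) \<in> IA" using mem[OF y(1)] y(2) i(3) by simp
      have "slt RA ((l, y, \<gamma>), {#}) x" using m x(1) y i unfolding iw slt_ER ilt_def by simp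
      then show "\<exists>u\<in>A. blk_type \<gamma> A RA u \<and> slt RA u x" using El[OF m] by blast
    next
      fix s t assume st: "s \<in> A" "t \<in> A" "blk_start A RA s \<and> slt RA s t \<and> blk_start A RA t \<and> (t, (iD, {#})) \<in> RA"
      obtain i w where iw: "s = (i, w)" by (cases s)
      obtain j v where jv: "t = (j, v)" by (cases t)
      have "w = {#}" "v = {#}" using blk_start_iff[OF dense_IA] st iw jv by blast+
      then have ij: "i \<in> IA" "j \<in> IA" "ilt i j" using st unfolding iw jv slt_ER by auto
      have j: "fst j = l" "pos j \<le> pos iD" using le[of j] st ij(2) jv by (auto simp: le_ER)
      have i: "fst i = l" "pos i < pos j" using ij j by (auto simp: ilt_def IA_def IB_def)
      obtain y where y: "y \<in> X \<gamma>" "pos i < y" "y < pos j" using X_dense[OF i(2)] by blast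
      have m: "(l, y, \<gamma>) \<in> IA" using mem[OF y(1)] y(3) j(2) by simp
      have "slt RA s ((l, y, \<gamma>), {#})" "slt RA ((l, y, \<gamma>), {#}) t"
        using m st(1,2) y i j unfolding iw jv slt_ER ilt_def by simp_all
      then show "\<exists>u\<in>A. blk_type \<gamma> A RA u \<and> slt RA s u \<and> slt RA u t" using El[OF m] by blast
    qed
  qed
  have 5: "part_dense \<beta> \<gamma> A RA (iD, {#})" if b: "\<beta> < l" "\<gamma> \<le> \<beta>" for \<beta> \<gamma>
  proof -
    have mem: "(\<beta>, x, \<gamma>) \<in> IA" if "x \<in> X \<gamma>" for x
      using that b by (auto simp: IA_def IB_def)
    have P: "in_part \<beta> A RA (iD, {#}) ((\<beta>, x, \<gamma>), {#})" if "(\<beta>, x, \<gamma>) \<in> IA" for x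
      using in_part_iff[OF El(1)[OF that], of \<beta>] that b(1) by auto
    have PD: "\<exists>i\<in>IA. s = (i, {#}) \<and> fst i = \<beta>" if "s \<in> A" "in_part \<beta> A RA (iD, {#}) s" for s
      using in_part_iff[OF that(1)] that(2) by blast
    show ?thesis
      unfolding part_dense_def
    proof (intro conjI ballI impI)
      obtain y where "y \<in> X \<gamma>" using X_dense[of 0 1 \<gamma>] by auto
      then show "\<exists>s\<in>A. in_part \<beta> A RA (iD, {#}) s" using mem P El(1) by blast
    next
      fix s assume s: "s \<in> A" "in_part \<beta> A RA (iD, {#}) s"
      obtain i where i: "i \<in> IA" "s = (i, {#})" "fst i = \<beta>" using PD[OF s] by blast
      obtain y where y: "y \<in> X \<gamma>" "y < pos i" using X_dense[of "pos i - 1" "pos i" \<gamma>] by auto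
      note m = mem[OF y(1)]
      have "slt RA ((\<beta>, y, \<gamma>), {#}) s" using m s(1) i(1,3) y unfolding i(2) slt_ER ilt_def by simp
      then show "\<exists>u\<in>A. blk_type \<gamma> A RA u \<and> in_part \<beta> A RA (iD, {#}) u \<and> slt RA u s"
        using El[OF m] P[OF m] by blast
    next
      fix s assume s: "s \<in> A" "in_part \<beta> A RA (iD, {#}) s"
      obtain i where i: "i \<in> IA" "s = (i, {#})" "fst i = \<beta>" using PD[OF s] by blast
      obtain y where y: "y \<in> X \<gamma>" "pos i < y" using X_dense[of "pos i" "pos i + 1" \<gamma>] by auto
      note m = mem[OF y(1)]
      have "slt RA s ((\<beta>, y, \<gamma>), {#})" using m s(1) i(1,3) y unfolding i(2) slt_ER ilt_def by simp
      then show "\<exists>u\<in>A. blk_type \<gamma> A RA u \<and> in_part \<beta> A RA (iD, {#}) u \<and> slt RA s u"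
        using El[OF m] P[OF m] by blast
    next
      fix s t assume st: "s \<in> A" "t \<in> A" "in_part \<beta> A RA (iD, {#}) s \<and> slt RA s t \<and> in_part \<beta> A RA (iD, {#}) t"
      obtain i where i: "i \<in> IA" "s = (i, {#})" "fst i = \<beta>" using PD[OF st(1)] st(3) by blast
      obtain j where j: "j \<in> IA" "t = (j, {#})" "fst j = \<beta>" using PD[OF st(2)] st(3) by blast
      have "pos i < pos j" using st(3) i(3) j(3) unfolding i(2) j(2) slt_ER ilt_def by auto
      then obtain y where y: "y \<in> X \<gamma>" "pos i < y" "y < pos j" using X_dense by blast
      note m = mem[OF y(1)]
      have "slt RA s ((\<beta>, y, \<gamma>), {#})" "slt RA ((\<beta>, y, \<gamma>), {#}) t"
        using m st(1,2) i(1,3) j(1,3) y unfolding i(2) j(2) slt_ER ilt_def by simp_all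
      then show "\<exists>u\<in>A. blk_type \<gamma> A RA u \<and> slt RA s u \<and> slt RA u t" using El[OF m] by blast
    qed
  qed
  show ?thesis unfolding canonical_def using 1 2 3 4 5 by simp
qed

lemma canonical_order_A: "canonical_order l A RA (iD, {#})"
  by (unfold_locales) (use lim lin_El[OF IA_subset] countable_El[OF IA_subset] iD canonical_A in auto)

text \<open>If \<open>p\<close> lies in the left summand, the labels after it are unbounded below
  \<open>l\<close>, so blocks following it belong to no part. If \<open>p\<close> lies in a summand
  with a key below \<open>l\<close>, larger labels are missing just before \<open>p\<close>.\<close>

lemma not_canonical_IB:
  assumes p: "p \<in> El IB"
  shows "\<not> canonical l (El IB) (ER IB) p"
proof
  assume c: "canonical l (El IB) (ER IB) p"
  interpret canonical_order l "El IB" "ER IB" p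
    by (rule canonical_order.intro[OF lim lin_El[OF subset_refl] countable_El[OF subset_refl] p c])
  note T = blk_type_iff[OF dense_IB]
  obtain i where i: "i \<in> IB" "p = (i, {#})" using T[OF p] canonD(1) by blast
  have st: "blk_start (El IB) (ER IB) (j, {#})" "(j, {#}) \<in> El IB" if "j \<in> IB" for j
    using blk_start_iff[OF dense_IB] that by auto
  show False
  proof (cases "fst i = l")
    case True
    obtain x where x: "x \<in> X 0" "pos i < x" using X_dense[of "pos i" "pos i + 1" 0] by auto
    have j: "(l, x, 0) \<in> IB" using x l_pos by (simp add: IB_def)
    have "slt (ER IB) p ((l, x, 0), {#})" using i(1) j x True unfolding i(2) slt_ER ilt_def by simp
    then obtain \<beta> where b: "\<beta> < l" "in_part \<beta> (El IB) (ER IB) p ((l, x, 0), {#})"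
      using canonD(3)[OF st(2)[OF j] _ st(1)[OF j]] by blast
    \<comment> \<open>Blocks of label \<open>succ_ord \<beta>\<close> occur arbitrarily late in the
      left summand, although \<beta> should bound all labels from the chosen start on.\<close>
    have sb: "succ_ord \<beta> < l" by (rule limit_ord_succ[OF lim b(1)])
    obtain y where y: "y \<in> X (succ_ord \<beta>)" "x < y" using X_dense[of x "x + 1" "succ_ord \<beta>"] by auto
    have k: "(l, y, succ_ord \<beta>) \<in> IB" using y sb by (simp add: IB_def)
    have "(((l, x, 0), {#}), ((l, y, succ_ord \<beta>), {#})) \<in> ER IB" using j k y by (simp add: le_ER ilt_def)
    then obtain \<gamma> where "\<gamma> \<le> \<beta>" "blk_type \<gamma> (El IB) (ER IB) ((l, y, succ_ord \<beta>), {#})"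
      using b(2) st[OF k] unfolding in_part_def by blast
    then show False using T[OF st(2)[OF k]] by (auto simp: succ_ord_le_iff)
  next
    case False
    then have fl: "fst i < l" using i by (auto simp: IB_def)
    \<comment> \<open>Density on the left demands this label between two blocks of the summand with
      key \<open>fst i\<close>, whose labels are at most \<open>fst i\<close>.\<close>
    have sb: "succ_ord (fst i) < l" by (rule limit_ord_succ[OF lim fl])
    obtain x where x: "x \<in> X 0" "x < pos i" using X_dense[of "pos i - 1" "pos i" 0] by auto
    have j: "(fst i, x, 0) \<in> IB" using x l_pos fl by (simp add: IB_def)
    have "slt (ER IB) ((fst i, x, 0), {#}) p" using i(1) j x unfolding i(2) slt_ER ilt_def by simp
    moreover have "(p, p) \<in> ER IB" using p i by (simp add: le_ER)
    moreover have "blk_start (El IB) (ER IB) p" using st(1)[OF i(1)] i(2) by simp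
    ultimately obtain u where u: "u \<in> El IB" "blk_type (succ_ord (fst i)) (El IB) (ER IB) u"
      "slt (ER IB) ((fst i, x, 0), {#}) u" "slt (ER IB) u p"
      using canonD(4)[OF sb] st[OF j] p unfolding left_dense_def by blast
    obtain k where k: "k \<in> IB" "u = (k, {#})" "lb k = succ_ord (fst i)" using T[OF u(1)] u(2) by auto
    have "fst k = fst i" using u(3,4) unfolding k(2) i(2) slt_ER ilt_def by auto
    moreover have "lb k \<le> fst k" using k(1) by (simp add: IB_def)
    ultimately show False using k(3) by (simp add: succ_ord_le_iff)
  qed
qed

end


section \<open>Back-and-forth between ordinals\<close>

text \<open>A pair is a matched couple of ordinals; the condition compares the types of the
  intervals from \<open>p\<close> to \<open>q\<close> on the two sides.\<close>

definition osim_itv :: "omega1 \<Rightarrow> omega1 multiset \<times> omega1 multiset \<Rightarrow> omega1 multiset \<times> omega1 multiset \<Rightarrow> bool" where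
  "osim_itv \<delta> p q \<longleftrightarrow> (\<exists>d d'. fst q = fst p \<oplus> d \<and> snd q = snd p \<oplus> d' \<and> osim \<delta> d d')"

definition osim_map :: "omega1 \<Rightarrow> (omega1 multiset \<times> omega1 multiset) set \<Rightarrow> bool" where
  "osim_map \<delta> Q \<longleftrightarrow> (\<forall>p\<in>Q. \<forall>q\<in>Q. fst p \<le> fst q \<longrightarrow> osim_itv \<delta> p q)"

lemma osim_itv_trans:
  assumes "osim_itv \<delta> p q" "osim_itv \<delta> q r"
  shows "osim_itv \<delta> p r"
proof -
  obtain d d' where d: "fst q = fst p \<oplus> d" "snd q = snd p \<oplus> d'" "osim \<delta> d d'"
    using assms(1) unfolding osim_itv_def by blast
  obtain e e' where e: "fst r = fst q \<oplus> e" "snd r = snd q \<oplus> e'" "osim \<delta> e e'"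
    using assms(2) unfolding osim_itv_def by blast
  have "fst r = fst p \<oplus> (d \<oplus> e)" "snd r = snd p \<oplus> (d' \<oplus> e')"
    using d e by (simp_all add: osum_assoc)
  then show ?thesis using osim_osum[OF d(3) e(3)] unfolding osim_itv_def by blast
qed

lemma osim_itv_mono: "osim_itv \<delta> p q \<Longrightarrow> \<delta>' \<le> \<delta> \<Longrightarrow> osim_itv \<delta>' p q"
  unfolding osim_itv_def using osim_mono by blast

lemma osim_itv_refl: "osim_itv \<delta> p p"
  unfolding osim_itv_def by (intro exI[of _ "{#}"]) simp

lemma osim_itv_less:
  assumes "osim_itv \<delta> p q"
  shows "snd p \<le> snd q" "fst p < fst q \<longleftrightarrow> snd p < snd q"
proof -
  obtain d d' where d: "fst q = fst p \<oplus> d" "snd q = snd p \<oplus> d'" "osim \<delta> d d'"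
    using assms(1) unfolding osim_itv_def by blast
  show "snd p \<le> snd q" "fst p < fst q \<longleftrightarrow> snd p < snd q"
    using osim_empty_iff[OF d(3)] unfolding d(1,2) by simp_all
qed

text \<open>Similarity preserves emptiness of intervals, so the map is strictly increasing and
  reflects order and equality.\<close>

lemma osim_map_le:
  assumes "osim_map \<delta> Q" "p \<in> Q" "q \<in> Q"
  shows "fst p \<le> fst q \<longleftrightarrow> snd p \<le> snd q" "fst p = fst q \<longleftrightarrow> snd p = snd q"
proof -
  have *: "osim_itv \<delta> p q" if "fst p \<le> fst q" "p \<in> Q" "q \<in> Q" for p q
    using assms(1) that unfolding osim_map_def by blast
  consider "fst p < fst q" | "fst p = fst q" | "fst q < fst p" by (rule linorder_cases)
  then have "(fst p \<le> fst q \<longleftrightarrow> snd p \<le> snd q) \<and> (fst p = fst q \<longleftrightarrow> snd p = snd q)"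
  proof cases
    case 1
    then have "snd p < snd q" using osim_itv_less(2)[OF *[OF less_imp_le assms(2,3)]] by blast
    then show ?thesis using 1 by auto
  next
    case 2
    then have "snd p \<le> snd q" "snd q \<le> snd p"
      using osim_itv_less(1)[OF *[OF _ assms(2,3)]] osim_itv_less(1)[OF *[OF _ assms(3,2)]] by auto
    then show ?thesis using 2 by auto
  next
    case 3
    then have "snd q < snd p" using osim_itv_less(2)[OF *[OF less_imp_le assms(3,2)]] by blast
    then show ?thesis using 3 by auto
  qed
  then show "fst p \<le> fst q \<longleftrightarrow> snd p \<le> snd q" "fst p = fst q \<longleftrightarrow> snd p = snd q" by auto
qed

lemma osim_map_converse:
  assumes "osim_map \<delta> Q"
  shows "osim_map \<delta> (Q\<inverse>)"
  unfolding osim_map_def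
proof (intro ballI impI)
  fix p q assume p: "p \<in> Q\<inverse>" and q: "q \<in> Q\<inverse>" and le: "fst p \<le> fst q"
  obtain u v where u: "p = (u, v)" "(v, u) \<in> Q" using p by (cases p) auto
  obtain x y where x: "q = (x, y)" "(y, x) \<in> Q" using q by (cases q) auto
  have "v \<le> y" using osim_map_le(1)[OF assms u(2) x(2)] le u x by simp
  then have "osim_itv \<delta> (v, u) (y, x)" using assms u(2) x(2) unfolding osim_map_def by force
  then show "osim_itv \<delta> p q" using osim_sym u x unfolding osim_itv_def by force
qed

text \<open>Points are inserted from left to right. Everything from the last inserted point \<open>m\<close> on still
  matches at the finer level \<open>\<delta>\<close>, which is what allows the next insertion.\<close>

lemma osim_map_insert:
  assumes Q: "finite Q" "osim_map \<delta>' Q" "\<delta>' < \<delta>"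
    and hi: "\<And>p q. p \<in> Q \<Longrightarrow> q \<in> Q \<Longrightarrow> m \<le> fst p \<Longrightarrow> fst p \<le> fst q \<Longrightarrow> osim_itv \<delta> p q"
    and m: "m \<in> fst ` Q" "m \<le> x" and top: "t \<in> fst ` Q" "x \<le> t"
  shows "\<exists>x'. osim_map \<delta>' (insert (x, x') Q) \<and>
    (\<forall>p\<in>insert (x, x') Q. \<forall>q\<in>insert (x, x') Q. x \<le> fst p \<longrightarrow> fst p \<le> fst q \<longrightarrow> osim_itv \<delta> p q)"
proof (cases "x \<in> fst ` Q")
  case True
  then obtain x' where x': "(x, x') \<in> Q" by force
  then have "insert (x, x') Q = Q" by blast
  then show ?thesis using Q(2) hi m(2) by (intro exI[of _ x']) (auto intro: order.trans)
next
  case False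
  have mx: "m < x" "x < t" using False m top by (metis le_neq_trans)+
  let ?lo = "{u \<in> fst ` Q. u < x}" and ?up = "{u \<in> fst ` Q. x < u}"
  have fin: "finite ?lo" "finite ?up" and ne: "?lo \<noteq> {}" "?up \<noteq> {}" using Q(1) m top mx by auto
  have lm: "Max ?lo \<in> ?lo" "Min ?up \<in> ?up" using Max_in[OF fin(1) ne(1)] Min_in[OF fin(2) ne(2)] by auto
  obtain p0 where p0: "p0 \<in> Q" "fst p0 = Max ?lo" "fst p0 < x" using lm(1) by auto
  obtain q0 where q0: "q0 \<in> Q" "fst q0 = Min ?up" "x < fst q0" using lm(2) by auto
  have lo: "fst p \<le> fst p0" if "p \<in> Q" "fst p \<le> x" for p
  proof -
    have "fst p < x" using that False by (metis image_eqI le_neq_trans)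
    then show ?thesis using Max_ge[OF fin(1), of "fst p"] that(1) p0(2) by auto
  qed
  have up: "fst q0 \<le> fst p" if "p \<in> Q" "x \<le> fst p" for p
  proof -
    have "x < fst p" using that False by (metis image_eqI le_neq_trans)
    then show ?thesis using Min_le[OF fin(2), of "fst p"] that(1) q0(2) by auto
  qed
  have mp: "m \<le> fst p0" using lo m(1) mx(1) by auto
  have "fst p0 \<le> fst q0" using p0(3) q0(3) by (meson less_imp_le order.strict_trans)
  then have "osim_itv \<delta> p0 q0" by (rule hi[OF p0(1) q0(1) mp])
  then obtain d d' where d: "fst q0 = fst p0 \<oplus> d" "snd q0 = snd p0 \<oplus> d'" "osim \<delta> d d'"
    unfolding osim_itv_def by blast
  obtain e where e: "x = fst p0 \<oplus> e" using p0(3) le_imp_osum[OF less_imp_le] by blast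
  obtain r where r: "fst q0 = x \<oplus> r" using q0(3) le_imp_osum[OF less_imp_le] by blast
  have "d = e \<oplus> r" using d(1) r e by (simp add: osum_assoc)
  moreover have "r \<noteq> {#}" using q0(3) r by auto
  ultimately obtain e' r' where er: "d' = e' \<oplus> r'" "osim \<delta>' e e'" "osim \<delta> r r'"
    using osim_split[OF d(3) _ _ Q(3)] by blast
  let ?x = "(x, snd p0 \<oplus> e')"
  have px: "osim_itv \<delta>' p0 ?x" unfolding osim_itv_def using e er by auto
  have xq: "osim_itv \<delta> ?x q0"
    unfolding osim_itv_def using r er d(2) by (auto simp: osum_assoc)
  have xq': "osim_itv \<delta>' ?x q0" using osim_itv_mono[OF xq] Q(3) by simp
  have M: "osim_itv \<delta>' p q" if "p \<in> Q" "q \<in> Q" "fst p \<le> fst q" for p q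
    using Q(2) that unfolding osim_map_def by blast
  have "osim_itv \<delta>' p q" if pq: "p \<in> insert ?x Q" "q \<in> insert ?x Q" "fst p \<le> fst q" for p q
  proof -
    consider "p = ?x" "q = ?x" | "p = ?x" "q \<in> Q" | "p \<in> Q" "q = ?x" | "p \<in> Q" "q \<in> Q" using pq(1,2) by blast
    then show ?thesis
    proof cases
      case 1
      then show ?thesis using osim_itv_refl by blast
    next
      case 2
      then have "osim_itv \<delta>' q0 q" using M[OF q0(1)] up[of q] pq(3) by simp
      then show ?thesis using osim_itv_trans[OF xq'] 2 by blast
    next
      case 3
      then have "osim_itv \<delta>' p p0" using M[OF _ p0(1)] lo[of p] pq(3) by simp
      then show ?thesis using osim_itv_trans[OF _ px] 3 by blast
    next
      case 4
      then show ?thesis using M pq(3) by blast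
    qed
  qed
  moreover have "osim_itv \<delta> p q" if pq: "p \<in> insert ?x Q" "q \<in> insert ?x Q" "x \<le> fst p" "fst p \<le> fst q" for p q
  proof -
    have mq: "m \<le> fst q0" using mx q0(3) by (meson less_imp_le order.strict_trans)
    consider "p = ?x" "q = ?x" | "p = ?x" "q \<in> Q" | "p \<in> Q" "q = ?x" | "p \<in> Q" "q \<in> Q" using pq(1,2) by blast
    then show ?thesis
    proof cases
      case 1
      then show ?thesis using osim_itv_refl by blast
    next
      case 2
      then have "osim_itv \<delta> q0 q" using hi[OF q0(1) _ mq] up[of q] pq(4) by simp
      then show ?thesis using osim_itv_trans[OF xq] 2 by blast
    next
      case 3
      then have "fst p = x" using pq(3,4) by simp
      then show ?thesis using False 3(1) by blast
    next
      case 4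
      then show ?thesis using hi[of p q] pq(3,4) mx(1) by (meson less_imp_le order.trans)
    qed
  qed
  ultimately show ?thesis unfolding osim_map_def by blast
qed

text \<open>Insertion in increasing order keeps level \<delta> from the last inserted point on, so a
  single drop to \<delta>' pays for the whole list. The bound \<open>t\<close> provides a right
  neighbour for every new point.\<close>

lemma osim_map_insert_list:
  assumes "finite Q" "osim_map \<delta>' Q" "\<delta>' < \<delta>"
    and "\<forall>p\<in>Q. \<forall>q\<in>Q. m \<le> fst p \<longrightarrow> fst p \<le> fst q \<longrightarrow> osim_itv \<delta> p q"
    and "m \<in> fst ` Q" "t \<in> fst ` Q" "sorted (m # xs)" "\<forall>x\<in>set xs. x \<le> t"
  shows "\<exists>Q'. finite Q' \<and> Q \<subseteq> Q' \<and> osim_map \<delta>' Q' \<and> set xs \<subseteq> fst ` Q' \<and> fst ` Q' \<subseteq> fst ` Q \<union> set xs"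
  using assms
proof (induction xs arbitrary: Q m)
  case Nil
  then show ?case by auto
next
  case (Cons x xs)
  have "\<exists>x'. osim_map \<delta>' (insert (x, x') Q) \<and>
    (\<forall>p\<in>insert (x, x') Q. \<forall>q\<in>insert (x, x') Q. x \<le> fst p \<longrightarrow> fst p \<le> fst q \<longrightarrow> osim_itv \<delta> p q)"
    by (rule osim_map_insert[of Q \<delta>' \<delta> m x t]) (use Cons.prems in auto)
  then obtain x' where x': "osim_map \<delta>' (insert (x, x') Q)"
    "\<forall>p\<in>insert (x, x') Q. \<forall>q\<in>insert (x, x') Q. x \<le> fst p \<longrightarrow> fst p \<le> fst q \<longrightarrow> osim_itv \<delta> p q" by blast
  have "\<exists>Q'. finite Q' \<and> insert (x, x') Q \<subseteq> Q' \<and> osim_map \<delta>' Q' \<and> set xs \<subseteq> fst ` Q' \<and>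
      fst ` Q' \<subseteq> fst ` insert (x, x') Q \<union> set xs"
    by (rule Cons.IH[of "insert (x, x') Q" x]) (use Cons.prems x' in auto)
  then obtain Q' where Q': "finite Q'" "insert (x, x') Q \<subseteq> Q'" "osim_map \<delta>' Q'" "set xs \<subseteq> fst ` Q'"
    "fst ` Q' \<subseteq> fst ` insert (x, x') Q \<union> set xs" by blast
  have "x \<in> fst ` Q'" using Q'(2) by force
  then show ?case using Q' by (intro exI[of _ Q']) auto
qed

text \<open>Sentinels: the two end points of the blocks are matched in advance, so that each
  inserted point has neighbours on both sides.\<close>

definition sent :: "omega1 \<Rightarrow> omega1 \<Rightarrow> (omega1 multiset \<times> omega1 multiset) set" where
  "sent \<gamma> \<gamma>' = {({#}, {#}), ({#\<gamma>#}, {#\<gamma>'#})}"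

definition loc :: "omega1 \<Rightarrow> omega1 \<Rightarrow> omega1 \<Rightarrow> (omega1 multiset \<times> omega1 multiset) set \<Rightarrow> bool" where
  "loc \<delta> \<gamma> \<gamma>' q \<longleftrightarrow> finite q \<and> q \<subseteq> {..{#\<gamma>#}} \<times> {..{#\<gamma>'#}} \<and> osim_map \<delta> (sent \<gamma> \<gamma>' \<union> q)"

lemma osim_map_mono: "osim_map \<delta> Q \<Longrightarrow> \<delta>' \<le> \<delta> \<Longrightarrow> Q' \<subseteq> Q \<Longrightarrow> osim_map \<delta>' Q'"
  unfolding osim_map_def using osim_itv_mono by blast

lemma loc_mono: "loc \<delta> \<gamma> \<gamma>' q \<Longrightarrow> \<delta>' \<le> \<delta> \<Longrightarrow> loc \<delta>' \<gamma> \<gamma>' q"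
  unfolding loc_def using osim_map_mono by blast

lemma loc_converse:
  assumes "loc \<delta> \<gamma> \<gamma>' q"
  shows "loc \<delta> \<gamma>' \<gamma> (q\<inverse>)"
proof -
  have "(sent \<gamma> \<gamma>' \<union> q)\<inverse> = sent \<gamma>' \<gamma> \<union> q\<inverse>" by (auto simp: sent_def)
  then show ?thesis
    using osim_map_converse[of \<delta> "sent \<gamma> \<gamma>' \<union> q"] assms unfolding loc_def by auto
qed

text \<open>The source of absorption: at level \<delta> two blocks with labels at least \<delta>
  form a legitimate starting position.\<close>

lemma loc_empty:
  assumes "\<gamma> = \<gamma>' \<or> \<delta> \<le> \<gamma> \<and> \<delta> \<le> \<gamma>'"
  shows "loc \<delta> \<gamma> \<gamma>' {}"
proof -
  have "osim_itv \<delta> ({#}, {#}) ({#\<gamma>#}, {#\<gamma>'#})"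
    unfolding osim_itv_def using osim_singleton[OF assms] by (intro exI[of _ "{#\<gamma>#}"] exI[of _ "{#\<gamma>'#}"]) simp
  then show ?thesis
    unfolding loc_def osim_map_def sent_def using osim_itv_refl by auto
qed

text \<open>Within one block the identity preserves interval types and so works at every
  level.\<close>

lemma loc_diag:
  assumes "finite F" "F \<subseteq> {..{#\<gamma>#}}"
  shows "loc \<delta> \<gamma> \<gamma> ((\<lambda>w. (w, w)) ` F)"
proof -
  have "osim_itv \<delta> (u, u) (v, v)" if uv: "u \<le> v" for u v
  proof -
    obtain d where "v = u \<oplus> d" by (rule le_imp_osum[OF uv])
    then show ?thesis unfolding osim_itv_def by (intro exI[of _ d]) simp
  qed
  then have "osim_map \<delta> ((\<lambda>w. (w, w)) ` G)" for G
    unfolding osim_map_def by auto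
  moreover have "sent \<gamma> \<gamma> \<union> (\<lambda>w. (w, w)) ` F = (\<lambda>w. (w, w)) ` ({{#}, {#\<gamma>#}} \<union> F)"
    by (auto simp: sent_def)
  ultimately have "osim_map \<delta> (sent \<gamma> \<gamma> \<union> (\<lambda>w. (w, w)) ` F)" by (simp only:)
  then show ?thesis unfolding loc_def using assms by auto
qed

lemma loc_extend:
  assumes q: "loc \<delta> \<gamma> \<gamma>' q" and lt: "\<delta>' < \<delta>" and F: "finite F" "F \<subseteq> {..{#\<gamma>#}}"
  obtains q' where "q \<subseteq> q'" "loc \<delta>' \<gamma> \<gamma>' q'" "F \<subseteq> fst ` q'"
proof -
  let ?Q = "sent \<gamma> \<gamma>' \<union> q"
  have "\<exists>Q'. finite Q' \<and> ?Q \<subseteq> Q' \<and> osim_map \<delta>' Q' \<and> set (sorted_list_of_set F) \<subseteq> fst ` Q' \<and>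
     fst ` Q' \<subseteq> fst ` ?Q \<union> set (sorted_list_of_set F)"
  proof (rule osim_map_insert_list[where m = "{#}" and t = "{#\<gamma>#}" and \<delta> = \<delta>])
    show "osim_map \<delta>' ?Q" using q lt osim_map_mono[of \<delta> ?Q \<delta>' ?Q] unfolding loc_def by simp
    show "finite ?Q" using q by (auto simp: loc_def sent_def)
    show "\<forall>p\<in>?Q. \<forall>r\<in>?Q. {#} \<le> fst p \<longrightarrow> fst p \<le> fst r \<longrightarrow> osim_itv \<delta> p r"
      using q unfolding loc_def osim_map_def by blast
    show "{#} \<in> fst ` ?Q" "{#\<gamma>#} \<in> fst ` ?Q" by (auto simp: sent_def)
    show "\<forall>x\<in>set (sorted_list_of_set F). x \<le> {#\<gamma>#}" using F by auto
    show "sorted ({#} # sorted_list_of_set F)" by simp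
  qed (rule lt)
  then obtain Q' where Q': "finite Q'" "?Q \<subseteq> Q'" "osim_map \<delta>' Q'" "F \<subseteq> fst ` Q'" "fst ` Q' \<subseteq> fst ` ?Q \<union> F"
    using F(1) by auto
  have "fst ` Q' \<subseteq> {..{#\<gamma>#}}"
    using Q'(5) F(2) q unfolding loc_def by (fastforce simp: sent_def)
  then have le: "fst p \<le> {#\<gamma>#}" if "p \<in> Q'" for p using that by auto
  have top: "({#\<gamma>#}, {#\<gamma>'#}) \<in> Q'" using Q'(2) by (auto simp: sent_def)
  \<comment> \<open>Monotonicity against the matched end points keeps the answers inside the second
    block.\<close>
  have "snd p \<le> {#\<gamma>'#}" if "p \<in> Q'" for p
    using osim_map_le(1)[OF Q'(3) that top] le[OF that] by simp
  then have "Q' \<subseteq> {..{#\<gamma>#}} \<times> {..{#\<gamma>'#}}" using le by auto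
  moreover have "sent \<gamma> \<gamma>' \<union> Q' = Q'" using Q'(2) by blast
  ultimately have "loc \<delta>' \<gamma> \<gamma>' Q'" unfolding loc_def using Q' by auto
  then show ?thesis using that[of Q'] Q' by auto
qed


section \<open>Back-and-forth between sums\<close>

text \<open>Labels may disagree only where level \<delta> cannot distinguish them, as in
  \<open>loc_empty\<close>.\<close>

definition idx_iso :: "omega1 \<Rightarrow> idx set \<Rightarrow> idx set \<Rightarrow> (idx \<Rightarrow> idx) \<Rightarrow> bool" where
  "idx_iso \<delta> I I' f \<longleftrightarrow> bij_betw f I I' \<and> (\<forall>i\<in>I. \<forall>j\<in>I. ilt i j \<longleftrightarrow> ilt (f i) (f j)) \<and>
     (\<forall>i\<in>I. lb i = lb (f i) \<or> \<delta> \<le> lb i \<and> \<delta> \<le> lb (f i))"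

definition fib :: "(elem \<times> elem) set \<Rightarrow> idx \<Rightarrow> idx \<Rightarrow> (omega1 multiset \<times> omega1 multiset) set" where
  "fib p i j = {(w, v). ((i, w), (j, v)) \<in> p}"

text \<open>An isomorphism of the indices reduces the game on sums to independent games on
  corresponding blocks.\<close>

definition bf :: "idx set \<Rightarrow> idx set \<Rightarrow> omega1 \<Rightarrow> (elem \<times> elem) set \<Rightarrow> bool" where
  "bf I I' \<delta> p \<longleftrightarrow> finite p \<and> p \<subseteq> El I \<times> El I' \<and> (\<exists>f. idx_iso \<delta> I I' f \<and>
     (\<forall>a b. (a, b) \<in> p \<longrightarrow> fst b = f (fst a)) \<and> (\<forall>i\<in>I. loc \<delta> (lb i) (lb (f i)) (fib p i (f i))))"

lemma idx_iso_mono: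
  assumes "idx_iso \<delta> I I' f" "\<delta>' \<le> \<delta>"
  shows "idx_iso \<delta>' I I' f"
proof -
  have "\<forall>i\<in>I. lb i = lb (f i) \<or> \<delta>' \<le> lb i \<and> \<delta>' \<le> lb (f i)"
  proof
    fix i assume "i \<in> I"
    then have "lb i = lb (f i) \<or> \<delta> \<le> lb i \<and> \<delta> \<le> lb (f i)" using assms(1) unfolding idx_iso_def by blast
    then show "lb i = lb (f i) \<or> \<delta>' \<le> lb i \<and> \<delta>' \<le> lb (f i)"
      using order.trans[OF assms(2)] by blast
  qed
  then show ?thesis using assms(1) unfolding idx_iso_def by simp
qed

lemma bf_mono:
  assumes "bf I I' \<delta> p" "\<delta>' \<le> \<delta>"
  shows "bf I I' \<delta>' p"
proof -
  obtain f where p: "finite p" "p \<subseteq> El I \<times> El I'" and f: "idx_iso \<delta> I I' f"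
    "\<forall>a b. (a, b) \<in> p \<longrightarrow> fst b = f (fst a)" "\<forall>i\<in>I. loc \<delta> (lb i) (lb (f i)) (fib p i (f i))"
    using assms(1) unfolding bf_def by (elim exE conjE) (rule that)
  have "\<forall>i\<in>I. loc \<delta>' (lb i) (lb (f i)) (fib p i (f i))"
    using loc_mono[OF bspec[OF f(3)] assms(2)] by blast
  then show ?thesis
    unfolding bf_def using p f(2) idx_iso_mono[OF f(1) assms(2)] by (intro conjI exI[of _ f])
qed

lemma idx_iso_inv:
  assumes "idx_iso \<delta> I I' f"
  shows "idx_iso \<delta> I' I (inv_into I f)"
proof -
  have f: "bij_betw f I I'" "\<forall>i\<in>I. \<forall>j\<in>I. ilt i j \<longleftrightarrow> ilt (f i) (f j)"
    "\<forall>i\<in>I. lb i = lb (f i) \<or> \<delta> \<le> lb i \<and> \<delta> \<le> lb (f i)" using assms by (auto simp: idx_iso_def)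
  have g: "inv_into I f j \<in> I" "f (inv_into I f j) = j" if "j \<in> I'" for j
    using f(1) that by (auto simp: bij_betw_def inv_into_into f_inv_into_f)
  show ?thesis
    unfolding idx_iso_def
  proof (intro conjI ballI bij_betw_inv_into[OF f(1)])
    fix i assume i: "i \<in> I'"
    show "lb i = lb (inv_into I f i) \<or> \<delta> \<le> lb i \<and> \<delta> \<le> lb (inv_into I f i)"
      using f(3) g[OF i] by force
    show "ilt i j \<longleftrightarrow> ilt (inv_into I f i) (inv_into I f j)" if j: "j \<in> I'" for j
      using f(2) g[OF i] g[OF j] by simp
  qed
qed

lemma bf_converse:
  assumes "bf I I' \<delta> p"
  shows "bf I' I \<delta> (p\<inverse>)"
proof -
  obtain f where p: "finite p" "p \<subseteq> El I \<times> El I'" and f: "idx_iso \<delta> I I' f"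
    "\<forall>a b. (a, b) \<in> p \<longrightarrow> fst b = f (fst a)" "\<forall>i\<in>I. loc \<delta> (lb i) (lb (f i)) (fib p i (f i))"
    using assms unfolding bf_def by blast
  have b: "bij_betw f I I'" using f(1) by (simp add: idx_iso_def)
  let ?g = "inv_into I f"
  have g: "?g j \<in> I" "f (?g j) = j" if "j \<in> I'" for j
    using b that by (auto simp: bij_betw_def inv_into_into f_inv_into_f)
  have "fst b = ?g (fst a)" if ab: "(a, b) \<in> p\<inverse>" for a b
  proof -
    have "fst a = f (fst b)" using f(2) ab by blast
    moreover have "fst b \<in> I" using p(2) ab by (cases b) auto
    ultimately show ?thesis using b by (simp add: bij_betw_def inv_into_f_f)
  qed
  moreover have "loc \<delta> (lb j) (lb (?g j)) (fib (p\<inverse>) j (?g j))" if j: "j \<in> I'" for j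
  proof -
    have "fib (p\<inverse>) j (?g j) = (fib p (?g j) j)\<inverse>" by (auto simp: fib_def)
    then show ?thesis using loc_converse[OF bspec[OF f(3) g(1)[OF j]]] g(2)[OF j] by simp
  qed
  ultimately show ?thesis
    unfolding bf_def using p idx_iso_inv[OF f(1)] by (intro conjI exI[of _ ?g]) auto
qed

text \<open>The map \<open>f\<close> on indices is kept, as it remains valid at the smaller level.
  Only the finitely many blocks met by \<open>F\<close> receive new points.\<close>

lemma bf_forth:
  assumes "bf I I' \<delta> p" "\<delta>' < \<delta>" "finite F" "F \<subseteq> El I"
  shows "\<exists>q. p \<subseteq> q \<and> bf I I' \<delta>' q \<and> F \<subseteq> fst ` q"
proof -
  obtain f where p: "finite p" "p \<subseteq> El I \<times> El I'" and f: "idx_iso \<delta> I I' f"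
    "\<forall>a b. (a, b) \<in> p \<longrightarrow> fst b = f (fst a)" "\<forall>i\<in>I. loc \<delta> (lb i) (lb (f i)) (fib p i (f i))"
    using assms unfolding bf_def by blast
  have fI: "f i \<in> I'" if "i \<in> I" for i using f(1) that by (auto simp: idx_iso_def bij_betw_def)
  have inj: "i = j" if "i \<in> I" "j \<in> I" "f i = f j" for i j
    using f(1) that by (auto simp: idx_iso_def bij_betw_def inj_on_def)
  have *: "\<exists>q. fib p i (f i) \<subseteq> q \<and> loc \<delta>' (lb i) (lb (f i)) q \<and> {w. (i, w) \<in> F} \<subseteq> fst ` q" if i: "i \<in> I" for i
  proof -
    have "{w. (i, w) \<in> F} \<subseteq> snd ` F" by force
    then have Fi: "finite {w. (i, w) \<in> F}" using finite_subset finite_imageI[OF assms(3)] by blast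
    have Fs: "{w. (i, w) \<in> F} \<subseteq> {..{#lb i#}}" using assms(4) by auto
    show ?thesis
      by (rule loc_extend[OF bspec[OF f(3) i] assms(2) Fi Fs]) blast
  qed
  have "\<exists>g. \<forall>i\<in>I. fib p i (f i) \<subseteq> g i \<and> loc \<delta>' (lb i) (lb (f i)) (g i) \<and> {w. (i, w) \<in> F} \<subseteq> fst ` g i"
    by (rule bchoice) (rule ballI, rule *)
  then obtain g where gg: "\<forall>i\<in>I. fib p i (f i) \<subseteq> g i \<and> loc \<delta>' (lb i) (lb (f i)) (g i) \<and> {w. (i, w) \<in> F} \<subseteq> fst ` g i"
    by (elim exE)
  then have g: "\<And>i. i \<in> I \<Longrightarrow> fib p i (f i) \<subseteq> g i" "\<And>i. i \<in> I \<Longrightarrow> loc \<delta>' (lb i) (lb (f i)) (g i)"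
    "\<And>i. i \<in> I \<Longrightarrow> {w. (i, w) \<in> F} \<subseteq> fst ` g i" by simp_all
  define new where "new = (\<Union>i\<in>fst ` F. (\<lambda>x. ((i, fst x), (f i, snd x))) ` g i)"
  have FI: "i \<in> I" if "i \<in> fst ` F" for i using that assms(4) by auto
  have fin: "finite new" unfolding new_def using assms(3) g(2) FI by (auto simp: loc_def)
  have new: "((i, w), (j, v)) \<in> new \<longleftrightarrow> i \<in> fst ` F \<and> j = f i \<and> (w, v) \<in> g i" for i w j v
    unfolding new_def by force
  have sub: "new \<subseteq> El I \<times> El I'"
  proof
    fix x assume x: "x \<in> new"
    obtain i w j v where y: "x = ((i, w), (j, v))" by (metis surj_pair)
    then have i: "i \<in> I" "j = f i" "(w, v) \<in> g i" using x new FI by auto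
    then have "w \<le> {#lb i#}" "v \<le> {#lb j#}" using g(2)[OF i(1)] unfolding loc_def by auto
    then show "x \<in> El I \<times> El I'" using i fI y by simp
  qed
  have fib: "fib (p \<union> new) i (f i) = (if i \<in> fst ` F then g i else fib p i (f i))" if i: "i \<in> I" for i
    using g(1)[OF i] new unfolding fib_def by auto
  have "bf I I' \<delta>' (p \<union> new)"
    unfolding bf_def
  proof (intro conjI exI[of _ f] allI impI ballI)
    show "finite (p \<union> new)" "p \<union> new \<subseteq> El I \<times> El I'" using p fin sub by auto
    show "idx_iso \<delta>' I I' f" by (rule idx_iso_mono[OF f(1) less_imp_le[OF assms(2)]])
    show "fst b = f (fst a)" if "(a, b) \<in> p \<union> new" for a b
      using that f(2)[rule_format, of a b] new[of "fst a" "snd a" "fst b" "snd b"] by auto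
    show "loc \<delta>' (lb i) (lb (f i)) (fib (p \<union> new) i (f i))" if i: "i \<in> I" for i
      unfolding fib[OF i] using g(2)[OF i] loc_mono[OF bspec[OF f(3) i]] assms(2) by simp
  qed
  moreover have "F \<subseteq> fst ` (p \<union> new)"
  proof
    fix x assume x: "x \<in> F"
    obtain i w where iw: "x = (i, w)" by (cases x)
    then have i1: "i \<in> fst ` F" using x by force
    have i: "i \<in> fst ` F" "i \<in> I" using i1 FI[OF i1] by blast+
    then obtain v where "(w, v) \<in> g i" using g(3)[OF i(2)] x iw by force
    then have "((i, w), (f i, v)) \<in> new" using new i by blast
    then show "x \<in> fst ` (p \<union> new)" using iw by force
  qed
  ultimately show ?thesis by blast
qed

lemma bf_backw:
  assumes "bf I I' \<delta> p" "\<delta>' < \<delta>" "finite F" "F \<subseteq> El I'"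
  shows "\<exists>q. p \<subseteq> q \<and> bf I I' \<delta>' q \<and> F \<subseteq> snd ` q"
proof -
  obtain q where q: "p\<inverse> \<subseteq> q" "bf I' I \<delta>' q" "F \<subseteq> fst ` q"
    using bf_forth[OF bf_converse[OF assms(1)] assms(2-4)] by blast
  have "bf I I' \<delta>' (q\<inverse>)" by (rule bf_converse[OF q(2)])
  moreover have "F \<subseteq> snd ` (q\<inverse>)" using q(3) by force
  moreover have "p \<subseteq> q\<inverse>" using q(1) by auto
  ultimately show ?thesis by blast
qed

lemma bf_atomic:
  assumes "bf I I' \<delta> p" "(a, b) \<in> p" "(a', b') \<in> p"
  shows "(a = a' \<longleftrightarrow> b = b') \<and> ((a, a') \<in> ER I \<longleftrightarrow> (b, b') \<in> ER I')"
proof -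
  obtain f where p: "p \<subseteq> El I \<times> El I'" and f: "idx_iso \<delta> I I' f"
    "\<forall>a b. (a, b) \<in> p \<longrightarrow> fst b = f (fst a)" "\<forall>i\<in>I. loc \<delta> (lb i) (lb (f i)) (fib p i (f i))"
    using assms(1) unfolding bf_def by blast
  obtain i w where a: "a = (i, w)" by (cases a)
  obtain i' w' where a': "a' = (i', w')" by (cases a')
  have "fst b = f i" "fst b' = f i'" using f(2) assms(2,3) a a' by (metis fst_conv)+
  then obtain v v' where b: "b = (f i, v)" and b': "b' = (f i', v')" by (metis prod.collapse)
  have El: "a \<in> El I" "b \<in> El I'" "a' \<in> El I" "b' \<in> El I'" using p assms(2,3) by auto
  then have i: "i \<in> I" "i' \<in> I" using a a' by auto
  show ?thesis
  proof (cases "i = i'")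
    case True
    let ?Q = "sent (lb i) (lb (f i)) \<union> fib p i (f i)"
    have Q: "(w, v) \<in> ?Q" "(w', v') \<in> ?Q" using assms(2,3) a a' b b' True by (auto simp: fib_def)
    have "osim_map \<delta> ?Q" using f(3) i unfolding loc_def by blast
    from osim_map_le[OF this Q] have "w \<le> w' \<longleftrightarrow> v \<le> v'" "w = w' \<longleftrightarrow> v = v'" by auto
    then show ?thesis using El True unfolding a a' b b' le_ER by auto
  next
    case False
    then have "f i \<noteq> f i'" "ilt i i' \<longleftrightarrow> ilt (f i) (f i')"
      using f(1) i by (auto simp: idx_iso_def bij_betw_def inj_on_def)
    then show ?thesis using El False unfolding a a' b b' le_ER by auto
  qed
qed

section \<open>Embeddings of the cut order into the uncut one\<close>

context limit_orders
begin

text \<open>Integer steps suffice: they preserve each set \<open>X \<gamma>\<close> and are cofinal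
  in the reals. Summands with keys below \<open>l\<close> stay fixed.\<close>

definition shift :: "int \<Rightarrow> idx \<Rightarrow> idx" where
  "shift k i = (if fst i = l then (l, pos i + of_int k, lb i) else i)"

lemma shift_simps [simp]: "fst (shift k i) = fst i" "lb (shift k i) = lb i"
  by (auto simp: shift_def)

lemma shift_ilt [simp]: "ilt (shift k i) (shift k j) \<longleftrightarrow> ilt i j"
  by (auto simp: shift_def ilt_def)

lemma shift_shift: "shift k (shift (- k) i) = i" "shift (- k) (shift k i) = i"
  by (cases i, auto simp: shift_def)+

lemma shift_IB [simp]: "shift k i \<in> IB \<longleftrightarrow> i \<in> IB"
proof -
  have *: "shift k i \<in> IB" if "i \<in> IB" for k i
    using that X_shift by (auto simp: IB_def shift_def)
  show ?thesis using *[of i k] *[of "shift k i" "- k"] shift_shift(2) by metis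
qed

abbreviation ile :: "idx rel" where "ile \<equiv> {(i, j). ilt i j \<or> i = j}"

lemma lin_idx: "I \<subseteq> IB \<Longrightarrow> lin I ile"
proof -
  have "lin IB ile"
    unfolding lin_def
  proof (intro ballI conjI impI)
    fix i j k assume "i \<in> IB" "j \<in> IB"
    then show "(i, j) \<in> ile \<or> (j, i) \<in> ile" using ilt_total[of i j] by auto
    show "i = j" if "(i, j) \<in> ile \<and> (j, i) \<in> ile" using that ilt_trans[of i j i] by auto
    show "(i, k) \<in> ile" if "(i, j) \<in> ile \<and> (j, k) \<in> ile" using that ilt_trans[of i j k] by auto
  qed auto
  then show "I \<subseteq> IB \<Longrightarrow> lin I ile" by (rule lin_subset)
qed

text \<open>The region in which the two orders are matched non-canonically. With \<open>b\<close>
  true it contains the piece of the left summand after position \<open>c\<close>, which the cut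
  order omits.\<close>

definition middle :: "omega1 \<Rightarrow> bool \<Rightarrow> real \<Rightarrow> idx set" where
  "middle \<beta> b c = {i \<in> IB. fst i = l \<and> b \<and> c < pos i \<or> \<beta> \<le> fst i \<and> fst i < l}"

text \<open>Every summand here contains all labels up to \<delta> densely, and larger ones are
  truncated to \<delta>. A sum of such shuffles is again one, whether or not the piece of the left
  summand is present.\<close>

lemma middle_dense:
  assumes "\<delta> \<le> \<beta>" "\<beta> < l"
  shows "labelled_dense (middle \<beta> b c) ile (\<lambda>i. min (lb i) \<delta>) {..\<delta>}"
proof -
  have dl: "\<delta> < l" using assms by simp
  have mem: "(fst i, y, \<gamma>) \<in> middle \<beta> b c"
    if "i \<in> middle \<beta> b c" "\<gamma> \<le> \<delta>" "y \<in> X \<gamma>" "fst i = l \<Longrightarrow> c < y" for i y \<gamma>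
  proof -
    have "\<beta> \<le> fst i" using that(1) assms(2) by (auto simp: middle_def)
    then have "\<gamma> \<le> fst i" using that(2) assms(1) by simp
    moreover have "\<gamma> < l" using that(2) dl by simp
    ultimately show ?thesis using that by (auto simp: middle_def IB_def)
  qed
  have slt: "slt ile i j \<longleftrightarrow> ilt i j" for i j by auto
  have "(\<exists>z\<in>middle \<beta> b c. min (lb z) \<delta> = \<gamma>) \<and>
     (\<forall>x\<in>middle \<beta> b c. (\<exists>z\<in>middle \<beta> b c. min (lb z) \<delta> = \<gamma> \<and> ilt z x) \<and> (\<exists>z\<in>middle \<beta> b c. min (lb z) \<delta> = \<gamma> \<and> ilt x z)) \<and>
     (\<forall>x\<in>middle \<beta> b c. \<forall>y\<in>middle \<beta> b c. ilt x y \<longrightarrow> (\<exists>z\<in>middle \<beta> b c. min (lb z) \<delta> = \<gamma> \<and> ilt x z \<and> ilt z y))"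
    if g: "\<gamma> \<le> \<delta>" for \<gamma>
  proof (intro conjI ballI impI)
    have mn: "min \<gamma> \<delta> = \<gamma>" using g by simp
    obtain y where "y \<in> X \<gamma>" using X_dense[of 0 1 \<gamma>] by auto
    then have "(\<beta>, y, \<gamma>) \<in> middle \<beta> b c" using assms g dl by (auto simp: middle_def IB_def)
    then show "\<exists>z\<in>middle \<beta> b c. min (lb z) \<delta> = \<gamma>" using mn by force
    show dn: "\<exists>z\<in>middle \<beta> b c. min (lb z) \<delta> = \<gamma> \<and> ilt z x" if x: "x \<in> middle \<beta> b c" for x
    proof -
      \<comment> \<open>A lower bound for the new position: the border \<open>c\<close> within the
        left summand, otherwise anything smaller than \<open>pos x\<close>.\<close>
      define a where "a = (if fst x = l then c else pos x - 1)"
      have "a < pos x" using x by (auto simp: a_def middle_def)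
      then obtain y where y: "y \<in> X \<gamma>" "a < y" "y < pos x" using X_dense by blast
      have "(fst x, y, \<gamma>) \<in> middle \<beta> b c" by (rule mem[OF x g y(1)]) (use y(2) in \<open>simp add: a_def\<close>)
      then show ?thesis by (rule bexI[rotated]) (use y mn in \<open>simp add: ilt_def\<close>)
    qed
    show "\<exists>z\<in>middle \<beta> b c. min (lb z) \<delta> = \<gamma> \<and> ilt x z" if x: "x \<in> middle \<beta> b c" for x
    proof -
      obtain y where y: "y \<in> X \<gamma>" "pos x < y" using X_dense[of "pos x" "pos x + 1" \<gamma>] by auto
      have "(fst x, y, \<gamma>) \<in> middle \<beta> b c" by (rule mem[OF x g y(1)]) (use x y(2) in \<open>auto simp: middle_def\<close>)
      then show ?thesis by (rule bexI[rotated]) (use y mn in \<open>simp add: ilt_def\<close>)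
    qed
    show "\<exists>z\<in>middle \<beta> b c. min (lb z) \<delta> = \<gamma> \<and> ilt x z \<and> ilt z w"
      if xw: "x \<in> middle \<beta> b c" "w \<in> middle \<beta> b c" "ilt x w" for x w
    proof -
      define a where "a = (if fst x = fst w then pos x else pos w - 1)"
      have "a < pos w" using xw(3) by (auto simp: a_def ilt_def)
      then obtain y where y: "y \<in> X \<gamma>" "a < y" "y < pos w" using X_dense by blast
      have le: "fst w \<le> fst x" using xw(3) by (auto simp: ilt_def)
      have "c < y" if "fst w = l"
      proof -
        have "fst x = l" using le that xw(1) by (auto simp: middle_def IB_def)
        then show ?thesis using xw(1) y(2) that by (auto simp: middle_def a_def)
      qed
      then have "(fst w, y, \<gamma>) \<in> middle \<beta> b c" by (rule mem[OF xw(2) g y(1)])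
      moreover have "ilt x (fst w, y, \<gamma>)" using le y(2) by (auto simp: ilt_def a_def split: if_splits)
      moreover have "ilt (fst w, y, \<gamma>) w" using y(3) by (simp add: ilt_def)
      ultimately show ?thesis using mn by (intro bexI[of _ "(fst w, y, \<gamma>)"]) auto
    qed
  qed
  then show ?thesis unfolding labelled_dense_def slt by auto
qed

text \<open>The left summand up to the cut is shifted, summands with keys below \<beta> are fixed,
  and the region between is matched by Cantor's theorem for labels truncated at \<delta>; the
  omitted piece disappears there.\<close>

lemma ex_idx_iso:
  assumes d: "\<delta> < l" and G: "finite G" "G \<subseteq> IA"
  shows "\<exists>f. idx_iso \<delta> IA IB f \<and> (\<forall>i\<in>G. f i = shift k i)"
proof -
  \<comment> \<open>\<beta> is at least \<delta>, so the middle summands have all labels up to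
    \<delta>, and beyond the keys below \<open>l\<close> of \<open>G\<close>, so \<open>G\<close>
    avoids the region that is matched non-canonically.\<close>
  define \<beta> where "\<beta> = Max (insert \<delta> ((\<lambda>i. succ_ord (fst i)) ` {i \<in> G. fst i < l}))"
  have fin: "finite (insert \<delta> ((\<lambda>i. succ_ord (fst i)) ` {i \<in> G. fst i < l}))" using G(1) by simp
  have "\<beta> \<in> insert \<delta> ((\<lambda>i. succ_ord (fst i)) ` {i \<in> G. fst i < l})"
    unfolding \<beta>_def by (rule Max_in[OF fin]) simp
  then have bl: "\<beta> < l" using d limit_ord_succ[OF lim] by auto
  have db: "\<delta> \<le> \<beta>" unfolding \<beta>_def by (rule Max_ge[OF fin]) simp
  have Gb: "fst i < \<beta>" if "i \<in> G" "fst i < l" for i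
  proof -
    have "succ_ord (fst i) \<le> \<beta>" unfolding \<beta>_def by (rule Max_ge[OF fin]) (use that in auto)
    then show ?thesis by (simp add: succ_ord_le_iff)
  qed
  \<comment> \<open>The position to which the shift moves the cut.\<close>
  define c where "c = pos iD + of_int k"
  let ?MA = "middle \<beta> False c" and ?MB = "middle \<beta> True c"
  let ?LA = "{i \<in> IB. fst i = l \<and> pos i \<le> pos iD}" and ?LB = "{i \<in> IB. fst i = l \<and> pos i \<le> c}"
  let ?R = "{i \<in> IB. fst i < \<beta>}"
  have M: "?MA \<subseteq> IB" "?MB \<subseteq> IB" by (auto simp: middle_def)
  obtain g where g: "bij_betw g ?MA ?MB" "\<And>x y. x \<in> ?MA \<Longrightarrow> y \<in> ?MA \<Longrightarrow> (x, y) \<in> ile \<longleftrightarrow> (g x, g y) \<in> ile"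
    "\<And>x. x \<in> ?MA \<Longrightarrow> min (lb (g x)) \<delta> = min (lb x) \<delta>"
    by (rule labelled_cantor[OF lin_idx[OF M(1)] countable_subset[OF M(1) countable_IB] middle_dense[OF db bl]
        lin_idx[OF M(2)] countable_subset[OF M(2) countable_IB] middle_dense[OF db bl]]) (rule that)
  define f where "f i = (if fst i = l then shift k i else if \<beta> \<le> fst i then g i else i)" for i
  have fL: "f i = shift k i" if "fst i = l" for i using that by (simp add: f_def)
  have fM: "f i = g i" if "i \<in> ?MA" for i using that by (auto simp: f_def middle_def)
  have fR: "f i = i" if "i \<in> ?R" for i using that bl by (auto simp: f_def)
  have b1: "bij_betw f ?LA ?LB"
  proof (rule bij_betw_byWitness[where f' = "shift (- k)"])
    show "\<forall>a\<in>?LA. shift (- k) (f a) = a" using fL shift_shift(2) by auto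
    show "\<forall>a\<in>?LB. f (shift (- k) a) = a" using fL shift_shift(1) by auto
    have "pos (shift k i) = pos i + of_int k" if "fst i = l" for k i using that by (simp add: shift_def)
    then show "f ` ?LA \<subseteq> ?LB" "shift (- k) ` ?LB \<subseteq> ?LA" using fL by (auto simp: c_def)
  qed
  have b2: "bij_betw f ?MA ?MB" using g(1) bij_betw_cong[of ?MA f g ?MB] fM by blast
  have b3: "bij_betw f ?R ?R" using bij_betw_cong[of ?R f id ?R] fR by auto
  have bij: "bij_betw f (?LA \<union> ?MA \<union> ?R) (?LB \<union> ?MB \<union> ?R)"
    by (intro bij_betw_combine b1 b2 b3) (use bl in \<open>auto simp: middle_def\<close>)
  have IA: "IA = ?LA \<union> ?MA \<union> ?R" using bl by (auto simp: IA_def IB_def middle_def)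
  have IB: "IB = ?LB \<union> ?MB \<union> ?R" using bl by (auto simp: IB_def middle_def)
  have "bij_betw f IA IB" using bij unfolding IA[symmetric] IB[symmetric] .
  have fB: "f i \<in> ?LB" if "i \<in> ?LA" for i using b1 that by (auto simp: bij_betw_def)
  have gB: "g i \<in> ?MB" if "i \<in> ?MA" for i using g(1) that by (auto simp: bij_betw_def)
  have lt: "ilt (f i) (f j)" if ij: "i \<in> IA" "j \<in> IA" "ilt i j" for i j
  proof -
    have jf: "fst j \<le> fst i" using ij(3) by (auto simp: ilt_def)
    consider "i \<in> ?LA" | "i \<in> ?MA" | "i \<in> ?R" using ij(1) IA by blast
    then show ?thesis
    proof cases
      case 1
      consider "j \<in> ?LA" | "j \<in> ?MA" | "j \<in> ?R" using ij(2) IA by blast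
      then show ?thesis
      proof cases
        case 1
        then show ?thesis using \<open>i \<in> ?LA\<close> fL ij(3) by simp
      next
        case 2
        then show ?thesis using fB[OF \<open>i \<in> ?LA\<close>] gB[OF 2] fM[OF 2] by (auto simp: middle_def ilt_def)
      next
        case 3
        then show ?thesis using fB[OF \<open>i \<in> ?LA\<close>] fR[OF 3] bl by (auto simp: ilt_def)
      qed
    next
      case 2
      then have "fst i < l" by (auto simp: middle_def)
      then have "j \<notin> ?LA" using jf by auto
      then consider "j \<in> ?MA" | "j \<in> ?R" using ij(2) IA by blast
      then show ?thesis
      proof cases
        case 1
        then show ?thesis using g(2)[OF 2 1] g(1) ij(3) fM[OF 1] fM[OF 2] 1 2 by (auto simp: bij_betw_def inj_on_def)
      next
        case r: 2
        then show ?thesis using gB[OF 2] fM[OF 2] fR[OF r] bl by (auto simp: middle_def ilt_def)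
      qed
    next
      case 3
      then have "j \<in> ?R" using jf ij(2) IA_subset by auto
      then show ?thesis using fR 3 ij(3) by simp
    qed
  qed
  have "ilt i j \<longleftrightarrow> ilt (f i) (f j)" if ij: "i \<in> IA" "j \<in> IA" for i j
    using lt[OF ij] lt[OF ij(2,1)] ilt_total[of i j] ij IA_subset ilt_trans[of "f i" "f j" "f i"] by auto
  moreover have "lb i = lb (f i) \<or> \<delta> \<le> lb i \<and> \<delta> \<le> lb (f i)" if i: "i \<in> IA" for i
  proof -
    consider "i \<in> ?LA" | "i \<in> ?MA" | "i \<in> ?R" using i IA by blast
    then show ?thesis
    proof cases
      case 2
      then show ?thesis using g(3)[OF 2] fM[OF 2] by (auto simp: min_def split: if_splits)
    qed (use fL fR in auto)
  qed
  moreover have "f i = shift k i" if i: "i \<in> G" for i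
  proof (cases "fst i = l")
    case True
    then show ?thesis by (rule fL)
  next
    case False
    then have "fst i < l" using i G(2) by (auto simp: IA_def IB_def)
    then have "i \<in> ?R" using Gb i G(2) IA_subset by blast
    then show ?thesis using fR False by (simp add: shift_def)
  qed
  ultimately show ?thesis using \<open>bij_betw f IA IB\<close> unfolding idx_iso_def by blast
qed

definition emb :: "int \<Rightarrow> elem \<Rightarrow> elem" where
  "emb k a = (shift k (fst a), snd a)"

text \<open>The isomorphism of indices depends on \<delta> and \<open>F\<close>, yet on
  \<open>F\<close> it is always given by \<open>emb k\<close>. One finite map thus serves all
  \<delta> below \<open>l\<close>, which is what level \<open>l\<close> of the system
  demands.\<close>

lemma emb_bf:
  assumes d: "\<delta> < l" and F: "finite F" "F \<subseteq> El IA"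
  shows "bf IA IB \<delta> ((\<lambda>a. (a, emb k a)) ` F)"
proof -
  have "finite (fst ` F)" "fst ` F \<subseteq> IA" using F by (auto simp: El_def)
  then obtain f where f: "idx_iso \<delta> IA IB f" "\<forall>i\<in>fst ` F. f i = shift k i" using ex_idx_iso[OF d] by blast
  let ?p = "(\<lambda>a. (a, emb k a)) ` F"
  have "loc \<delta> (lb i) (lb (f i)) (fib ?p i (f i))" if i: "i \<in> IA" for i
  proof (cases "i \<in> fst ` F")
    case True
    then have fi: "f i = shift k i" using f by blast
    have "fib ?p i (f i) = (\<lambda>w. (w, w)) ` {w. (i, w) \<in> F}"
      unfolding fi by (force simp: fib_def emb_def)
    moreover have "{w. (i, w) \<in> F} \<subseteq> snd ` F" by force
    then have "finite {w. (i, w) \<in> F}" using finite_subset finite_imageI[OF F(1)] by blast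
    moreover have "{w. (i, w) \<in> F} \<subseteq> {..{#lb i#}}" using F(2) by auto
    ultimately show ?thesis using loc_diag fi by simp
  next
    case False
    then have "fib ?p i (f i) = {}" by (force simp: fib_def)
    moreover have "lb i = lb (f i) \<or> \<delta> \<le> lb i \<and> \<delta> \<le> lb (f i)" using f(1) i unfolding idx_iso_def by blast
    ultimately show ?thesis using loc_empty by simp
  qed
  moreover have "?p \<subseteq> El IA \<times> El IB"
    using F(2) IA_subset by (auto simp: emb_def El_def)
  moreover have "\<forall>a b. (a, b) \<in> ?p \<longrightarrow> fst b = f (fst a)" using f(2) by (auto simp: emb_def)
  ultimately show ?thesis unfolding bf_def using F(1) f(1) by (intro conjI exI[of _ f]) auto
qed

text \<open>Finitely many elements have bounded positions, and the cut can be shifted beyond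
  them.\<close>

lemma emb_onto_finite:
  assumes "finite F" "F \<subseteq> El IB"
  shows "\<exists>k. F \<subseteq> emb k ` El IA"
proof -
  have "finite ((\<lambda>a. pos (fst a)) ` F)" using assms(1) by simp
  then obtain M where M: "\<And>a. a \<in> F \<Longrightarrow> pos (fst a) \<le> M"
    by (metis (no_types, lifting) Max_ge image_eqI)
  \<comment> \<open>The least integer by which the cut \<open>pos iD\<close> reaches the bound
    \<open>M\<close>.\<close>
  define k where "k = \<lceil>M - pos iD\<rceil>"
  have k: "M - of_int k \<le> pos iD" unfolding k_def by linarith
  have "a \<in> emb k ` El IA" if a: "a \<in> F" for a
  proof (rule image_eqI)
    show "a = emb k (shift (- k) (fst a), snd a)" by (simp add: emb_def shift_shift(1))
    have "fst a \<in> IB" "snd a \<le> {#lb (fst a)#}" using a assms(2) by (auto simp: El_def)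
    moreover have "pos (shift (- k) (fst a)) \<le> pos iD" if "fst (fst a) = l"
      using M[OF a] k that by (simp add: shift_def)
    ultimately show "(shift (- k) (fst a), snd a) \<in> El IA" by (simp add: IA_def)
  qed
  then show ?thesis by blast
qed

text \<open>Below \<open>l\<close> this is \<open>bf\<close> at level \<alpha>, by monotonicity. At
  \<open>l\<close> it asks for all smaller levels at once, since \<open>ex_idx_iso\<close> supplies
  isomorphisms of indices below \<open>l\<close> only.\<close>

definition lim_bf :: "omega1 \<Rightarrow> (elem \<times> elem) set \<Rightarrow> bool" where
  "lim_bf \<alpha> p \<longleftrightarrow> (\<forall>\<delta><l. \<delta> \<le> \<alpha> \<longrightarrow> bf IA IB \<delta> p)"

lemma lim_bf_zero: "lim_bf \<alpha> p \<Longrightarrow> bf IA IB 0 p"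
  unfolding lim_bf_def using l_pos by simp

lemma lim_bf_step:
  assumes "lim_bf \<alpha> p" "\<alpha> \<le> l" "\<beta> < \<alpha>"
  obtains \<delta> where "\<beta> < \<delta>" "bf IA IB \<delta> p"
proof (cases "\<alpha> = l")
  case True
  \<comment> \<open>At the limit there is room for a level strictly between \<beta> and
    \<open>l\<close>.\<close>
  then have "\<beta> < l" "succ_ord \<beta> < l" using assms(3) limit_ord_succ[OF lim] by auto
  then show ?thesis using assms(1) that[of "succ_ord \<beta>"] True unfolding lim_bf_def by simp
next
  case False
  then show ?thesis using assms that[of \<alpha>] unfolding lim_bf_def by simp
qed

lemma lim_bfI: "bf IA IB \<beta> q \<Longrightarrow> lim_bf \<beta> q"
  unfolding lim_bf_def using bf_mono by blast

sublocale back_forth_system "El IA" "ER IA" "El IB" "ER IB" lim_bf l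
proof
  show "p \<subseteq> El IA \<times> El IB" if "lim_bf \<alpha> p" for \<alpha> p
    using lim_bf_zero[OF that] unfolding bf_def by blast
  show "(a = a' \<longleftrightarrow> b = b') \<and> ((a, a') \<in> ER IA \<longleftrightarrow> (b, b') \<in> ER IB)"
    if h: "lim_bf \<alpha> p" "(a, b) \<in> p" "(a', b') \<in> p" for \<alpha> p a b a' b'
    by (rule bf_atomic[OF lim_bf_zero[OF h(1)] h(2,3)])
  show "\<exists>q. p \<subseteq> q \<and> lim_bf \<beta> q \<and> F \<subseteq> fst ` q"
    if h: "lim_bf \<alpha> p" "\<alpha> \<le> l" "\<beta> < \<alpha>" "finite F" "F \<subseteq> El IA" for \<alpha> p \<beta> F
  proof -
    obtain \<delta> where d: "\<beta> < \<delta>" "bf IA IB \<delta> p" by (rule lim_bf_step[OF h(1-3)])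
    show ?thesis using bf_forth[OF d(2,1) h(4,5)] lim_bfI by blast
  qed
  show "\<exists>q. p \<subseteq> q \<and> lim_bf \<beta> q \<and> G \<subseteq> snd ` q"
    if h: "lim_bf \<alpha> p" "\<alpha> \<le> l" "\<beta> < \<alpha>" "finite G" "G \<subseteq> El IB" for \<alpha> p \<beta> G
  proof -
    obtain \<delta> where d: "\<beta> < \<delta>" "bf IA IB \<delta> p" by (rule lim_bf_step[OF h(1-3)])
    show ?thesis using bf_backw[OF d(2,1) h(4,5)] lim_bfI by blast
  qed
qed

lemma emb_lim_bf: "finite F \<Longrightarrow> F \<subseteq> El IA \<Longrightarrow> lim_bf \<alpha> ((\<lambda>a. (a, emb k a)) ` F)"
  unfolding lim_bf_def using emb_bf by blast

text \<open>Every tuple of the larger order is the image of a tuple of the smaller one under some shift,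
  and shifts preserve the formulas of complexity at most \<open>l\<close>.\<close>

lemma Pi_transfer:
  assumes \<phi>: "Pi_in (succ_ord (succ_ord l)) \<phi>" "sentence \<phi>" and mA: "models (El IA) (ER IA) \<phi>"
  shows "models (El IB) (ER IB) \<phi>"
proof -
  have pos: "0 < succ_ord (succ_ord l)" using less_succ_ord_iff omega1_zero_le by blast
  obtain \<beta> \<Phi> xs where \<Phi>: "\<phi> = Conj (\<lambda>i. Alls (xs i) (\<Phi> i))" "\<And>i. \<beta> i < succ_ord (succ_ord l)"
    "\<And>i. Sigma_in (\<beta> i) (\<Phi> i)"
    by (rule Pi_posE[OF \<phi>(1) pos]) (rule that)
  have fvs: "fv (\<Phi> i) \<subseteq> set (xs i)" for i
    using \<phi>(2) unfolding sentence_def \<Phi>(1) by auto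
  have "sat (El IB) (ER IB) (\<Phi> i) e'" if e': "\<forall>v\<in>set (xs i). e' v \<in> El IB" for i e'
  proof -
    \<comment> \<open>The tuple chosen for the universal block decides how far the cut is shifted,
      so that the tuple can be pulled back.\<close>
    obtain k where k: "e' ` set (xs i) \<subseteq> emb k ` El IA"
      using emb_onto_finite[of "e' ` set (xs i)"] e' by auto
    have "\<forall>v\<in>set (xs i). \<exists>a. a \<in> El IA \<and> e' v = emb k a" using k by blast
    from bchoice[OF this] obtain h where h: "\<forall>v\<in>set (xs i). h v \<in> El IA \<and> e' v = emb k (h v)" by blast
    \<comment> \<open>Outside the block the value \<open>(iD, {#})\<close> keeps the assignment
      inside the domain, as \<open>models\<close> requires.\<close>
    define e where "e v = (if v \<in> set (xs i) then h v else (iD, {#}))" for v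
    have eA: "e v \<in> El IA" for v using h iD by (simp add: e_def)
    have ee: "e' v = emb k (e v)" if "v \<in> fv (\<Phi> i)" for v using that fvs h by (auto simp: e_def)
    have "sat (El IA) (ER IA) \<phi> e" using mA eA unfolding models_def by blast
    then have "sat (El IA) (ER IA) (Alls (xs i) (\<Phi> i)) e" unfolding \<Phi>(1) by simp
    then have sA: "sat (El IA) (ER IA) (\<Phi> i) e" unfolding sat_Alls using eA by blast
    let ?F = "e ` set (xs i)"
    have F: "finite ?F" "?F \<subseteq> El IA" using eA by auto
    show ?thesis
    proof (cases "\<beta> i = 0")
      case True
      then have "finitary_qf (\<Phi> i)" using Sigma_in_zero \<Phi>(3)[of i] by simp
      have "(e v, e' v) \<in> (\<lambda>a. (a, emb k a)) ` ?F" if v: "v \<in> fv (\<Phi> i)" for v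
        using ee[OF v] fvs v by auto
      then show ?thesis
        using qf_agree[OF emb_lim_bf[OF F, of l k] order_refl \<open>finitary_qf (\<Phi> i)\<close>, of e e'] sA by blast
    next
      case False
      then have "0 < \<beta> i" using omega1_zero_le[of "\<beta> i"] by (simp add: order_less_le)
      \<comment> \<open>The matrix is a disjunction of existential blocks over \<Pi> formulas of
        level at most \<open>l\<close>: witnesses found in the cut order are pushed forward by the
        same \<open>emb k\<close>.\<close>
      obtain \<gamma> \<Psi> ys where \<Psi>: "\<Phi> i = Disj (\<lambda>j. Exs (ys j) (\<Psi> j))" "\<And>j. \<gamma> j < \<beta> i" "\<And>j. Pi_in (\<gamma> j) (\<Psi> j)"
        by (rule Sigma_posE[OF \<Phi>(3) \<open>0 < \<beta> i\<close>]) (rule that)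
      obtain j where "sat (El IA) (ER IA) (Exs (ys j) (\<Psi> j)) e" using sA unfolding \<Psi>(1) by auto
      then obtain e1 where e1: "\<forall>v. v \<notin> set (ys j) \<longrightarrow> e1 v = e v" "\<forall>v\<in>set (ys j). e1 v \<in> El IA"
        "sat (El IA) (ER IA) (\<Psi> j) e1"
        unfolding sat_Exs by (elim exE conjE) (rule that)
      define e2 where "e2 v = (if v \<in> set (ys j) then emb k (e1 v) else e' v)" for v
      have "\<beta> i \<le> succ_ord l" using \<Phi>(2)[of i] by (simp add: less_succ_ord_iff)
      with \<Psi>(2)[of j] have "\<gamma> j < succ_ord l" by (rule order.strict_trans2)
      then have gl: "\<gamma> j \<le> l" by (simp add: less_succ_ord_iff)
      have fvj: "fv (\<Psi> j) - set (ys j) \<subseteq> fv (\<Phi> i)" unfolding \<Psi>(1) by auto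
      let ?F1 = "?F \<union> e1 ` set (ys j)"
      have F1: "finite ?F1" "?F1 \<subseteq> El IA" using F e1(2) by auto
      have "sat (El IA) (ER IA) (\<Psi> j) e1 \<longleftrightarrow> sat (El IB) (ER IB) (\<Psi> j) e2"
      proof (rule agree(2)[OF \<Psi>(3) emb_lim_bf[OF F1, of "\<gamma> j" k] gl])
        fix v assume v: "v \<in> fv (\<Psi> j)"
        show "(e1 v, e2 v) \<in> (\<lambda>a. (a, emb k a)) ` ?F1"
        proof (cases "v \<in> set (ys j)")
          case True
          then show ?thesis by (simp add: e2_def)
        next
          case False
          then have "v \<in> fv (\<Phi> i)" using v fvj by blast
          then have "v \<in> set (xs i)" "e' v = emb k (e v)" using fvs ee by auto
          then show ?thesis using False e1(1) by (simp add: e2_def)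
        qed
      qed
      then have "sat (El IB) (ER IB) (\<Psi> j) e2" using e1(3) by blast
      moreover have "emb k a \<in> El IB" if "a \<in> El IA" for a
        using that IA_subset by (auto simp: emb_def El_def)
      ultimately have "sat (El IB) (ER IB) (Exs (ys j) (\<Psi> j)) e'"
        unfolding sat_Exs using e1(2) by (intro exI[of _ e2]) (simp add: e2_def)
      then show ?thesis unfolding \<Psi>(1) by auto
    qed
  qed
  then show ?thesis
    unfolding models_def \<Phi>(1) sat.simps sat_Alls by blast
qed

end


section \<open>Scott sentences\<close>

text \<open>A binary \<open>And\<close> would leave the class \<open>Pi_in\<close>; interleaving
  keeps a single countable conjunction.\<close>

definition conj_merge :: "(nat \<Rightarrow> form) \<Rightarrow> (nat \<Rightarrow> form) \<Rightarrow> form" where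
  "conj_merge \<Phi> \<Psi> = Conj (\<lambda>i. if even i then \<Phi> (i div 2) else \<Psi> (i div 2))"

lemma all_even_odd: "(\<forall>i::nat. P (if even i then f (i div 2) else g (i div 2))) \<longleftrightarrow> (\<forall>i. P (f i)) \<and> (\<forall>i. P (g i))"
proof (intro iffI conjI allI)
  assume h: "\<forall>i::nat. P (if even i then f (i div 2) else g (i div 2))"
  show "P (f i)" for i using h[rule_format, of "2 * i"] by simp
  show "P (g i)" for i using h[rule_format, of "2 * i + 1"] by simp
qed auto

lemma sat_conj_merge [simp]: "sat B S (conj_merge \<Phi> \<Psi>) e \<longleftrightarrow> sat B S (Conj \<Phi>) e \<and> sat B S (Conj \<Psi>) e"
  unfolding conj_merge_def sat.simps by (rule all_even_odd)

lemma fv_conj_merge: "fv (conj_merge \<Phi> \<Psi>) \<subseteq> fv (Conj \<Phi>) \<union> fv (Conj \<Psi>)"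
  by (auto simp: conj_merge_def split: if_splits)

lemma Pi_in_conj_merge:
  assumes "Pi_in \<alpha> (Conj \<Phi>)" "Pi_in \<alpha> (Conj \<Psi>)" "0 < \<alpha>"
  shows "Pi_in \<alpha> (conj_merge \<Phi> \<Psi>)"
proof -
  obtain \<beta> \<Phi>' xs where \<Phi>: "Conj \<Phi> = Conj (\<lambda>i. Alls (xs i) (\<Phi>' i))" "\<And>i. \<beta> i < \<alpha>" "\<And>i. Sigma_in (\<beta> i) (\<Phi>' i)"
    by (rule Pi_posE[OF assms(1,3)]) (rule that)
  obtain \<gamma> \<Psi>' ys where \<Psi>: "Conj \<Psi> = Conj (\<lambda>i. Alls (ys i) (\<Psi>' i))" "\<And>i. \<gamma> i < \<alpha>" "\<And>i. Sigma_in (\<gamma> i) (\<Psi>' i)"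
    by (rule Pi_posE[OF assms(2,3)]) (rule that)
  let ?m = "\<lambda>f g i. if even i then f (i div 2) else g (i div 2)"
  have "conj_merge \<Phi> \<Psi> = Conj (\<lambda>i. Alls (?m xs ys i) (?m \<Phi>' \<Psi>' i))"
    using \<Phi>(1) \<Psi>(1) by (auto simp: conj_merge_def)
  also have "Pi_in \<alpha> \<dots>"
    by (rule Pi_pos[where \<beta> = "?m \<beta> \<gamma>"]) (simp add: \<Phi> \<Psi>)
  finally show ?thesis .
qed

definition lin_qf :: form where
  "lin_qf = And (Le 1 1) (And (Or (Neg (And (Le 1 2) (Le 2 1))) (Eq 1 2))
     (And (Or (Neg (And (Le 1 2) (Le 2 3))) (Le 1 3)) (Or (Le 1 2) (Le 2 1))))"

text \<open>A constant sequence, in the form that \<open>conj_merge\<close> interleaves with other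
  conjuncts. As the universal closure of a quantifier-free formula, linearity is available at every
  positive level.\<close>

definition lin_conj :: "nat \<Rightarrow> form" where
  "lin_conj i = Alls [1, 2, 3] lin_qf"

lemma sat_lin_conj [simp]: "sat B S (Conj lin_conj) e \<longleftrightarrow> lin B S"
  by (auto simp: lin_conj_def lin_qf_def Alls_def lin_def)

lemma Pi_in_lin_conj:
  assumes "0 < \<alpha>"
  shows "Pi_in \<alpha> (Conj lin_conj)"
  unfolding lin_conj_def
  by (rule Pi_pos[where \<beta> = "\<lambda>_. 0"]) (use assms in \<open>auto simp: lin_qf_def intro!: Sigma_zero\<close>)

lemma fv_lin_conj [simp]: "fv (Conj lin_conj) = {}"
  by (auto simp: lin_conj_def lin_qf_def)

text \<open>Definability speaks of linear orders only, so linearity is conjoined before the point is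
  quantified; the single disjunct is repeated to fit \<open>Disj\<close>.\<close>

lemma Sigma_sentence_ex_point:
  assumes P: "Pi_definable \<alpha> {0} (\<lambda>B S (e :: nat \<Rightarrow> 'a). P B S (e 0))" and pos: "0 < \<alpha>"
  obtains \<phi> where "Sigma_in (succ_ord \<alpha>) \<phi>" "sentence \<phi>"
    "\<And>B S. B \<noteq> {} \<Longrightarrow> models B S \<phi> \<longleftrightarrow> lin B S \<and> (\<exists>p\<in>B. P B S p)"
proof -
  obtain \<psi> where \<psi>: "Pi_in \<alpha> \<psi>" "fv \<psi> \<subseteq> {0}"
    "\<And>B S (e :: nat \<Rightarrow> 'a). lin B S \<Longrightarrow> range e \<subseteq> B \<Longrightarrow> sat B S \<psi> e \<longleftrightarrow> P B S (e 0)"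
    by (rule Pi_definableE[OF P]) (rule that)
  obtain \<Psi> where \<Psi>: "\<psi> = Conj \<Psi>" by (rule Pi_posE[OF \<psi>(1) pos]) (rule that)
  define \<phi> where "\<phi> = Disj (\<lambda>i::nat. Exs [0] (conj_merge lin_conj \<Psi>))"
  have "Pi_in \<alpha> (conj_merge lin_conj \<Psi>)"
    using Pi_in_conj_merge[OF Pi_in_lin_conj[OF pos] _ pos] \<psi>(1) \<Psi> by simp
  then have 1: "Sigma_in (succ_ord \<alpha>) \<phi>"
    unfolding \<phi>_def by (intro Sigma_pos[where \<beta> = "\<lambda>_. \<alpha>"]) simp
  have "fv (conj_merge lin_conj \<Psi>) \<subseteq> {0}"
    using fv_conj_merge[of lin_conj \<Psi>] \<psi>(2) fv_lin_conj unfolding \<Psi> by blast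
  then have 2: "sentence \<phi>" unfolding sentence_def \<phi>_def by auto
  have 3: "models B S \<phi> \<longleftrightarrow> lin B S \<and> (\<exists>p\<in>B. P B S p)" if B: "B \<noteq> {}" for B :: "'a set" and S
  proof -
    have "sat B S \<phi> e \<longleftrightarrow> lin B S \<and> (\<exists>p\<in>B. P B S p)" if e: "range e \<subseteq> B" for e
    proof -
      have "sat B S \<phi> e \<longleftrightarrow> (\<exists>p\<in>B. lin B S \<and> sat B S \<psi> (e(0 := p)))"
        by (simp add: \<phi>_def Exs_def \<Psi> del: sat.simps(7))
      also have "\<dots> \<longleftrightarrow> lin B S \<and> (\<exists>p\<in>B. P B S p)"
      proof (cases "lin B S")
        case True
        have "sat B S \<psi> (e(0 := p)) \<longleftrightarrow> P B S p" if "p \<in> B" for p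
          using \<psi>(3)[OF True, of "e(0 := p)"] e that by auto
        then show ?thesis using True by auto
      qed simp
      finally show ?thesis .
    qed
    \<comment> \<open>In a nonempty domain some assignment exists, so truth under all assignments is
      not vacuous.\<close>
    moreover obtain b where "b \<in> B" using B by blast
    then have "range (\<lambda>_::nat. b) \<subseteq> B" by auto
    ultimately show ?thesis unfolding models_def by blast
  qed
  show ?thesis by (rule that[OF 1 2 3])
qed

lemma nat_copy:
  assumes c: "countable A" and lo: "linear_order_on A R"
  obtains A' :: "nat set" and R' where "isomorphic A R A' R'" "linear_order_on A' R'"
proof -
  let ?f = "to_nat_on A"
  let ?A = "?f ` A"
  define R' where "R' = {(x, y). x \<in> ?A \<and> y \<in> ?A \<and> (from_nat_into A x, from_nat_into A y) \<in> R}"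
  have g: "from_nat_into A (?f x) = x" if "x \<in> A" for x using that c by simp
  have "isomorphic A R ?A R'"
  proof (rule isomorphicI)
    show "bij_betw ?f A ?A" by (rule inj_on_imp_bij_betw[OF inj_on_to_nat_on[OF c]])
    show "(x, y) \<in> R \<longleftrightarrow> (?f x, ?f y) \<in> R'" if "x \<in> A" "y \<in> A" for x y
      using that g by (simp add: R'_def)
  qed
  moreover have r: "refl_on A R" "trans R" "antisym R" "total_on A R"
    using lo by (auto simp: order_on_defs)
  have "linear_order_on ?A R'"
    unfolding order_on_defs
  proof (intro conjI)
    show "R' \<subseteq> ?A \<times> ?A" by (auto simp: R'_def)
    show "refl_on ?A R'" using r(1) g by (auto simp: R'_def refl_on_def)
    show "trans R'" using r(2) unfolding R'_def by (intro transI) (auto dest: transD)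
    show "antisym R'"
    proof (rule antisymI)
      fix x y assume "(x, y) \<in> R'" "(y, x) \<in> R'"
      then obtain a b where "x = ?f a" "y = ?f b" "a \<in> A" "b \<in> A" "(a, b) \<in> R" "(b, a) \<in> R"
        using g by (auto simp: R'_def)
      then show "x = y" using antisymD[OF r(3), of a b] by simp
    qed
    show "total_on ?A R'" using r(4) g unfolding R'_def total_on_def by auto
  qed
  ultimately show ?thesis by (rule that)
qed

lemma isomorphic_nonempty: "isomorphic A R B S \<Longrightarrow> A \<noteq> {} \<Longrightarrow> B \<noteq> {}"
  unfolding isomorphic_def bij_betw_def by blast

lemma isomorphic_inj_image: "inj h \<Longrightarrow> isomorphic B S (h ` B) (map_prod h h ` S)"
  by (rule isomorphicI[of h]) (auto simp: bij_betw_def inj_on_def)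

section \<open>Scott sentences of the cut order\<close>

context limit_orders
begin

lemma canonical_sentence:
  obtains \<phi> where "Sigma_in (succ_ord (succ_ord l)) \<phi>" "sentence \<phi>" "models (El IA) (ER IA) \<phi>"
    "\<And>B S. (B :: elem set) \<noteq> {} \<Longrightarrow> models B S \<phi> \<Longrightarrow> lin B S \<and> (\<exists>p\<in>B. canonical l B S p)"
proof -
  have sl: "0 < succ_ord l" using l_pos order.strict_trans less_succ_ord by blast
  obtain \<phi> where \<phi>: "Sigma_in (succ_ord (succ_ord l)) \<phi>" "sentence \<phi>"
    "\<And>B S. (B :: elem set) \<noteq> {} \<Longrightarrow> models B S \<phi> \<longleftrightarrow> lin B S \<and> (\<exists>p\<in>B. canonical l B S p)"
    by (rule Sigma_sentence_ex_point[OF Pi_definable_canonical[OF lim] sl]) (rule that)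
  interpret A: canonical_order l "El IA" "ER IA" "(iD, {#})" by (rule canonical_order_A)
  have ne: "El IA \<noteq> {}" using A.pB by blast
  have "models (El IA) (ER IA) \<phi>" using \<phi>(3)[OF ne] A.lin A.pB A.canon by blast
  then show ?thesis using that[OF \<phi>(1,2)] \<phi>(3) by blast
qed

lemma El_nonempty: "El IA \<noteq> {}" "El IB \<noteq> {}"
proof -
  have "(iD, {#}) \<in> El IA" "(iD, {#}) \<in> El IB" using iD by simp_all
  then show "El IA \<noteq> {}" "El IB \<noteq> {}" by blast+
qed

text \<open>Having a canonical point is invariant under isomorphism because a sentence expresses it;
  this replaces a transport of the predicate itself.\<close>

lemma IA_IB_not_isomorphic: "\<not> isomorphic (El IA) (ER IA) (El IB) (ER IB)"
proof
  assume iso: "isomorphic (El IA) (ER IA) (El IB) (ER IB)"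
  obtain \<phi> where \<phi>: "models (El IA) (ER IA) \<phi>"
    "\<And>B S. (B :: elem set) \<noteq> {} \<Longrightarrow> models B S \<phi> \<Longrightarrow> lin B S \<and> (\<exists>p\<in>B. canonical l B S p)"
    by (rule canonical_sentence) (rule that)
  have "models (El IB) (ER IB) \<phi>" by (rule models_iso[OF iso \<phi>(1)])
  then show False using \<phi>(2)[OF El_nonempty(2)] not_canonical_IB by blast
qed

lemma no_Pi_scott_sentence:
  fixes A' :: "nat set"
  assumes iso: "isomorphic (El IA) (ER IA) A' R'" and \<chi>: "Pi_in (succ_ord (succ_ord l)) \<chi>"
  shows "\<not> scott_sentence A' R' \<chi>"
proof
  assume s: "scott_sentence A' R' \<chi>"
  obtain B' :: "nat set" and S' where B': "isomorphic (El IB) (ER IB) B' S'"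
    by (rule nat_copy[OF countable_El[OF subset_refl] linear_order_El[OF subset_refl]]) (rule that)
  have ne: "A' \<noteq> {}" "B' \<noteq> {}"
    using isomorphic_nonempty[OF iso El_nonempty(1)] isomorphic_nonempty[OF B' El_nonempty(2)] by blast+
  have "models A' R' \<chi>" "sentence \<chi>" using s ne(1) unfolding scott_sentence_def by auto
  then have "models (El IA) (ER IA) \<chi>" using models_iso[OF isomorphic_sym[OF iso]] by blast
  then have "models (El IB) (ER IB) \<chi>" by (rule Pi_transfer[OF \<chi> \<open>sentence \<chi>\<close>])
  then have "models B' S' \<chi>" by (rule models_iso[OF B'])
  then have "isomorphic A' R' B' S'" using s ne(2) unfolding scott_sentence_def by blast
  then show False
    using IA_IB_not_isomorphic isomorphic_trans[OF isomorphic_trans[OF iso] isomorphic_sym[OF B']] by blast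
qed

lemma Sigma_scott_sentence:
  fixes A' :: "nat set"
  assumes iso: "isomorphic (El IA) (ER IA) A' R'"
  obtains \<phi> where "Sigma_in (succ_ord (succ_ord l)) \<phi>" "scott_sentence A' R' \<phi>"
proof -
  obtain \<phi> where \<phi>: "Sigma_in (succ_ord (succ_ord l)) \<phi>" "sentence \<phi>" "models (El IA) (ER IA) \<phi>"
    "\<And>B S. (B :: elem set) \<noteq> {} \<Longrightarrow> models B S \<phi> \<Longrightarrow> lin B S \<and> (\<exists>p\<in>B. canonical l B S p)"
    by (rule canonical_sentence) (rule that)
  have "isomorphic A' R' B S" if B: "B \<noteq> {}" "models B S \<phi>" for B :: "nat set" and S
  proof -
    \<comment> \<open>The meaning of \<phi> is known for sets of the type \<open>elem\<close> only,
      so structures on natural numbers are moved there by an arbitrary injection.\<close>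
    define h :: "nat \<Rightarrow> elem" where "h n = ((0, real n, 0), {#})" for n
    have "inj h" by (auto simp: h_def inj_def)
    then have h: "isomorphic B S (h ` B) (map_prod h h ` S)" by (rule isomorphic_inj_image)
    have "h ` B \<noteq> {}" using B(1) by simp
    from \<phi>(4)[OF this models_iso[OF h B(2)]] obtain p
      where p: "lin (h ` B) (map_prod h h ` S)" "p \<in> h ` B" "canonical l (h ` B) (map_prod h h ` S) p" by blast
    have "canonical_order l (h ` B) (map_prod h h ` S) p"
      by (rule canonical_order.intro[OF lim p(1) countable_image[OF countableI_type] p(2,3)])
    from canonical_isomorphic[OF canonical_order_A this] show ?thesis
      using isomorphic_trans[OF isomorphic_trans[OF isomorphic_sym[OF iso]] isomorphic_sym[OF h]] by blast
  qed
  moreover have "models B S \<phi>" if "isomorphic A' R' B S" for B :: "nat set" and S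
    by (rule models_iso[OF isomorphic_trans[OF iso that] \<phi>(3)])
  ultimately have "scott_sentence A' R' \<phi>" using \<phi>(2) unfolding scott_sentence_def by blast
  with \<phi>(1) show ?thesis by (rule that)
qed

end

section \<open>Comparison of the complexity classes\<close>

lemma sat_Alls_Nil [simp]: "sat B S (Alls [] \<phi>) e \<longleftrightarrow> sat B S \<phi> e"
  by (simp add: Alls_def)

lemma equivalentI: "(\<And>B S e. sat B S \<phi> (e :: nat \<Rightarrow> nat) \<longleftrightarrow> sat B S \<psi> e) \<Longrightarrow> equivalent \<phi> \<psi>"
  by (simp add: equivalent_def models_def)

lemma class_le_above_Sigma:
  assumes "0 < \<alpha>" "\<alpha> \<le> \<beta>"
  shows "class_le (SigmaC \<alpha>) (SigmaC \<beta>)" "class_le (SigmaC \<alpha>) (dSigmaC \<beta>)"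
    "\<alpha> < \<beta> \<Longrightarrow> class_le (SigmaC \<alpha>) (PiC \<beta>)"
proof -
  show "class_le (SigmaC \<alpha>) (SigmaC \<beta>)"
    unfolding class_le_def using Sigma_in_mono[OF _ assms] by (auto simp: equivalent_def)
  show "class_le (SigmaC \<alpha>) (dSigmaC \<beta>)"
    unfolding class_le_def
  proof (intro allI impI)
    fix \<phi> assume \<phi>: "sentence \<phi> \<and> in_class (SigmaC \<alpha>) \<phi>"
    let ?\<psi> = "And \<phi> (Conj (\<lambda>i::nat. Alls [] (Neg Bot)))"
    have "0 < \<beta>" using assms by simp
    then have "Pi_in \<beta> (Conj (\<lambda>i::nat. Alls [] (Neg Bot)))" by (intro Pi_in_of_Sigma[OF Sigma_zero]) simp
    then have "dSigma_in \<beta> ?\<psi>" unfolding dSigma_in_def using Sigma_in_mono[OF _ assms] \<phi> by auto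
    moreover have "sentence ?\<psi>" using \<phi> by (auto simp: sentence_def)
    moreover have "equivalent \<phi> ?\<psi>" by (rule equivalentI) simp
    ultimately show "\<exists>\<psi>. sentence \<psi> \<and> in_class (dSigmaC \<beta>) \<psi> \<and> equivalent \<phi> \<psi>" by auto
  qed
  show "class_le (SigmaC \<alpha>) (PiC \<beta>)" if lt: "\<alpha> < \<beta>"
    unfolding class_le_def
  proof (intro allI impI)
    fix \<phi> assume \<phi>: "sentence \<phi> \<and> in_class (SigmaC \<alpha>) \<phi>"
    let ?\<psi> = "Conj (\<lambda>i::nat. Alls [] \<phi>)"
    have "Pi_in \<beta> ?\<psi>" using Pi_in_of_Sigma[OF _ lt] \<phi> by simp
    moreover have "sentence ?\<psi>" using \<phi> by (auto simp: sentence_def)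
    moreover have "equivalent \<phi> ?\<psi>" by (rule equivalentI) simp
    ultimately show "\<exists>\<psi>. sentence \<psi> \<and> in_class (PiC \<beta>) \<psi> \<and> equivalent \<phi> \<psi>" by auto
  qed
qed

text \<open>A class not above \<Sigma>_\<alpha> is \<Sigma> or d-\<Sigma> of an index below
  \<alpha>, or \<Pi> of an index at most \<alpha>, and each of these embeds in \<Pi>_\<alpha>.
  Minimality thus reduces to excluding a single class.\<close>

lemma ex_equivalent_Pi:
  assumes \<Delta>: "\<not> class_le (SigmaC \<alpha>) \<Delta>" "0 < complexity_index \<Delta>" "0 < \<alpha>" and \<phi>: "in_class \<Delta> \<phi>" "sentence \<phi>"
  obtains \<psi> where "Pi_in \<alpha> \<psi>" "sentence \<psi>" "equivalent \<phi> \<psi>"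
proof (cases \<Delta>)
  case (SigmaC \<beta>)
  then have lt: "\<beta> < \<alpha>" using \<Delta>(1) class_le_above_Sigma(1)[OF \<Delta>(3)] not_less by blast
  let ?\<psi> = "Conj (\<lambda>i::nat. Alls [] \<phi>)"
  have "Pi_in \<alpha> ?\<psi>" using Pi_in_of_Sigma[OF _ lt] \<phi>(1) SigmaC by simp
  moreover have "sentence ?\<psi>" using \<phi>(2) by (auto simp: sentence_def)
  moreover have "equivalent \<phi> ?\<psi>" by (rule equivalentI) simp
  ultimately show ?thesis by (rule that)
next
  case (PiC \<beta>)
  then have "\<beta> \<le> \<alpha>" using \<Delta>(1) class_le_above_Sigma(3)[OF \<Delta>(3)] by (meson less_imp_le not_less)
  then have "Pi_in \<alpha> \<phi>" using Pi_in_mono \<phi>(1) \<Delta>(2) PiC by simp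
  then show ?thesis using that \<phi>(2) by (simp add: equivalent_def)
next
  case (dSigmaC \<beta>)
  then have lt: "\<beta> < \<alpha>" using \<Delta>(1) class_le_above_Sigma(2)[OF \<Delta>(3)] not_less by blast
  obtain \<phi>1 \<phi>2 where \<phi>12: "\<phi> = And \<phi>1 \<phi>2" "Sigma_in \<beta> \<phi>1" "Pi_in \<beta> \<phi>2"
    using \<phi>(1) dSigmaC by (auto simp: dSigma_in_def)
  have "0 < \<beta>" using \<Delta>(2) dSigmaC by simp
  with \<phi>12(3) obtain \<Phi> where \<Phi>: "\<phi>2 = Conj \<Phi>" by (rule Pi_posE) (rule that)
  let ?\<psi> = "conj_merge (\<lambda>i. Alls [] \<phi>1) \<Phi>"
  have "Pi_in \<alpha> ?\<psi>"
    by (rule Pi_in_conj_merge[OF Pi_in_of_Sigma[OF \<phi>12(2) lt] _ \<Delta>(3)])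
      (use Pi_in_mono[OF \<phi>12(3) \<open>0 < \<beta>\<close>] lt \<Phi> in simp)
  moreover have "sentence ?\<psi>"
    using fv_conj_merge[of "\<lambda>i. Alls [] \<phi>1" \<Phi>] \<phi>(2) unfolding \<phi>12(1) \<Phi> sentence_def by auto
  moreover have "equivalent \<phi> ?\<psi>" by (rule equivalentI) (simp add: \<phi>12(1) \<Phi>)
  ultimately show ?thesis by (rule that)
qed

lemma scott_sentence_equivalent:
  "scott_sentence A R \<phi> \<Longrightarrow> sentence \<psi> \<Longrightarrow> equivalent \<phi> \<psi> \<Longrightarrow> scott_sentence A R \<psi>"
  unfolding scott_sentence_def equivalent_def by blast

theorem mainTheorem5:
  fixes l :: omega1
  assumes "limit_ord l"
  shows "\<exists>(A :: nat set) R. A \<noteq> {} \<and> linear_order_on A R \<and>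
           scott_sentence_complexity A R (SigmaC (succ_ord (succ_ord l)))"
proof -
  interpret limit_orders l by unfold_locales (rule assms)
  let ?\<sigma> = "succ_ord (succ_ord l)"
  obtain A' :: "nat set" and R' where A': "isomorphic (El IA) (ER IA) A' R'" "linear_order_on A' R'"
    by (rule nat_copy[OF countable_El[OF IA_subset] linear_order_El[OF IA_subset]]) (rule that)
  have pos: "0 < ?\<sigma>" using less_succ_ord_iff omega1_zero_le by blast
  obtain \<phi> where \<phi>: "Sigma_in ?\<sigma> \<phi>" "scott_sentence A' R' \<phi>"
    by (rule Sigma_scott_sentence[OF A'(1)]) (rule that)
  have "class_le (SigmaC ?\<sigma>) \<Delta>" if \<Delta>: "0 < complexity_index \<Delta>" "has_scott_sentence_in A' R' \<Delta>" for \<Delta>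
  proof (rule ccontr)
    assume n: "\<not> class_le (SigmaC ?\<sigma>) \<Delta>"
    obtain \<chi> where \<chi>: "in_class \<Delta> \<chi>" "scott_sentence A' R' \<chi>"
      using \<Delta>(2) unfolding has_scott_sentence_in_def by blast
    have "sentence \<chi>" using \<chi>(2) unfolding scott_sentence_def by blast
    then obtain \<psi> where "Pi_in ?\<sigma> \<psi>" "sentence \<psi>" "equivalent \<chi> \<psi>"
      by (rule ex_equivalent_Pi[OF n \<Delta>(1) pos \<chi>(1)]) (rule that)
    then show False
      using no_Pi_scott_sentence[OF A'(1)] scott_sentence_equivalent[OF \<chi>(2)] by blast
  qed
  then have "scott_sentence_complexity A' R' (SigmaC ?\<sigma>)"
    unfolding scott_sentence_complexity_def has_scott_sentence_in_def using \<phi> pos by auto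
  then show ?thesis using A'(2) isomorphic_nonempty[OF A'(1) El_nonempty(1)] by blast
qed

end
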